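(* Let $q\in(0,1)$, $a\in\mathbb{R}$, $t=q^a-q^{-a}$, let $\mathcal{O}_q(S_t^2)$ be the Podleś sphere and $\mathcal{I}_c$ its stabilizer dual. Let $\tilde\pi$ be the representation on the universal $(q+q^{-1},a)$-basic module $\mathcal{M}_{q+q^{-1},a}$ with cyclic vector $e_a$, and let $\pi$ be the $*$-representation of $\mathcal{O}_q(S_t^2)\bowtie\mathcal{I}_c$ on $\mathcal{D}_2^+\oplus\mathcal{D}_2^-\subset\mathcal{M}_{q+q^{-1},a}$. For $b\in\mathcal{O}_q(S_t^2)$ and $x\in\mathcal{I}_c$ put $$\tilde C(bx)=\tilde\pi(bx)e_a-\epsilon(bx)e_a,\qquad C(b)=\tilde\pi(b)e_a-\epsilon(b)e_a .$$ Then $\tilde C$ is a $(\pi,\epsilon)$-$1$-cocycle (on $\mathcal{O}_q(S_t^2)\bowtie\mathcal{I}_c$) and $C$ is a Yetter--Drinfeld $(\pi,\epsilon)$-$1$-cocycle (on $\mathcal{O}_q(S_t^2)$).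
   Context: Notation: $i=\sqrt{-1}$; $[c]=\frac{q^c-q^{-c}}{q-q^{-1}}$, $\llbracket c\rrbracket=q^c-q^{-c}$, $\{c\}=q^c+q^{-c}$ for $c\in\mathbb{R}$, so $t=\llbracket a\rrbracket$. Sweedler notation is used. Inner products are linear in the second variable. Hopf $*$-algebras. $\mathcal{A}=\mathcal{O}_q(SU(2))$ is the unital $*$-algebra generated by $\alpha,\gamma$ with $\alpha^*\alpha+\gamma^*\gamma=1$, $\alpha\alpha^*+q^2\gamma\gamma^*=1$, $\gamma^*\gamma=\gamma\gamma^*$, $\alpha\gamma=q\gamma\alpha$, $\alpha\gamma^*=q\gamma^*\alpha$; $U_{1/2}=\begin{bmatrix}\alpha&-q\gamma^*\\ \gamma&\alpha^*\end{bmatrix}=(u_{jl})$, $\Delta(u_{jl})=\sum_m u_{jm}\otimes u_{ml}$, $\epsilon(u_{jl})=\delta_{jl}$. $U_q(\mathfrak{su}(2))$ is generated by $k^{\pm1},e,f$ with $ke=q^2ek$, $kf=q^{-2}fk$, $[e,f]=\frac{k-k^{-1}}{q-q^{-1}}$, $\Delta(k)=k\otimes k$, $\Delta(e)=e\otimes1+k\otimes e$, $\Delta(f)=1\otimes f+f\otimes k^{-1}$, $\epsilon(k)=1$, $\epsilon(e)=\epsilon(f)=0$, $k^*=k$, $e^*=fk$, $f^*=k^{-1}e$. The unitary pairing of $\mathcal{A}$ and $U_q(\mathfrak{su}(2))$ is given by $(U_{1/2},k)=\mathrm{diag}(q,q^{-1})$, $(U_{1/2},e)=\begin{bmatrix}0&q^{1/2}\\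 0&0\end{bmatrix}$, $(U_{1/2},f)=\begin{bmatrix}0&0\\ q^{-1/2}&0\end{bmatrix}$. For $b\in\mathcal{A}$ and $h\in U_q(\mathfrak{su}(2))$ or $h\in\mathcal{U}=\mathrm{Hom}(\mathcal{A},\mathbb{C})$: $h\rhd b=b_{(1)}(b_{(2)},h)$, $b\lhd h=(b_{(1)},h)b_{(2)}$. For $s\in\frac12\mathbb{Z}_{\ge0}$, $H_s$ is the $(2s+1)$-dimensional irreducible unitary corepresentation of $\mathcal{A}$, with orthonormal weight basis $(\xi^s_j)_{j=-s,\dots,s}$, corresponding representation $\pi_s$ and matrix coefficients $u^s_{\xi,\eta}$; $h\rhd u^s_{\xi,\eta}=u^s_{\xi,h\eta}$, $u^s_{\xi,\eta}\lhd h=u^s_{h^*\xi,\eta}$. The phases of $\xi^1_j$ are such that the elements $T_c^\pm,A_c$ below lie in $\mathcal{O}_q(S_t^2)$. Podleś sphere. $B_t=-q^{1/2}k^{-1}e+q^{1/2}f-i(q-q^{-1})^{-1}t\,k^{-1}$, $I=\mathbb{C}[B_t]$, $\mathcal{O}_q(S_t^2)=\{b\in\mathcal{A}: h\rhd b=\epsilon(h)b\ \forall h\in I\}$, a unital left coideal $*$-subalgebra. $\pi_s(iB_t)$ is diagonalizable with eigenvalues $[a+2j]$, $j=-s,\dots,s$. $U_q(\mathfrak{sl}(2,\mathbb{R})_t)=\mathcal{O}_q(S_t^2)\bowtie I$ is the $*$-algebra spanned by products $by$ ($b\in\mathcal{O}_q(S_t^2)$, $y\in I$) with relations $by=y_{(1)}(b\lhd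 y_{(2)})$, $yb=(b\lhd S^{-1}(y_{(2)}))y_{(1)}$. Stabilizer dual. $\mathcal{I}_c=\bigoplus_{n\in\mathbb{Z}}\mathbb{B}(\mathbb{C}_n)\subset\mathcal{U}$, where $\mathbb{C}_n$ is the one-dimensional space on which $iB_t$ acts as $[a+2n]$; $\Phi_n$ is the projection onto the $n$-th summand. $\mathcal{O}_q(S_t^2)\bowtie\mathcal{I}_c$ is the $*$-subalgebra generated by $\mathcal{O}_q(S_t^2)$ and $\mathcal{I}_c$ in the Drinfeld double $\mathcal{A}\bowtie\mathcal{U}$, with the same commutation relations (now $y\in\mathcal{I}_c$). In a $U_q(\mathfrak{sl}(2,\mathbb{R})_t)$-module where $iB_t$ is diagonalizable with eigenvalues of the form $[a+2n]$, $\Phi_n$ acts as the projection onto the $[a+2n]$-eigenspace, which gives the corresponding representation of $\mathcal{O}_q(S_t^2)\bowtie\mathcal{I}_c$. $\epsilon$ is the counit, $\epsilon(bx)=\epsilon(b)\epsilon(x)$. Basic modules. For $c\in\mathbb{R}$ put in $H_1$ $\xi^{(\llbracket c\rrbracket;1)}=q^{1/2}\xi^1_1-\frac{i\llbracket c\rrbracket}{\sqrt{q+q^{-1}}}\xi^1_0+q^{-1/2}\xi^1_{-1}$, $\xi_+^{(\llbracket c\rrbracket;1)}=-q^{-c-1/2}\xi^1_1+i\sqrt{q+q^{-1}}\,\xi^1_0+q^{c+1/2}\xi^1_{-1}$, $\xi_-^{(\llbracket c\rrbracket;1)}=q^{c-1/2}\xi^1_1+i\sqrt{q+q^{-1}}\,\xi^1_0-q^{-c+1/2}\xi^1_{-1}$,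 and $T_c^\pm=u^1_{\xi_\pm^{(\llbracket c\rrbracket;1)},\xi^{(t;1)}}$, $A_c=u^1_{\xi^{(\llbracket c\rrbracket;1)},\xi^{(t;1)}}-(q+q^{-1})^{-1}\llbracket c\rrbracket t$. On the $[c]$-eigenspace of $iB_t$ in any $U_q(\mathfrak{sl}(2,\mathbb{R})_t)$-module, $A_c$ preserves the eigenvalue and $T_c^\pm$ maps into the $[c\pm2]$-eigenspace. A module is $(\lambda,b)$-basic if it has a cyclic vector $\xi$ with $iB_t\xi=[b]\xi$ and $A_b\xi=\lambda\xi$. $\mathcal{M}_{\lambda,b}$ is the universal $(\lambda,b)$-basic module: every $(\lambda,b)$-basic module is a quotient of it. It has cyclic vector $e_b$ and basis $\{e_{b+2n}\}_{n\in\mathbb{Z}}$, where for $n\ge1$ $e_{b+2n}=T^+_{b+2n-2}\cdots T^+_be_b$ and $e_{b-2n}=T^-_{b-2n+2}\cdots T^-_be_b$, and $iB_te_{b+2n}=[b+2n]e_{b+2n}$. It carries a $*$-invariant sesquilinear form, unique up to normalization, with kernel $\mathcal{N}_{\lambda,b}$, and $\mathcal{L}_{\lambda,b}=\mathcal{M}_{\lambda,b}/\mathcal{N}_{\lambda,b}$. The discrete series representations are $\mathcal{D}_2^\pm=\mathcal{L}_{q+q^{-1},a\pm2}$, and the trivial representation is $\mathcal{L}_{q+q^{-1},a}$. There is an exact sequence of representations of $\mathcal{O}_q(S_t^2)\bowtie\mathcal{I}_c$ $$0\to\mathcal{D}_2^+\oplus\mathcal{D}_2^-\to\mathcal{M}_{q+q^{-1},a}\to\mathcal{L}_{q+q^{-1},a}\to0,$$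 whose first map is $e_{a+2n}\mapsto e_{a+2n}$ ($n\ne0$) and whose second map is the canonical projection; through it $\mathcal{D}_2^+\oplus\mathcal{D}_2^-$ is regarded as a submodule of $\mathcal{M}_{q+q^{-1},a}$. It is equipped with an invariant inner product. Cocycles. For a $*$-algebra $\mathcal{X}$ with counit $\epsilon$ and a $*$-representation $\pi$ on a pre-Hilbert space $\mathcal{H}$, a linear map $C:\mathcal{X}\to\mathcal{H}$ is a $(\pi,\epsilon)$-$1$-cocycle if $C(xy)=\pi(x)C(y)+C(x)\epsilon(y)$ for all $x,y\in\mathcal{X}$. A $(\pi,\epsilon)$-$1$-cocycle $C$ on $\mathcal{O}_q(S_t^2)$ is Yetter--Drinfeld if $\pi(\omega)C(x)=C(x\lhd S^{-1}(\omega))$ for all $x\in\mathcal{O}_q(S_t^2)$, $\omega\in\mathcal{I}_c$.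
   Formalization: As printed, A_c and T_c^± do not shift the eigenvalues of iB_t as claimed (their adjoints do), and the universal modules collapse; the formal theorem is stated both with A_c, T_c^± acting through their adjoints and with the printed elements. *)

theory Defs
  imports "HOL-Analysis.Analysis" "HOL-Library.Poly_Mapping"
begin

section \<open>Complex vector spaces and complex *-algebras\<close>

class complex_vector = ab_group_add +
  fixes scaleC :: "complex \<Rightarrow> 'a \<Rightarrow> 'a" (infixr "*\<^sub>C" 75)
  assumes scaleC_right_distrib: "c *\<^sub>C (x + y) = c *\<^sub>C x + c *\<^sub>C y"
    and scaleC_left_distrib: "(c + d) *\<^sub>C x = c *\<^sub>C x + d *\<^sub>C x"
    and scaleC_scaleC: "c *\<^sub>C d *\<^sub>C x = (c * d) *\<^sub>C x"
    and scaleC_one: "1 *\<^sub>C x = x"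

class star_algebra = complex_vector + ring_1 +
  fixes star :: "'a \<Rightarrow> 'a"
  assumes mult_scaleC_left: "(c *\<^sub>C x) * y = c *\<^sub>C (x * y)"
    and mult_scaleC_right: "x * (c *\<^sub>C y) = c *\<^sub>C (x * y)"
    and star_add: "star (x + y) = star x + star y"
    and star_scaleC: "star (c *\<^sub>C x) = cnj c *\<^sub>C star x"
    and star_mult: "star (x * y) = star y * star x"
    and star_star: "star (star x) = x"

interpretation cvec: vector_space "scaleC :: complex \<Rightarrow> 'a \<Rightarrow> 'a::complex_vector"
  by unfold_locales
    (simp_all add: scaleC_right_distrib scaleC_left_distrib scaleC_scaleC scaleC_one)

abbreviation clinear :: "('a::complex_vector \<Rightarrow> 'b::complex_vector) \<Rightarrow> bool" where
  "clinear \<equiv> Vector_Spaces.linear scaleC scaleC"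

instantiation complex :: complex_vector
begin
definition "scaleC_complex (c::complex) (x::complex) = c * x"
instance by standard (simp_all add: scaleC_complex_def algebra_simps)
end

instantiation prod :: (complex_vector, complex_vector) complex_vector
begin
definition "scaleC_prod (c::complex) (x::'a \<times> 'b) = (c *\<^sub>C fst x, c *\<^sub>C snd x)"
instance
  by standard
    (simp_all add: scaleC_prod_def scaleC_right_distrib scaleC_left_distrib scaleC_scaleC
      scaleC_one)
end

instantiation poly_mapping :: (type, complex_vector) complex_vector
begin
definition "scaleC_poly_mapping (c::complex) (p::'a \<Rightarrow>\<^sub>0 'b) = Poly_Mapping.map (\<lambda>x. c *\<^sub>C x) p"
instance
proof
  fix c d :: complex and x y :: "'a \<Rightarrow>\<^sub>0 'b"
  have l: "Poly_Mapping.lookup (b *\<^sub>C z) k = b *\<^sub>C Poly_Mapping.lookup z k" for b :: complex and z :: "'a \<Rightarrow>\<^sub>0 'b" and k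
    by (simp add: scaleC_poly_mapping_def Poly_Mapping.map.rep_eq when_def)
  show "c *\<^sub>C (x + y) = c *\<^sub>C x + c *\<^sub>C y"
    by (rule poly_mapping_eqI) (simp add: l lookup_add scaleC_right_distrib)
  show "(c + d) *\<^sub>C x = c *\<^sub>C x + d *\<^sub>C x"
    by (rule poly_mapping_eqI) (simp add: l lookup_add scaleC_left_distrib)
  show "c *\<^sub>C d *\<^sub>C x = (c * d) *\<^sub>C x"
    by (rule poly_mapping_eqI) (simp add: l scaleC_scaleC)
  show "1 *\<^sub>C x = x"
    by (rule poly_mapping_eqI) (simp add: l scaleC_one)
qed
end

inductive_set star_gen :: "'a::star_algebra set \<Rightarrow> 'a set" for S :: "'a set" where
  base: "x \<in> S \<Longrightarrow> x \<in> star_gen S"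
| add: "x \<in> star_gen S \<Longrightarrow> y \<in> star_gen S \<Longrightarrow> x + y \<in> star_gen S"
| scale: "x \<in> star_gen S \<Longrightarrow> c *\<^sub>C x \<in> star_gen S"
| mult: "x \<in> star_gen S \<Longrightarrow> y \<in> star_gen S \<Longrightarrow> x * y \<in> star_gen S"
| star: "x \<in> star_gen S \<Longrightarrow> star x \<in> star_gen S"


section \<open>Presentations by generators and relations\<close>

datatype 'g word = Word (letters: "'g list")

instantiation word :: (type) monoid_add
begin
definition "zero_word = Word []"
definition "plus_word u v = Word (letters u @ letters v)"
instance by standard (simp_all add: zero_word_def plus_word_def)
end

text \<open>With words under concatenation as an additive monoid, the convolution product of
  \<^typ>\<open>'g word \<Rightarrow>\<^sub>0 complex\<close> is the product of the free unital algebra on \<^typ>\<open>'g\<close>.\<close>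

type_synonym 'g free_alg = "'g word \<Rightarrow>\<^sub>0 complex"

definition gen :: "'g \<Rightarrow> 'g free_alg" where
  "gen g = Poly_Mapping.single (Word [g]) 1"

definition eval_free :: "('g \<Rightarrow> 'a::star_algebra) \<Rightarrow> 'g free_alg \<Rightarrow> 'a" where
  "eval_free \<phi> p = (\<Sum>w\<in>Poly_Mapping.keys p. Poly_Mapping.lookup p w *\<^sub>C prod_list (map \<phi> (letters w)))"

inductive_set two_sided_ideal :: "'r::ring_1 set \<Rightarrow> 'r set" for R :: "'r set" where
  zero: "0 \<in> two_sided_ideal R"
| add: "r \<in> R \<Longrightarrow> x \<in> two_sided_ideal R \<Longrightarrow> u * r * v + x \<in> two_sided_ideal R"

definition presented_by :: "('g \<Rightarrow> 'a::star_algebra) \<Rightarrow> 'g free_alg set \<Rightarrow> bool" where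
  "presented_by \<phi> R \<longleftrightarrow> surj (eval_free \<phi>) \<and> (\<forall>p. eval_free \<phi> p = 0 \<longleftrightarrow> p \<in> two_sided_ideal R)"


section \<open>Hopf *-algebras and their duals\<close>

text \<open>An element of an algebraic tensor product is given by a list of pairs standing for the sum of
  the corresponding elementary tensors (Sweedler notation).  Linear functionals separate the points
  of an algebraic tensor product, so \<open>tens_eq\<close> is equality of the represented tensors.\<close>

definition tens_eq :: "('a::complex_vector \<times> 'b::complex_vector) list \<Rightarrow> ('a \<times> 'b) list \<Rightarrow> bool" where
  "tens_eq ps rs \<longleftrightarrow> (\<forall>(\<phi>::'a \<Rightarrow> complex) (\<psi>::'b \<Rightarrow> complex). clinear \<phi> \<longrightarrow> clinear \<psi> \<longrightarrow>
     (\<Sum>(x, y)\<leftarrow>ps. \<phi> x * \<psi> y) = (\<Sum>(x, y)\<leftarrow>rs. \<phi> x * \<psi> y))"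

record 'a hopf =
  coprod :: "'a \<Rightarrow> ('a \<times> 'a) list"
  counit :: "'a \<Rightarrow> complex"
  antip :: "'a \<Rightarrow> 'a"

definition hopf_star_algebra :: "('a::star_algebra) hopf \<Rightarrow> bool" where
  "hopf_star_algebra H \<longleftrightarrow>
    (\<forall>x y. tens_eq (coprod H (x + y)) (coprod H x @ coprod H y)) \<and>
    (\<forall>c x. tens_eq (coprod H (c *\<^sub>C x)) (map (\<lambda>(y, z). (c *\<^sub>C y, z)) (coprod H x))) \<and>
    tens_eq (coprod H 1) [(1, 1)] \<and>
    (\<forall>x y. tens_eq (coprod H (x * y))
       [(x1 * y1, x2 * y2). (x1, x2) \<leftarrow> coprod H x, (y1, y2) \<leftarrow> coprod H y]) \<and>
    (\<forall>x. tens_eq (coprod H (star x)) (map (\<lambda>(y, z). (star y, star z)) (coprod H x))) \<and>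
    (\<forall>x (\<phi>::'a \<Rightarrow> complex) (\<psi>::'a \<Rightarrow> complex) (\<theta>::'a \<Rightarrow> complex).
       clinear \<phi> \<longrightarrow> clinear \<psi> \<longrightarrow> clinear \<theta> \<longrightarrow>
       (\<Sum>(y, z)\<leftarrow>coprod H x. \<Sum>(y1, y2)\<leftarrow>coprod H y. \<phi> y1 * \<psi> y2 * \<theta> z) =
       (\<Sum>(y, z)\<leftarrow>coprod H x. \<Sum>(z1, z2)\<leftarrow>coprod H z. \<phi> y * \<psi> z1 * \<theta> z2)) \<and>
    clinear (counit H) \<and> counit H 1 = 1 \<and>
    (\<forall>x y. counit H (x * y) = counit H x * counit H y) \<and>
    (\<forall>x. counit H (star x) = cnj (counit H x)) \<and>
    (\<forall>x. (\<Sum>(y, z)\<leftarrow>coprod H x. counit H y *\<^sub>C z) = x) \<and>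
    (\<forall>x. (\<Sum>(y, z)\<leftarrow>coprod H x. counit H z *\<^sub>C y) = x) \<and>
    clinear (antip H) \<and>
    (\<forall>x. (\<Sum>(y, z)\<leftarrow>coprod H x. antip H y * z) = counit H x *\<^sub>C 1) \<and>
    (\<forall>x. (\<Sum>(y, z)\<leftarrow>coprod H x. y * antip H z) = counit H x *\<^sub>C 1)"

text \<open>The antipode of a Hopf *-algebra is bijective.\<close>

definition antip_inv :: "('a::star_algebra) hopf \<Rightarrow> 'a \<Rightarrow> 'a" where
  "antip_inv H = inv (antip H)"

text \<open>The full dual \<open>Hom(A, C)\<close>, its convolution product and its involution
  (the one making the evaluation pairing unitary).\<close>

definition dual_of :: "('a::star_algebra) hopf \<Rightarrow> ('a \<Rightarrow> complex) set" where
  "dual_of H = {\<omega>. clinear \<omega>}"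

definition conv :: "('a::star_algebra) hopf \<Rightarrow> ('a \<Rightarrow> complex) \<Rightarrow> ('a \<Rightarrow> complex) \<Rightarrow> 'a \<Rightarrow> complex" where
  "conv H \<omega> \<omega>' = (\<lambda>x. \<Sum>(y, z)\<leftarrow>coprod H x. \<omega> y * \<omega>' z)"

definition dual_star :: "('a::star_algebra) hopf \<Rightarrow> ('a \<Rightarrow> complex) \<Rightarrow> 'a \<Rightarrow> complex" where
  "dual_star H \<omega> = (\<lambda>x. cnj (\<omega> (star (antip H x))))"

definition dual_antip_inv :: "('a::star_algebra) hopf \<Rightarrow> ('a \<Rightarrow> complex) \<Rightarrow> 'a \<Rightarrow> complex" where
  "dual_antip_inv H \<omega> = (\<lambda>x. \<omega> (antip_inv H x))"

text \<open>The actions \<open>h \<rhd> b = b\<^sub>1 (b\<^sub>2, h)\<close> and \<open>b \<lhd> h = (b\<^sub>1, h) b\<^sub>2\<close>.\<close>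

definition lact :: "('a::star_algebra) hopf \<Rightarrow> ('a \<Rightarrow> complex) \<Rightarrow> 'a \<Rightarrow> 'a" where
  "lact H \<omega> b = (\<Sum>(y, z)\<leftarrow>coprod H b. \<omega> z *\<^sub>C y)"

definition ract :: "('a::star_algebra) hopf \<Rightarrow> 'a \<Rightarrow> ('a \<Rightarrow> complex) \<Rightarrow> 'a" where
  "ract H b \<omega> = (\<Sum>(y, z)\<leftarrow>coprod H b. \<omega> y *\<^sub>C z)"

definition corep :: "('a::star_algebra) hopf \<Rightarrow> 'i list \<Rightarrow> ('i \<Rightarrow> 'i \<Rightarrow> 'a) \<Rightarrow> bool" where
  "corep H js v \<longleftrightarrow> distinct js \<and> (\<forall>j\<in>set js. \<forall>l\<in>set js.
     tens_eq (coprod H (v j l)) [(v j m, v m l). m \<leftarrow> js] \<and> counit H (v j l) = (if j = l then 1 else 0))"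

definition unitary_corep :: "('a::star_algebra) hopf \<Rightarrow> 'i list \<Rightarrow> ('i \<Rightarrow> 'i \<Rightarrow> 'a) \<Rightarrow> bool" where
  "unitary_corep H js v \<longleftrightarrow> corep H js v \<and> (\<forall>j\<in>set js. \<forall>l\<in>set js.
     (\<Sum>m\<in>set js. star (v m j) * v m l) = (if j = l then 1 else 0) \<and>
     (\<Sum>m\<in>set js. v j m * star (v l m)) = (if j = l then 1 else 0))"

text \<open>The representation of the dual attached to a corepresentation:
  \<open>\<omega>\<close> acts on coordinate vectors by the matrix \<open>(\<omega> (v j l))\<close>.\<close>

definition dual_rep :: "'i list \<Rightarrow> ('i \<Rightarrow> 'i \<Rightarrow> 'a) \<Rightarrow> ('a \<Rightarrow> complex) \<Rightarrow> ('i \<Rightarrow> complex) \<Rightarrow> 'i \<Rightarrow> complex" where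
  "dual_rep js v \<omega> \<xi> = (\<lambda>j. if j \<in> set js then (\<Sum>l\<in>set js. \<omega> (v j l) * \<xi> l) else 0)"

definition irreducible_corep :: "('a::star_algebra) hopf \<Rightarrow> 'i list \<Rightarrow> ('i \<Rightarrow> 'i \<Rightarrow> 'a) \<Rightarrow> bool" where
  "irreducible_corep H js v \<longleftrightarrow> js \<noteq> [] \<and> corep H js v \<and>
    (\<forall>W. W \<subseteq> {\<xi>. \<forall>j. j \<notin> set js \<longrightarrow> \<xi> j = 0} \<and> (\<lambda>_. 0) \<in> W \<and>
       (\<forall>\<xi>\<in>W. \<forall>\<eta>\<in>W. (\<lambda>j. \<xi> j + \<eta> j) \<in> W) \<and> (\<forall>c. \<forall>\<xi>\<in>W. (\<lambda>j. c * \<xi> j) \<in> W) \<and>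
       (\<forall>\<omega>\<in>dual_of H. \<forall>\<xi>\<in>W. dual_rep js v \<omega> \<xi> \<in> W) \<longrightarrow>
       W = {\<lambda>_. 0} \<or> W = {\<xi>. \<forall>j. j \<notin> set js \<longrightarrow> \<xi> j = 0})"

definition unitary_pairing ::
  "('a::star_algebra) hopf \<Rightarrow> ('u::star_algebra) hopf \<Rightarrow> ('a \<Rightarrow> 'u \<Rightarrow> complex) \<Rightarrow> bool" where
  "unitary_pairing H K pr \<longleftrightarrow>
    (\<forall>h. clinear (\<lambda>b. pr b h)) \<and> (\<forall>b. clinear (pr b)) \<and>
    (\<forall>b h h'. pr b (h * h') = (\<Sum>(y, z)\<leftarrow>coprod H b. pr y h * pr z h')) \<and>
    (\<forall>b b' h. pr (b * b') h = (\<Sum>(y, z)\<leftarrow>coprod K h. pr b y * pr b' z)) \<and>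
    (\<forall>b. pr b 1 = counit H b) \<and> (\<forall>h. pr 1 h = counit K h) \<and>
    (\<forall>b h. pr (antip H b) h = pr b (antip K h)) \<and>
    (\<forall>b h. pr (star b) h = cnj (pr b (star (antip K h)))) \<and>
    (\<forall>b h. pr b (star h) = cnj (pr (star (antip H b)) h))"


section \<open>The quantum group SU(2) and its enveloping algebra\<close>

definition qint :: "real \<Rightarrow> real \<Rightarrow> real" where
  "qint q c = (q powr c - q powr (-c)) / (q - 1 / q)"

definition qdiff :: "real \<Rightarrow> real \<Rightarrow> real" where
  "qdiff q c = q powr c - q powr (-c)"

datatype su2_gen = Al | AlS | Ga | GaS

definition fund :: "real \<Rightarrow> 'a::star_algebra \<Rightarrow> 'a \<Rightarrow> nat \<Rightarrow> nat \<Rightarrow> 'a" where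
  "fund q \<alpha> \<gamma> j l =
     (if j = 0 then if l = 0 then \<alpha> else (- complex_of_real q) *\<^sub>C star \<gamma>
      else if l = 0 then \<gamma> else star \<alpha>)"

text \<open>The relations of \<open>O\<^sub>q(SU(2))\<close> as a *-algebra, as relations between the letters
  \<open>\<alpha>, \<alpha>\<^sup>*, \<gamma>, \<gamma>\<^sup>*\<close>: those that are not self-adjoint are listed with their adjoints.\<close>

definition su2_rels :: "real \<Rightarrow> su2_gen free_alg set" where
  "su2_rels q = (let s = complex_of_real q; A = gen Al; A' = gen AlS; G = gen Ga; G' = gen GaS in
     {A' * A + G' * G - 1,
      A * A' + (s\<^sup>2) *\<^sub>C (G * G') - 1,
      G' * G - G * G',
      A * G - s *\<^sub>C (G * A), G' * A' - s *\<^sub>C (A' * G'),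
      A * G' - s *\<^sub>C (G' * A), G * A' - s *\<^sub>C (A' * G)})"

definition Oq_SU2 :: "real \<Rightarrow> ('a::star_algebra) hopf \<Rightarrow> 'a \<Rightarrow> 'a \<Rightarrow> bool" where
  "Oq_SU2 q H \<alpha> \<gamma> \<longleftrightarrow> hopf_star_algebra H \<and>
     presented_by (\<lambda>g. case g of Al \<Rightarrow> \<alpha> | AlS \<Rightarrow> star \<alpha> | Ga \<Rightarrow> \<gamma> | GaS \<Rightarrow> star \<gamma>) (su2_rels q) \<and>
     corep H [0, 1] (fund q \<alpha> \<gamma>)"

datatype uq_gen = Kg | Ki | Eg | Fg

definition uq_rels :: "real \<Rightarrow> uq_gen free_alg set" where
  "uq_rels q = (let s = complex_of_real q; K = gen Kg; K' = gen Ki; E = gen Eg; F = gen Fg in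
     {K * K' - 1, K' * K - 1,
      K * E - (s\<^sup>2) *\<^sub>C (E * K),
      K * F - (1 / s\<^sup>2) *\<^sub>C (F * K),
      E * F - F * E - (1 / (s - 1 / s)) *\<^sub>C (K - K')})"

definition Uq_su2 :: "real \<Rightarrow> ('u::star_algebra) hopf \<Rightarrow> 'u \<Rightarrow> 'u \<Rightarrow> 'u \<Rightarrow> 'u \<Rightarrow> bool" where
  "Uq_su2 q K k k' e f \<longleftrightarrow> hopf_star_algebra K \<and>
     presented_by (\<lambda>g. case g of Kg \<Rightarrow> k | Ki \<Rightarrow> k' | Eg \<Rightarrow> e | Fg \<Rightarrow> f) (uq_rels q) \<and>
     star k = k \<and> star e = f * k \<and> star f = k' * e \<and>
     tens_eq (coprod K k) [(k, k)] \<and>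
     tens_eq (coprod K e) [(e, 1), (k, e)] \<and>
     tens_eq (coprod K f) [(1, f), (f, k')] \<and>
     counit K k = 1 \<and> counit K e = 0 \<and> counit K f = 0"

definition fund_pairing ::
  "real \<Rightarrow> 'a::star_algebra \<Rightarrow> 'a \<Rightarrow> 'u \<Rightarrow> 'u \<Rightarrow> 'u \<Rightarrow> ('a \<Rightarrow> 'u \<Rightarrow> complex) \<Rightarrow> bool" where
  "fund_pairing q \<alpha> \<gamma> k e f pr \<longleftrightarrow> (let u = fund q \<alpha> \<gamma> in
     pr (u 0 0) k = of_real q \<and> pr (u 0 1) k = 0 \<and> pr (u 1 0) k = 0 \<and> pr (u 1 1) k = of_real (1 / q) \<and>
     pr (u 0 0) e = 0 \<and> pr (u 0 1) e = of_real (sqrt q) \<and> pr (u 1 0) e = 0 \<and> pr (u 1 1) e = 0 \<and>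
     pr (u 0 0) f = 0 \<and> pr (u 0 1) f = 0 \<and> pr (u 1 0) f = of_real (1 / sqrt q) \<and> pr (u 1 1) f = 0)"

text \<open>The Drinfeld double of a Hopf *-algebra and its full dual: a *-algebra containing both, which
  is their algebraic tensor product as a vector space (the last two clauses; a tensor
  \<open>\<Sum> b\<^sub>i \<otimes> \<omega>\<^sub>i\<close> vanishes iff \<open>\<Sum> \<omega>\<^sub>i(x) b\<^sub>i = 0\<close> for all \<open>x\<close>), with the exchange relation
  \<open>\<omega> b = (\<omega>\<^sub>1 \<rhd> b \<lhd> S\<^sup>-(\<omega>\<^sub>3)) \<omega>\<^sub>2\<close>, where \<open>S\<^sup>-\<close> is the inverse antipode.  Written with the
  coproduct of \<open>b\<close> it reads \<open>\<omega> b = b\<^sub>2 \<omega>(b\<^sub>3 \<cdot> S\<^sup>-(b\<^sub>1))\<close>; equivalently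
  \<open>(\<omega>\<^sub>1 \<rhd> b) \<omega>\<^sub>2 = \<omega>\<^sub>1 (b \<lhd> \<omega>\<^sub>2)\<close>.  If \<open>\<omega>\<close> lies in a right coideal acting trivially
  on \<open>b\<close> from the left, this becomes \<open>b \<omega> = \<omega>\<^sub>1 (b \<lhd> \<omega>\<^sub>2)\<close>, \<open>\<omega> b = (b \<lhd> S\<^sup>-(\<omega>\<^sub>2)) \<omega>\<^sub>1\<close>.\<close>

definition drinfeld_double ::
  "('a::star_algebra) hopf \<Rightarrow> ('a \<Rightarrow> 'x::star_algebra) \<Rightarrow> (('a \<Rightarrow> complex) \<Rightarrow> 'x) \<Rightarrow> bool" where
  "drinfeld_double H jA jU \<longleftrightarrow>
    clinear jA \<and> jA 1 = 1 \<and> (\<forall>b b'. jA (b * b') = jA b * jA b') \<and> (\<forall>b. jA (star b) = star (jA b)) \<and>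
    (\<forall>\<omega>\<in>dual_of H. \<forall>\<omega>'\<in>dual_of H. jU (\<lambda>x. \<omega> x + \<omega>' x) = jU \<omega> + jU \<omega>') \<and>
    (\<forall>c. \<forall>\<omega>\<in>dual_of H. jU (\<lambda>x. c * \<omega> x) = c *\<^sub>C jU \<omega>) \<and>
    jU (counit H) = 1 \<and>
    (\<forall>\<omega>\<in>dual_of H. \<forall>\<omega>'\<in>dual_of H. jU (conv H \<omega> \<omega>') = jU \<omega> * jU \<omega>') \<and>
    (\<forall>\<omega>\<in>dual_of H. jU (dual_star H \<omega>) = star (jU \<omega>)) \<and>
    (\<forall>\<omega>\<in>dual_of H. \<forall>b. jU \<omega> * jA b =
       (\<Sum>(b1, c)\<leftarrow>coprod H b. \<Sum>(b2, b3)\<leftarrow>coprod H c. jA b2 * jU (\<lambda>x. \<omega> (b3 * x * antip_inv H b1)))) \<and>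
    (\<forall>y. \<exists>ps. set ps \<subseteq> UNIV \<times> dual_of H \<and> y = (\<Sum>(b, \<omega>)\<leftarrow>ps. jA b * jU \<omega>)) \<and>
    (\<forall>ps. set ps \<subseteq> UNIV \<times> dual_of H \<and> (\<Sum>(b, \<omega>)\<leftarrow>ps. jA b * jU \<omega>) = 0 \<longrightarrow>
       (\<forall>x. (\<Sum>(b, \<omega>)\<leftarrow>ps. \<omega> x *\<^sub>C b) = 0))"


section \<open>The Podles sphere and its stabilizer\<close>

record ('a, 'u, 'x) podles =
  hopfA :: "'a hopf"
  alpha :: 'a
  gamma :: 'a
  hopfU :: "'u hopf"
  kU :: 'u
  kinvU :: 'u
  eU :: 'u
  fU :: 'u
  pair :: "'a \<Rightarrow> 'u \<Rightarrow> complex"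
  incA :: "'a \<Rightarrow> 'x"
  incU :: "('a \<Rightarrow> complex) \<Rightarrow> 'x"
  epsX :: "'x \<Rightarrow> complex"
  spin1 :: "int \<Rightarrow> int \<Rightarrow> 'a"

definition fun_of :: "('a, 'u, 'x) podles \<Rightarrow> 'u \<Rightarrow> 'a \<Rightarrow> complex" where
  "fun_of D h = (\<lambda>b. pair D b h)"

definition Bt :: "('a, 'u::star_algebra, 'x) podles \<Rightarrow> real \<Rightarrow> real \<Rightarrow> 'u" where
  "Bt D q a = (- complex_of_real (sqrt q)) *\<^sub>C (kinvU D * eU D) + complex_of_real (sqrt q) *\<^sub>C fU D
     - (\<i> * complex_of_real (qdiff q a / (q - 1 / q))) *\<^sub>C kinvU D"

definition coideal_I :: "('a, 'u::star_algebra, 'x) podles \<Rightarrow> real \<Rightarrow> real \<Rightarrow> 'u set" where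
  "coideal_I D q a = cvec.span (range (\<lambda>n::nat. Bt D q a ^ n))"

definition Oq_sphere :: "('a::star_algebra, 'u::star_algebra, 'x) podles \<Rightarrow> real \<Rightarrow> real \<Rightarrow> 'a set" where
  "Oq_sphere D q a =
     {b. \<forall>h\<in>coideal_I D q a. lact (hopfA D) (fun_of D h) b = counit (hopfU D) h *\<^sub>C b}"

text \<open>The *-algebra \<open>U\<^sub>q(sl(2,R)\<^sub>t)\<close> is realised inside the double, \<open>U\<^sub>q(su(2))\<close> being embedded in the
  full dual through its (nondegenerate) pairing; \<open>iBt\<close> is the element \<open>i B\<^sub>t\<close> of the double.\<close>

definition iBt :: "('a::star_algebra, 'u::star_algebra, 'x::star_algebra) podles \<Rightarrow> real \<Rightarrow> real \<Rightarrow> 'x" where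
  "iBt D q a = incU D (fun_of D (\<i> *\<^sub>C Bt D q a))"

definition Uq_sl2R ::
  "('a::star_algebra, 'u::star_algebra, 'x::star_algebra) podles \<Rightarrow> real \<Rightarrow> real \<Rightarrow> 'x set" where
  "Uq_sl2R D q a =
     star_gen (incA D ` Oq_sphere D q a \<union> (\<lambda>h. incU D (fun_of D h)) ` coideal_I D q a)"

text \<open>\<open>\<Phi>\<^sub>n\<close> as an element of the full dual: in every finite-dimensional corepresentation it acts as
  the projection onto the \<open>[a+2n]\<close>-eigenspace of \<open>i B\<^sub>t\<close> along the other eigenspaces.
  As \<open>i B\<^sub>t\<close> acts diagonalizably and matrix coefficients span, this determines it.\<close>

definition is_Phi ::
  "('a::star_algebra, 'u::star_algebra, 'x) podles \<Rightarrow> real \<Rightarrow> real \<Rightarrow> int \<Rightarrow> ('a \<Rightarrow> complex) \<Rightarrow> bool" where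
  "is_Phi D q a n \<omega> \<longleftrightarrow> \<omega> \<in> dual_of (hopfA D) \<and>
     (\<forall>d v c \<xi>. corep (hopfA D) [0..<d] v \<and> (\<forall>j. d \<le> j \<longrightarrow> \<xi> j = 0) \<and>
        dual_rep [0..<d] v (fun_of D (\<i> *\<^sub>C Bt D q a)) \<xi> = (\<lambda>j. c * \<xi> j) \<longrightarrow>
        dual_rep [0..<d] v \<omega> \<xi> =
          (if c = complex_of_real (qint q (a + 2 * real_of_int n)) then \<xi> else (\<lambda>_. 0)))"

definition stab_Ic ::
  "('a::star_algebra, 'u::star_algebra, 'x) podles \<Rightarrow> real \<Rightarrow> real \<Rightarrow> ('a \<Rightarrow> complex) set" where
  "stab_Ic D q a =
     {\<lambda>x. \<Sum>(c, \<omega>)\<leftarrow>ps. c * \<omega> x | ps. \<forall>(c, \<omega>)\<in>set ps. \<exists>n. is_Phi D q a n \<omega>}"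

definition Oq_stab ::
  "('a::star_algebra, 'u::star_algebra, 'x::star_algebra) podles \<Rightarrow> real \<Rightarrow> real \<Rightarrow> 'x set" where
  "Oq_stab D q a = star_gen (incA D ` Oq_sphere D q a \<union> incU D ` stab_Ic D q a)"


section \<open>Spin one elements\<close>

definition xi_vec :: "real \<Rightarrow> real \<Rightarrow> int \<Rightarrow> complex" where
  "xi_vec q c j = (if j = 1 then of_real (sqrt q)
     else if j = 0 then - (\<i> * of_real (qdiff q c / sqrt (q + 1 / q)))
     else if j = -1 then of_real (1 / sqrt q) else 0)"

definition xi_plus :: "real \<Rightarrow> real \<Rightarrow> int \<Rightarrow> complex" where
  "xi_plus q c j = (if j = 1 then - of_real (q powr (- c - 1/2))
     else if j = 0 then \<i> * of_real (sqrt (q + 1 / q))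
     else if j = -1 then of_real (q powr (c + 1/2)) else 0)"

definition xi_minus :: "real \<Rightarrow> real \<Rightarrow> int \<Rightarrow> complex" where
  "xi_minus q c j = (if j = 1 then of_real (q powr (c - 1/2))
     else if j = 0 then \<i> * of_real (sqrt (q + 1 / q))
     else if j = -1 then - of_real (q powr (- c + 1/2)) else 0)"

definition mcoef :: "('a::star_algebra, 'u, 'x) podles \<Rightarrow> (int \<Rightarrow> complex) \<Rightarrow> (int \<Rightarrow> complex) \<Rightarrow> 'a" where
  "mcoef D \<xi> \<eta> = (\<Sum>j\<in>{-1, 0, 1}. \<Sum>l\<in>{-1, 0, 1}. (cnj (\<xi> j) * \<eta> l) *\<^sub>C spin1 D j l)"

definition T_plus :: "('a::star_algebra, 'u, 'x) podles \<Rightarrow> real \<Rightarrow> real \<Rightarrow> real \<Rightarrow> 'a" where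
  "T_plus D q a c = mcoef D (xi_plus q c) (xi_vec q a)"

definition T_minus :: "('a::star_algebra, 'u, 'x) podles \<Rightarrow> real \<Rightarrow> real \<Rightarrow> real \<Rightarrow> 'a" where
  "T_minus D q a c = mcoef D (xi_minus q c) (xi_vec q a)"

definition A_el :: "('a::star_algebra, 'u, 'x) podles \<Rightarrow> real \<Rightarrow> real \<Rightarrow> real \<Rightarrow> 'a" where
  "A_el D q a c = mcoef D (xi_vec q c) (xi_vec q a)
     - complex_of_real (qdiff q c * qdiff q a / (q + 1 / q)) *\<^sub>C 1"

text \<open>The weight basis of \<open>H\<^sub>1\<close> does not depend on the parameter \<open>t\<close>, so the choice of its phases
  is required to work for all \<open>t\<close>.\<close>

definition podles_setting ::
  "real \<Rightarrow> ('a::star_algebra, 'u::star_algebra, 'x::star_algebra) podles \<Rightarrow> bool" where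
  "podles_setting q D \<longleftrightarrow>
     Oq_SU2 q (hopfA D) (alpha D) (gamma D) \<and>
     Uq_su2 q (hopfU D) (kU D) (kinvU D) (eU D) (fU D) \<and>
     unitary_pairing (hopfA D) (hopfU D) (pair D) \<and>
     fund_pairing q (alpha D) (gamma D) (kU D) (eU D) (fU D) (pair D) \<and>
     drinfeld_double (hopfA D) (incA D) (incU D) \<and>
     clinear (epsX D) \<and>
     (\<forall>b. \<forall>\<omega>\<in>dual_of (hopfA D). epsX D (incA D b * incU D \<omega>) = counit (hopfA D) b * \<omega> 1) \<and>
     irreducible_corep (hopfA D) [-1, 0, 1] (spin1 D) \<and>
     unitary_corep (hopfA D) [-1, 0, 1] (spin1 D) \<and>
     (\<forall>j\<in>{-1, 0, 1}. \<forall>l\<in>{-1, 0, 1}.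
        pair D (spin1 D j l) (kU D) = (if j = l then of_real (q powr (2 * real_of_int j)) else 0)) \<and>
     (\<forall>a c. T_plus D q a c \<in> Oq_sphere D q a \<and> T_minus D q a c \<in> Oq_sphere D q a \<and>
        A_el D q a c \<in> Oq_sphere D q a)"


section \<open>Modules\<close>

definition is_rep :: "'x::star_algebra set \<Rightarrow> 'v::complex_vector set \<Rightarrow> ('x \<Rightarrow> 'v \<Rightarrow> 'v) \<Rightarrow> bool" where
  "is_rep X W \<rho> \<longleftrightarrow> cvec.subspace W \<and>
     (\<forall>x\<in>X. \<forall>v\<in>W. \<rho> x v \<in> W) \<and>
     (\<forall>x\<in>X. \<forall>v\<in>W. \<forall>w\<in>W. \<rho> x (v + w) = \<rho> x v + \<rho> x w) \<and>
     (\<forall>x\<in>X. \<forall>c. \<forall>v\<in>W. \<rho> x (c *\<^sub>C v) = c *\<^sub>C \<rho> x v) \<and>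
     (\<forall>x\<in>X. \<forall>y\<in>X. \<forall>v\<in>W. \<rho> (x + y) v = \<rho> x v + \<rho> y v) \<and>
     (\<forall>c. \<forall>x\<in>X. \<forall>v\<in>W. \<rho> (c *\<^sub>C x) v = c *\<^sub>C \<rho> x v) \<and>
     (\<forall>x\<in>X. \<forall>y\<in>X. \<forall>v\<in>W. \<rho> (x * y) v = \<rho> x (\<rho> y v)) \<and>
     (1 \<in> X \<longrightarrow> (\<forall>v\<in>W. \<rho> 1 v = v))"

text \<open>The parameter \<open>s\<close> below is applied to the elements \<open>A\<^sub>c\<close> and \<open>T\<^sub>c\<^sup>\<plusminus>\<close> before they act, and will
  be either the identity or the involution.  On a left module, the exchange relation gives
  \<open>iB\<^sub>t u\<^sub>\<xi>\<^sup>* v = (u\<^sub>\<eta>)\<^sup>* v\<close> with \<open>\<eta> = \<pi>\<^sub>1(i B\<^bsub>t'\<^esub>) \<xi>\<close>, \<open>t'\<close> the parameter of \<open>c\<close>, whenever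
  \<open>iB\<^sub>t v = [c] v\<close>, where \<open>u\<^sub>\<xi>\<close> is the matrix coefficient of \<open>\<xi>\<close> and the vector \<open>\<xi>\<close> of
  parameter \<open>a\<close>.  Since \<^const>\<open>xi_vec\<close>, \<^const>\<open>xi_plus\<close>, \<^const>\<open>xi_minus\<close> are eigenvectors
  with eigenvalues \<open>[c], [c+2], [c-2]\<close>, it is the adjoints of \<^const>\<open>A_el\<close>, \<^const>\<open>T_plus\<close>,
  \<^const>\<open>T_minus\<close> that map the \<open>[c]\<close>-eigenspace to the eigenspaces of these eigenvalues.  The
  identity gives the formulas without adjoints.\<close>

definition basic_module ::
  "('a::star_algebra, 'u::star_algebra, 'x::star_algebra) podles \<Rightarrow> real \<Rightarrow> real \<Rightarrow> ('a \<Rightarrow> 'a) \<Rightarrow>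
   complex \<Rightarrow> real \<Rightarrow> 'v::complex_vector set \<Rightarrow> ('x \<Rightarrow> 'v \<Rightarrow> 'v) \<Rightarrow> 'v \<Rightarrow> bool" where
  "basic_module D q a s lam b W \<rho> \<xi> \<longleftrightarrow> is_rep (Uq_sl2R D q a) W \<rho> \<and> \<xi> \<in> W \<and>
     W = (\<lambda>x. \<rho> x \<xi>) ` Uq_sl2R D q a \<and>
     \<rho> (iBt D q a) \<xi> = complex_of_real (qint q b) *\<^sub>C \<xi> \<and>
     \<rho> (incA D (s (A_el D q a b))) \<xi> = lam *\<^sub>C \<xi>"

text \<open>Cyclic modules have countable dimension, hence are isomorphic to modules on subspaces of
  \<^typ>\<open>nat \<Rightarrow>\<^sub>0 complex\<close>: quantifying over the latter loses nothing.\<close>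

definition universal_basic_module ::
  "('a::star_algebra, 'u::star_algebra, 'x::star_algebra) podles \<Rightarrow> real \<Rightarrow> real \<Rightarrow> ('a \<Rightarrow> 'a) \<Rightarrow>
   complex \<Rightarrow> real \<Rightarrow> ('x \<Rightarrow> 'm \<Rightarrow> 'm::complex_vector) \<Rightarrow> 'm \<Rightarrow> bool" where
  "universal_basic_module D q a s lam b \<rho> e \<longleftrightarrow> basic_module D q a s lam b UNIV \<rho> e \<and>
     (\<forall>(W::(nat \<Rightarrow>\<^sub>0 complex) set) \<rho>' \<xi>. basic_module D q a s lam b W \<rho>' \<xi> \<longrightarrow>
        (\<exists>\<phi>. clinear \<phi> \<and> range \<phi> = W \<and> \<phi> e = \<xi> \<and>
           (\<forall>x\<in>Uq_sl2R D q a. \<forall>v. \<phi> (\<rho> x v) = \<rho>' x (\<phi> v))))"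

fun ladder_up ::
  "('a::star_algebra, 'u::star_algebra, 'x::star_algebra) podles \<Rightarrow> real \<Rightarrow> real \<Rightarrow> ('a \<Rightarrow> 'a) \<Rightarrow>
   real \<Rightarrow> ('x \<Rightarrow> 'm \<Rightarrow> 'm::complex_vector) \<Rightarrow> 'm \<Rightarrow> nat \<Rightarrow> 'm" where
  "ladder_up D q a s b \<rho> e 0 = e"
| "ladder_up D q a s b \<rho> e (Suc n) =
     \<rho> (incA D (s (T_plus D q a (b + 2 * real n)))) (ladder_up D q a s b \<rho> e n)"

fun ladder_down ::
  "('a::star_algebra, 'u::star_algebra, 'x::star_algebra) podles \<Rightarrow> real \<Rightarrow> real \<Rightarrow> ('a \<Rightarrow> 'a) \<Rightarrow>
   real \<Rightarrow> ('x \<Rightarrow> 'm \<Rightarrow> 'm::complex_vector) \<Rightarrow> 'm \<Rightarrow> nat \<Rightarrow> 'm" where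
  "ladder_down D q a s b \<rho> e 0 = e"
| "ladder_down D q a s b \<rho> e (Suc n) =
     \<rho> (incA D (s (T_minus D q a (b - 2 * real n)))) (ladder_down D q a s b \<rho> e n)"

definition invariant_form ::
  "'x::star_algebra set \<Rightarrow> ('x \<Rightarrow> 'm \<Rightarrow> 'm::complex_vector) \<Rightarrow> ('m \<Rightarrow> 'm \<Rightarrow> complex) \<Rightarrow> bool" where
  "invariant_form X \<rho> h \<longleftrightarrow>
     (\<forall>v. clinear (h v)) \<and>
     (\<forall>v v' w. h (v + v') w = h v w + h v' w) \<and> (\<forall>c v w. h (c *\<^sub>C v) w = cnj c * h v w) \<and>
     (\<forall>x\<in>X. \<forall>v w. h v (\<rho> x w) = h (\<rho> (star x) v) w)"

definition unique_invariant_form ::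
  "'x::star_algebra set \<Rightarrow> ('x \<Rightarrow> 'm \<Rightarrow> 'm::complex_vector) \<Rightarrow> ('m \<Rightarrow> 'm \<Rightarrow> complex) \<Rightarrow> bool" where
  "unique_invariant_form X \<rho> h \<longleftrightarrow> invariant_form X \<rho> h \<and> (\<exists>v w. h v w \<noteq> 0) \<and>
     (\<forall>h'. invariant_form X \<rho> h' \<longrightarrow> (\<exists>c. \<forall>v w. h' v w = c * h v w))"

text \<open>\<open>(\<rho>, e)\<close> is \<open>M\<^bsub>\<lambda>,b\<^esub>\<close>, with invariant form \<open>h\<close>, and the quotient map \<open>p\<close> exhibits
  \<open>\<rho>L\<close> as \<open>L\<^bsub>\<lambda>,b\<^esub>\<close>, the quotient by the kernel of the form.\<close>

definition L_module ::
  "('a::star_algebra, 'u::star_algebra, 'x::star_algebra) podles \<Rightarrow> real \<Rightarrow> real \<Rightarrow> ('a \<Rightarrow> 'a) \<Rightarrow>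
   complex \<Rightarrow> real \<Rightarrow> ('x \<Rightarrow> 'm \<Rightarrow> 'm::complex_vector) \<Rightarrow> 'm \<Rightarrow> ('m \<Rightarrow> 'm \<Rightarrow> complex) \<Rightarrow>
   ('m \<Rightarrow> 'l::complex_vector) \<Rightarrow> ('x \<Rightarrow> 'l \<Rightarrow> 'l) \<Rightarrow> bool" where
  "L_module D q a s lam b \<rho> e h p \<rho>L \<longleftrightarrow>
     universal_basic_module D q a s lam b \<rho> e \<and> unique_invariant_form (Uq_sl2R D q a) \<rho> h \<and>
     clinear p \<and> surj p \<and> {v. p v = 0} = {v. \<forall>w. h v w = 0} \<and>
     (\<forall>x\<in>Uq_sl2R D q a. \<forall>v. \<rho>L x (p v) = p (\<rho> x v))"

text \<open>\<open>\<pi>\<close> is the representation of \<open>O\<^sub>q(S\<^sub>t\<^sup>2) \<bowtie> I\<^sub>c\<close> that corresponds to \<open>\<rho>\<close>.\<close>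

definition stab_rep ::
  "('a::star_algebra, 'u::star_algebra, 'x::star_algebra) podles \<Rightarrow> real \<Rightarrow> real \<Rightarrow>
   ('x \<Rightarrow> 'm \<Rightarrow> 'm::complex_vector) \<Rightarrow> ('x \<Rightarrow> 'm \<Rightarrow> 'm) \<Rightarrow> bool" where
  "stab_rep D q a \<rho> \<pi> \<longleftrightarrow> is_rep (Oq_stab D q a) UNIV \<pi> \<and>
     (\<forall>b\<in>Oq_sphere D q a. \<pi> (incA D b) = \<rho> (incA D b)) \<and>
     cvec.span {v. \<exists>n::int. \<rho> (iBt D q a) v = complex_of_real (qint q (a + 2 * of_int n)) *\<^sub>C v} = UNIV \<and>
     (\<forall>n \<omega> m v. is_Phi D q a n \<omega> \<and>
        \<rho> (iBt D q a) v = complex_of_real (qint q (a + 2 * of_int m)) *\<^sub>C v \<longrightarrow>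
        \<pi> (incU D \<omega>) v = (if m = n then v else 0))"

definition short_exact ::
  "'x set \<Rightarrow> ('n::complex_vector \<Rightarrow> 'm::complex_vector) \<Rightarrow> ('m \<Rightarrow> 'l::complex_vector) \<Rightarrow>
   ('x \<Rightarrow> 'n \<Rightarrow> 'n) \<Rightarrow> ('x \<Rightarrow> 'm \<Rightarrow> 'm) \<Rightarrow> ('x \<Rightarrow> 'l \<Rightarrow> 'l) \<Rightarrow> bool" where
  "short_exact X \<iota> p \<pi>N \<pi>M \<pi>L \<longleftrightarrow> clinear \<iota> \<and> clinear p \<and> inj \<iota> \<and> surj p \<and>
     range \<iota> = {v. p v = 0} \<and>
     (\<forall>x\<in>X. \<forall>v. \<iota> (\<pi>N x v) = \<pi>M x (\<iota> v)) \<and> (\<forall>x\<in>X. \<forall>v. p (\<pi>M x v) = \<pi>L x (p v))"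

definition sum_rep ::
  "('x \<Rightarrow> 'v \<Rightarrow> 'v) \<Rightarrow> ('x \<Rightarrow> 'w \<Rightarrow> 'w) \<Rightarrow> 'x \<Rightarrow> 'v \<times> 'w \<Rightarrow> 'v \<times> 'w" where
  "sum_rep \<pi> \<pi>' x = (\<lambda>(v, w). (\<pi> x v, \<pi>' x w))"


section \<open>Cocycles\<close>

definition inner_product_on :: "'v::complex_vector set \<Rightarrow> ('v \<Rightarrow> 'v \<Rightarrow> complex) \<Rightarrow> bool" where
  "inner_product_on W ip \<longleftrightarrow>
     (\<forall>u\<in>W. \<forall>v\<in>W. \<forall>w\<in>W. ip u (v + w) = ip u v + ip u w) \<and>
     (\<forall>c. \<forall>u\<in>W. \<forall>v\<in>W. ip u (c *\<^sub>C v) = c * ip u v) \<and>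
     (\<forall>u\<in>W. \<forall>v\<in>W. ip v u = cnj (ip u v)) \<and>
     (\<forall>v\<in>W. v \<noteq> 0 \<longrightarrow> Re (ip v v) > 0)"

definition star_rep ::
  "'x::star_algebra set \<Rightarrow> 'v::complex_vector set \<Rightarrow> ('v \<Rightarrow> 'v \<Rightarrow> complex) \<Rightarrow> ('x \<Rightarrow> 'v \<Rightarrow> 'v) \<Rightarrow> bool" where
  "star_rep X W ip \<pi> \<longleftrightarrow> is_rep X W \<pi> \<and> inner_product_on W ip \<and>
     (\<forall>x\<in>X. \<forall>v\<in>W. \<forall>w\<in>W. ip v (\<pi> x w) = ip (\<pi> (star x) v) w)"

definition cocycle ::
  "'x::star_algebra set \<Rightarrow> ('x \<Rightarrow> complex) \<Rightarrow> 'v::complex_vector set \<Rightarrow> ('v \<Rightarrow> 'v \<Rightarrow> complex) \<Rightarrow>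
   ('x \<Rightarrow> 'v \<Rightarrow> 'v) \<Rightarrow> ('x \<Rightarrow> 'v) \<Rightarrow> bool" where
  "cocycle X \<epsilon> W ip \<pi> C \<longleftrightarrow> star_rep X W ip \<pi> \<and>
     (\<forall>x\<in>X. C x \<in> W) \<and>
     (\<forall>x\<in>X. \<forall>y\<in>X. C (x + y) = C x + C y) \<and> (\<forall>c. \<forall>x\<in>X. C (c *\<^sub>C x) = c *\<^sub>C C x) \<and>
     (\<forall>x\<in>X. \<forall>y\<in>X. C (x * y) = \<pi> x (C y) + \<epsilon> y *\<^sub>C C x)"

definition yetter_drinfeld_cocycle ::
  "('a::star_algebra, 'u::star_algebra, 'x::star_algebra) podles \<Rightarrow> real \<Rightarrow> real \<Rightarrow>
   'v::complex_vector set \<Rightarrow> ('v \<Rightarrow> 'v \<Rightarrow> complex) \<Rightarrow> ('x \<Rightarrow> 'v \<Rightarrow> 'v) \<Rightarrow> ('a \<Rightarrow> 'v) \<Rightarrow> bool" where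
  "yetter_drinfeld_cocycle D q a W ip \<pi> C \<longleftrightarrow>
     cocycle (Oq_sphere D q a) (counit (hopfA D)) W ip (\<lambda>b. \<pi> (incA D b)) C \<and>
     (\<forall>x\<in>Oq_sphere D q a. \<forall>\<omega>\<in>stab_Ic D q a.
        \<pi> (incU D \<omega>) (C x) = C (ract (hopfA D) x (dual_antip_inv (hopfA D) \<omega>)))"

end

(* The trivial character eps of the Drinfeld double makes a line into a (q + 1/q, a)-basic module, so
   universality gives a functional phi on M with phi(x v) = eps(x) phi(v) and phi(e_a) = 1.  The form
   conj(phi v) phi(w) is invariant, hence a multiple of the invariant form, and the kernel of M -> L
   is the kernel of phi.  So y e_a - eps(y) e_a lies in D_2^+ + D_2^- for y in O_q(S_t^2); for y in
   I_c one uses that each Phi_n agrees with a polynomial in i B_t on any given finite set, because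
   i B_t is self-adjoint in unitary corepresentations.  The cocycle identity is then formal.  The
   Yetter-Drinfeld identity follows from the exchange relation of i B_t with O_q(S_t^2), applied to
   e_a and iterated, with an interpolating polynomial of i B_t in place of Phi_n. *)

theory Submission
  imports Defs "HOL-Library.Function_Algebras" "HOL-Computational_Algebra.Fundamental_Theorem_Algebra"
begin

section \<open>Linear maps and algebraic tensors\<close>

text \<open>The hypotheses give \<Phi>_n only through its action on eigenvectors of i B_t in
  corepresentations, and \<open>\<pi>t\<close> on I_c only through weight vectors. Statements about
  I_c are therefore reached by evaluating on finitely many vectors or elements. This works because
  every element of A is a combination of coefficients of one unitary corepresentation: the
  fundamental matrix is unitary, and tensor products and direct sums preserve unitarity. There the
  antipode is the entrywise adjoint of the transposed matrix, which also gives a formula for its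
  inverse.

  Exchanging B_t with the sphere brings in two further elements, since the coproduct of B_t is B_t
  tensor \<open>k'\<close> plus 1 tensor \<open>Z\<close>. They recombine into B_t twice: against x,
  because B_t acts on the sphere from the left by its counit, and against e_a, because the
  eigenvalue [a] is the counit of i B_t. This is why the shift formula holds for the cyclic vector.

  The algebra with I_c is generated as a star-algebra, so equivariance of the functional has to be
  proved for y and \<open>star y\<close> together; this requires self-adjointness of \<Phi>_n and
  closure of the sphere under the star.\<close>

lemma clinear_iff:
  "clinear f \<longleftrightarrow> (\<forall>x y. f (x + y) = f x + f y) \<and> (\<forall>c x. f (c *\<^sub>C x) = c *\<^sub>C f x)"
  by (simp add: Vector_Spaces.linear_iff cvec.vector_space_axioms)

lemma clinearI:
  "(\<And>x y. f (x + y) = f x + f y) \<Longrightarrow> (\<And>c x. f (c *\<^sub>C x) = c *\<^sub>C f x) \<Longrightarrow> clinear f"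
  by (simp add: clinear_iff)

lemma clinear_add: "clinear f \<Longrightarrow> f (x + y) = f x + f y"
  and clinear_scale: "clinear f \<Longrightarrow> f (c *\<^sub>C x) = c *\<^sub>C f x"
  by (simp_all add: clinear_iff)

lemma clinear_0: "clinear f \<Longrightarrow> f 0 = 0"
  using clinear_add[of f 0 0] by simp

lemma clinear_minus: "clinear f \<Longrightarrow> f (- x) = - f x"
  using clinear_add[of f x "- x"] clinear_0[of f] by (simp add: add_eq_0_iff)

lemma clinear_diff: "clinear f \<Longrightarrow> f (x - y) = f x - f y"
  using clinear_add[of f x "- y"] clinear_minus[of f] by simp

lemma clinear_sum: "clinear f \<Longrightarrow> f (\<Sum>i\<in>A. g i) = (\<Sum>i\<in>A. f (g i))"
  by (induction A rule: infinite_finite_induct) (simp_all add: clinear_0 clinear_add)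

lemma clinear_sum_list: "clinear f \<Longrightarrow> f (\<Sum>i\<leftarrow>l. g i) = (\<Sum>i\<leftarrow>l. f (g i))"
  by (induction l) (simp_all add: clinear_0 clinear_add)

lemma clinear_sum_list2: "clinear f \<Longrightarrow> f (\<Sum>(x, y)\<leftarrow>l. g x y) = (\<Sum>(x, y)\<leftarrow>l. f (g x y))"
  by (simp add: clinear_sum_list case_prod_unfold)

lemma scaleC_complex [simp]: "(c::complex) *\<^sub>C (x::complex) = c * x"
  by (simp add: scaleC_complex_def)

lemma scaleC_zero_simps [simp]: "(0::complex) *\<^sub>C x = 0" "c *\<^sub>C (0::'a::complex_vector) = 0" "1 *\<^sub>C (x::'a) = x"
  by (simp_all add: scaleC_one)

lemma scaleC_sum_list2:
  "c *\<^sub>C (\<Sum>(x, y)\<leftarrow>l. g x y) = (\<Sum>(x, y)\<leftarrow>l. c *\<^sub>C (g x y :: 'a::complex_vector))"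
  by (induction l) (auto simp: scaleC_right_distrib)

lemma sum_list_concat_map: "sum_list (concat xs) = (\<Sum>x\<leftarrow>xs. sum_list x)"
  by (induction xs) auto

lemma sum_list2_add:
  "(\<Sum>(x, y)\<leftarrow>l. f x y + g x y) = (\<Sum>(x, y)\<leftarrow>l. f x y) + (\<Sum>(x, y)\<leftarrow>l. g x y :: 'a::ab_group_add)"
  by (induction l) (auto simp: algebra_simps)

lemma cnj_sum_list2: "cnj (\<Sum>(x, y)\<leftarrow>l. f x y) = (\<Sum>(x, y)\<leftarrow>l. cnj (f x y))"
  by (induction l) auto

lemma sum_list2_sum:
  "(\<Sum>(y, z)\<leftarrow>l. \<Sum>k\<in>A. f y z k) = (\<Sum>k\<in>A. \<Sum>(y, z)\<leftarrow>l. (f y z k :: 'b::comm_monoid_add))"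
  by (induction l) (auto simp: sum.distrib)

lemma sum_list2_cong:
  "(\<And>x y. f x y = g x y) \<Longrightarrow> (\<Sum>(x, y)\<leftarrow>l. f x y) = (\<Sum>(x, y)\<leftarrow>l. g x y)"
  by simp

lemma clinear_representation:
  assumes "cvec.independent B" "cvec.span B = UNIV"
  shows "clinear (\<lambda>x::'a::complex_vector. cvec.representation B x b)"
  using assms by (intro clinearI) (auto simp: cvec.representation_add cvec.representation_scale)

text \<open>Expanding in a basis turns a bilinear map into a combination of the products of
  coordinate functionals by which \<^const>\<open>tens_eq\<close> is tested.\<close>

lemma tens_eq_bilinear:
  fixes \<beta> :: "'a::complex_vector \<Rightarrow> 'b::complex_vector \<Rightarrow> 'c::complex_vector"
  assumes eq: "tens_eq ps rs"
    and l: "\<And>y. clinear (\<lambda>x. \<beta> x y)" and r: "\<And>x. clinear (\<beta> x)"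
  shows "(\<Sum>(x, y)\<leftarrow>ps. \<beta> x y) = (\<Sum>(x, y)\<leftarrow>rs. \<beta> x y)"
proof -
  define B where "B = cvec.extend_basis ({}::'a set)"
  define B' where "B' = cvec.extend_basis ({}::'b set)"
  have B: "cvec.independent B" "cvec.span B = UNIV"
    unfolding B_def by (simp_all add: cvec.independent_extend_basis cvec.span_extend_basis cvec.independent_empty)
  have B': "cvec.independent B'" "cvec.span B' = UNIV"
    unfolding B'_def by (simp_all add: cvec.independent_extend_basis cvec.span_extend_basis cvec.independent_empty)
  let ?f = "cvec.representation B" and ?g = "cvec.representation B'"
  define F where "F = (\<Union>(x, y)\<in>set (ps @ rs). {b. ?f x b \<noteq> 0})"
  define G where "G = (\<Union>(x, y)\<in>set (ps @ rs). {b. ?g y b \<noteq> 0})"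
  have fin: "finite F" "finite G"
    unfolding F_def G_def by (auto simp: cvec.finite_representation)
  have expand: "\<beta> x y = (\<Sum>b\<in>F. \<Sum>b'\<in>G. (?f x b * ?g y b') *\<^sub>C \<beta> b b')" if xy: "(x, y) \<in> set (ps @ rs)" for x y
  proof -
    have "x = (\<Sum>b | ?f x b \<noteq> 0. ?f x b *\<^sub>C b)"
      using cvec.sum_nonzero_representation_eq[OF B(1)] B(2) by simp
    also have "\<dots> = (\<Sum>b\<in>F. ?f x b *\<^sub>C b)"
      using fin xy by (intro sum.mono_neutral_left) (auto simp: F_def)
    finally have x: "x = (\<Sum>b\<in>F. ?f x b *\<^sub>C b)" .
    have "y = (\<Sum>b | ?g y b \<noteq> 0. ?g y b *\<^sub>C b)"
      using cvec.sum_nonzero_representation_eq[OF B'(1)] B'(2) by simp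
    also have "\<dots> = (\<Sum>b\<in>G. ?g y b *\<^sub>C b)"
      using fin xy by (intro sum.mono_neutral_left) (auto simp: G_def)
    finally have y: "y = (\<Sum>b\<in>G. ?g y b *\<^sub>C b)" .
    have "\<beta> x y = (\<Sum>b\<in>F. ?f x b *\<^sub>C \<beta> b y)"
      by (subst x) (simp add: clinear_sum[OF l] clinear_scale[OF l])
    also have "\<dots> = (\<Sum>b\<in>F. ?f x b *\<^sub>C (\<Sum>b'\<in>G. ?g y b' *\<^sub>C \<beta> b b'))"
    proof (intro sum.cong refl arg_cong[where f = "scaleC _"])
      fix b
      show "\<beta> b y = (\<Sum>b'\<in>G. ?g y b' *\<^sub>C \<beta> b b')"
        by (subst y) (simp add: clinear_sum[OF r] clinear_scale[OF r])
    qed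
    also have "\<dots> = (\<Sum>b\<in>F. \<Sum>b'\<in>G. (?f x b * ?g y b') *\<^sub>C \<beta> b b')"
      by (simp add: cvec.scale_sum_right scaleC_scaleC)
    finally show ?thesis .
  qed
  \<comment> \<open>Stated for every list of pairs drawn from the two given ones, so that
    \<open>ps\<close> and \<open>rs\<close> are expanded over the same finite sets of basis
    vectors.\<close>
  have total: "(\<Sum>(x, y)\<leftarrow>l. \<beta> x y) =
      (\<Sum>b\<in>F. \<Sum>b'\<in>G. (\<Sum>(x, y)\<leftarrow>l. ?f x b * ?g y b') *\<^sub>C \<beta> b b')"
    if "set l \<subseteq> set (ps @ rs)" for l
    using that
  proof (induction l)
    case (Cons z l)
    then show ?case
      by (cases z) (simp add: expand scaleC_left_distrib sum.distrib)
  qed simp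
  have "(\<Sum>(x, y)\<leftarrow>ps. ?f x b * ?g y b') = (\<Sum>(x, y)\<leftarrow>rs. ?f x b * ?g y b')" for b b'
    using eq clinear_representation[OF B] clinear_representation[OF B']
    unfolding tens_eq_def by blast
  then show ?thesis
    by (simp add: total)
qed

text \<open>Coordinates in a basis already separate points. Coassociativity is available only after
  applying functionals, so identities between elements of the algebra are tested this way.\<close>

lemma clinear_functional_eqI:
  fixes x y :: "'a::complex_vector"
  assumes "\<And>\<phi>::'a \<Rightarrow> complex. clinear \<phi> \<Longrightarrow> \<phi> x = \<phi> y"
  shows "x = y"
proof -
  define B where "B = cvec.extend_basis ({}::'a set)"
  have B: "cvec.independent B" "cvec.span B = UNIV"
    unfolding B_def by (simp_all add: cvec.independent_extend_basis cvec.span_extend_basis cvec.independent_empty)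
  have "cvec.representation B x = cvec.representation B y"
    using assms clinear_representation[OF B] by blast
  then show ?thesis
    using cvec.sum_nonzero_representation_eq[OF B(1)] B(2) by (metis UNIV_I)
qed

lemma star_zero [simp]: "star (0::'a::star_algebra) = 0"
  using star_add[of "0::'a" 0] by simp

lemma star_minus: "star (- x) = - star (x::'a::star_algebra)"
  using star_add[of x "- x"] by (simp add: add_eq_0_iff)

lemma star_diff: "star (x - y) = star x - star (y::'a::star_algebra)"
  using star_add[of x "- y"] by (simp add: star_minus)

lemma star_one [simp]: "star (1::'a::star_algebra) = 1"
proof -
  have "star 1 * star (star (1::'a)) = star (star 1 * 1)"
    by (simp only: star_mult)
  then show ?thesis
    by (simp add: star_star)
qed

lemma star_sum_list2: "star (\<Sum>(x, y)\<leftarrow>l. g x y) = (\<Sum>(x, y)\<leftarrow>l. star (g x y :: 'a::star_algebra))"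
  by (induction l) (auto simp: star_add)

lemma clinear_mult_left: "clinear (\<lambda>x::'a::star_algebra. x * y)"
  and clinear_mult_right: "clinear (\<lambda>x::'a::star_algebra. y * x)"
  by (auto intro!: clinearI simp: distrib_left distrib_right mult_scaleC_left mult_scaleC_right)

lemma clinear_compose: "clinear f \<Longrightarrow> clinear g \<Longrightarrow> clinear (\<lambda>x. f (g x))"
  by (simp add: clinear_iff)

lemma clinear_scaleC: "clinear f \<Longrightarrow> clinear (\<lambda>x. c *\<^sub>C f x)"
  by (simp add: clinear_iff scaleC_right_distrib scaleC_scaleC mult.commute)

lemma clinear_scaleC_left: "clinear f \<Longrightarrow> clinear (\<lambda>x. f x *\<^sub>C y)"
  by (simp add: clinear_iff scaleC_left_distrib scaleC_scaleC)

lemma clinear_times_left: "clinear f \<Longrightarrow> clinear (\<lambda>x. f x * (y::complex))"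
  and clinear_times_right: "clinear f \<Longrightarrow> clinear (\<lambda>x. (y::complex) * f x)"
  by (simp_all add: clinear_iff algebra_simps)

lemma clinear_plus: "clinear f \<Longrightarrow> clinear g \<Longrightarrow> clinear (\<lambda>x. f x + g x)"
  by (simp add: clinear_iff scaleC_right_distrib)

lemma clinear_zero: "clinear (\<lambda>x. 0)"
  by (simp add: clinear_iff)

lemma clinear_ident: "clinear (\<lambda>x. x)"
  by (simp add: clinear_iff)

lemma clinear_sum_list_fun:
  "(\<And>x y. clinear (\<lambda>v. g v x y)) \<Longrightarrow> clinear (\<lambda>v. \<Sum>(x, y)\<leftarrow>l. g v x y)"
  by (induction l) (auto intro!: clinear_plus clinear_zero)

lemmas clinear_intros = clinear_mult_left clinear_mult_right clinear_scaleC clinear_scaleC_left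
  clinear_times_left clinear_times_right clinear_plus clinear_zero clinear_ident


section \<open>Evaluation in free algebras\<close>

lemma lookup_scaleC: "Poly_Mapping.lookup (c *\<^sub>C p) k = c *\<^sub>C Poly_Mapping.lookup p k"
  by (simp add: scaleC_poly_mapping_def Poly_Mapping.map.rep_eq when_def)

lemma eval_free_superset:
  assumes "finite A" "Poly_Mapping.keys p \<subseteq> A"
  shows "eval_free \<phi> p = (\<Sum>w\<in>A. Poly_Mapping.lookup p w *\<^sub>C prod_list (map \<phi> (letters w)))"
  unfolding eval_free_def using assms
  by (intro sum.mono_neutral_left) (auto simp: in_keys_iff)

lemma eval_free_add: "eval_free \<phi> (p + r) = eval_free \<phi> p + eval_free \<phi> r"
proof -
  let ?A = "Poly_Mapping.keys p \<union> Poly_Mapping.keys r"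
  have "eval_free \<phi> (p + r) = (\<Sum>w\<in>?A. Poly_Mapping.lookup (p + r) w *\<^sub>C prod_list (map \<phi> (letters w)))"
    by (intro eval_free_superset) (use Poly_Mapping.keys_add[of p r] in auto)
  then show ?thesis
    by (simp add: eval_free_superset[of ?A p] eval_free_superset[of ?A r] lookup_add
        scaleC_left_distrib sum.distrib)
qed

lemma eval_free_zero [simp]: "eval_free \<phi> 0 = 0"
  by (simp add: eval_free_def)

lemma eval_free_minus: "eval_free \<phi> (- p) = - eval_free \<phi> p"
  using eval_free_add[of \<phi> p "- p"] by (simp add: add_eq_0_iff)

lemma eval_free_diff: "eval_free \<phi> (p - r) = eval_free \<phi> p - eval_free \<phi> r"
  using eval_free_add[of \<phi> p "- r"] by (simp add: eval_free_minus)

lemma eval_free_single: "eval_free \<phi> (Poly_Mapping.single w c) = c *\<^sub>C prod_list (map \<phi> (letters w))"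
  by (cases "c = 0") (simp_all add: eval_free_def)

lemma eval_free_scaleC: "eval_free \<phi> (c *\<^sub>C p) = c *\<^sub>C eval_free \<phi> p"
proof -
  have "Poly_Mapping.keys (c *\<^sub>C p) \<subseteq> Poly_Mapping.keys p"
    by (auto simp: in_keys_iff lookup_scaleC)
  then show ?thesis
    by (simp add: eval_free_superset[of "Poly_Mapping.keys p"] lookup_scaleC cvec.scale_sum_right scaleC_scaleC)
qed

lemma eval_free_gen_times: "eval_free \<phi> (gen g * gen g') = \<phi> g * \<phi> g'"
  by (simp add: gen_def mult_single eval_free_single plus_word_def)

lemma eval_free_one: "eval_free \<phi> 1 = 1"
  using eval_free_single[of \<phi> 0 1] by (simp add: zero_word_def flip: single_one)

lemma presented_by_relation:
  assumes "presented_by \<phi> R" "r \<in> R"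
  shows "eval_free \<phi> r = 0"
proof -
  have "1 * r * 1 + 0 \<in> two_sided_ideal R"
    by (intro two_sided_ideal.intros assms)
  then show ?thesis
    using assms by (simp add: presented_by_def)
qed

lemmas eval_free_simps = eval_free_add eval_free_diff eval_free_scaleC eval_free_gen_times eval_free_one


section \<open>Hopf *-algebras and unitary corepresentations\<close>

locale hopf_star =
  fixes H :: "'a::star_algebra hopf"
  assumes hopf: "hopf_star_algebra H"
begin

lemma coprod_add [rule_format]: "\<forall>x y. tens_eq (coprod H (x + y)) (coprod H x @ coprod H y)"
  and coprod_scale [rule_format]: "\<forall>c x. tens_eq (coprod H (c *\<^sub>C x)) (map (\<lambda>(y, z). (c *\<^sub>C y, z)) (coprod H x))"
  and coprod_one: "tens_eq (coprod H 1) [(1, 1)]"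
  and coprod_mult [rule_format]: "\<forall>x y. tens_eq (coprod H (x * y))
       [(x1 * y1, x2 * y2). (x1, x2) \<leftarrow> coprod H x, (y1, y2) \<leftarrow> coprod H y]"
  and coprod_star [rule_format]: "\<forall>x. tens_eq (coprod H (star x)) (map (\<lambda>(y, z). (star y, star z)) (coprod H x))"
  and coassoc [rule_format]: "\<forall>x \<phi> \<psi> \<theta>. clinear \<phi> \<longrightarrow> clinear \<psi> \<longrightarrow> clinear \<theta> \<longrightarrow>
       (\<Sum>(y, z)\<leftarrow>coprod H x. \<Sum>(y1, y2)\<leftarrow>coprod H y. \<phi> y1 * \<psi> y2 * \<theta> z :: complex) =
       (\<Sum>(y, z)\<leftarrow>coprod H x. \<Sum>(z1, z2)\<leftarrow>coprod H z. \<phi> y * \<psi> z1 * \<theta> z2)"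
  and counit_clinear: "clinear (counit H)"
  and counit_one: "counit H 1 = 1"
  and counit_mult [rule_format]: "\<forall>x y. counit H (x * y) = counit H x * counit H y"
  and counit_star [rule_format]: "\<forall>x. counit H (star x) = cnj (counit H x)"
  and counit_left [rule_format]: "\<forall>x. (\<Sum>(y, z)\<leftarrow>coprod H x. counit H y *\<^sub>C z) = x"
  and counit_right [rule_format]: "\<forall>x. (\<Sum>(y, z)\<leftarrow>coprod H x. counit H z *\<^sub>C y) = x"
  and antip_clinear: "clinear (antip H)"
  and antip_left [rule_format]: "\<forall>x. (\<Sum>(y, z)\<leftarrow>coprod H x. antip H y * z) = counit H x *\<^sub>C 1"
  using hopf unfolding hopf_star_algebra_def by - (elim conjE, assumption)+

text \<open>The Hopf axioms are equalities of tensors, so they may be used under any bilinear map,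
  in particular under maps with values in the algebra or in the double.\<close>

lemma coprod_bilinear:
  fixes \<beta> :: "'a \<Rightarrow> 'a \<Rightarrow> 'c::complex_vector"
  assumes l: "\<And>y. clinear (\<lambda>x. \<beta> x y)" and r: "\<And>x. clinear (\<beta> x)"
  shows coprod_bilinear_clinear: "clinear (\<lambda>x. \<Sum>(y, z)\<leftarrow>coprod H x. \<beta> y z)"
    and coprod_bilinear_one: "(\<Sum>(y, z)\<leftarrow>coprod H 1. \<beta> y z) = \<beta> 1 1"
    and coprod_bilinear_mult: "(\<Sum>(y, z)\<leftarrow>coprod H (x * x'). \<beta> y z) =
      (\<Sum>(y, z)\<leftarrow>coprod H x. \<Sum>(y', z')\<leftarrow>coprod H x'. \<beta> (y * y') (z * z'))"
    and coprod_bilinear_star: "(\<Sum>(y, z)\<leftarrow>coprod H (star x). \<beta> y z) =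
      (\<Sum>(y, z)\<leftarrow>coprod H x. \<beta> (star y) (star z))"
proof -
  show "clinear (\<lambda>x. \<Sum>(y, z)\<leftarrow>coprod H x. \<beta> y z)"
  proof (rule clinearI)
    show "(\<Sum>(y, z)\<leftarrow>coprod H (x + x'). \<beta> y z) =
        (\<Sum>(y, z)\<leftarrow>coprod H x. \<beta> y z) + (\<Sum>(y, z)\<leftarrow>coprod H x'. \<beta> y z)" for x x'
      by (simp add: tens_eq_bilinear[OF coprod_add l r])
    show "(\<Sum>(y, z)\<leftarrow>coprod H (c *\<^sub>C x). \<beta> y z) = c *\<^sub>C (\<Sum>(y, z)\<leftarrow>coprod H x. \<beta> y z)" for c x
      unfolding tens_eq_bilinear[OF coprod_scale l r]
      by (simp add: comp_def case_prod_unfold clinear_scale[OF l] scaleC_sum_list2[unfolded case_prod_unfold])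
  qed
  show "(\<Sum>(y, z)\<leftarrow>coprod H 1. \<beta> y z) = \<beta> 1 1"
    by (simp add: tens_eq_bilinear[OF coprod_one l r])
  show "(\<Sum>(y, z)\<leftarrow>coprod H (x * x'). \<beta> y z) =
      (\<Sum>(y, z)\<leftarrow>coprod H x. \<Sum>(y', z')\<leftarrow>coprod H x'. \<beta> (y * y') (z * z'))"
    unfolding tens_eq_bilinear[OF coprod_mult l r]
    by (simp add: map_concat sum_list_concat_map comp_def case_prod_unfold)
  show "(\<Sum>(y, z)\<leftarrow>coprod H (star x). \<beta> y z) = (\<Sum>(y, z)\<leftarrow>coprod H x. \<beta> (star y) (star z))"
    unfolding tens_eq_bilinear[OF coprod_star l r]
    by (simp add: comp_def case_prod_unfold)
qed

lemma lact_clinear: "clinear \<omega> \<Longrightarrow> clinear (lact H \<omega>)"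
  and ract_clinear: "clinear \<omega> \<Longrightarrow> clinear (\<lambda>b. ract H b \<omega>)"
  unfolding lact_def ract_def
  by (intro coprod_bilinear_clinear clinear_intros; assumption)+

lemma lact_counit: "lact H (counit H) b = b"
  by (simp add: lact_def counit_right)

lemma ract_counit: "ract H b (counit H) = b"
  by (simp add: ract_def counit_left)

lemma functional_lact: "clinear \<phi> \<Longrightarrow> \<phi> (lact H \<theta> b) = (\<Sum>(y, z)\<leftarrow>coprod H b. \<phi> y * \<theta> z)"
  unfolding lact_def by (simp add: clinear_sum_list2[where f = \<phi>] clinear_scale[where f = \<phi>] mult.commute)

lemma functional_ract: "clinear \<phi> \<Longrightarrow> \<phi> (ract H b \<omega>) = (\<Sum>(y, z)\<leftarrow>coprod H b. \<omega> y * \<phi> z)"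
  unfolding ract_def by (simp add: clinear_sum_list2[where f = \<phi>] clinear_scale[where f = \<phi>])

text \<open>The two actions use the two outer legs of the twofold coproduct, so coassociativity
  makes them commute. Hence the sphere, cut out by a left action, is stable under right
  actions.\<close>

lemma lact_ract:
  assumes "clinear \<omega>" "clinear \<theta>"
  shows "lact H \<theta> (ract H b \<omega>) = ract H (lact H \<theta> b) \<omega>"
proof (rule clinear_functional_eqI)
  fix \<phi> :: "'a \<Rightarrow> complex"
  assume \<phi>: "clinear \<phi>"
  have "\<phi> (lact H \<theta> (ract H b \<omega>)) = (\<Sum>(y, z)\<leftarrow>coprod H b. \<omega> y * \<phi> (lact H \<theta> z))"
    by (rule functional_ract) (intro clinear_compose[OF \<phi>] lact_clinear assms)
  also have "\<dots> = (\<Sum>(y, z)\<leftarrow>coprod H b. \<Sum>(z1, z2)\<leftarrow>coprod H z. \<omega> y * \<phi> z1 * \<theta> z2)"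
    by (simp only: functional_lact[OF \<phi>] mult.assoc sum_list_const_mult case_prod_unfold)
  also have "\<dots> = (\<Sum>(y, z)\<leftarrow>coprod H b. \<Sum>(y1, y2)\<leftarrow>coprod H y. \<omega> y1 * \<phi> y2 * \<theta> z)"
    by (simp only: coassoc assms \<phi>)
  also have "\<dots> = (\<Sum>(y, z)\<leftarrow>coprod H b. \<phi> (ract H y \<omega>) * \<theta> z)"
    by (simp only: functional_ract[OF \<phi>] sum_list_mult_const case_prod_unfold)
  also have "\<dots> = \<phi> (ract H (lact H \<theta> b) \<omega>)"
    by (rule functional_lact[symmetric]) (intro clinear_compose[OF \<phi>] ract_clinear assms)
  finally show "\<phi> (lact H \<theta> (ract H b \<omega>)) = \<phi> (ract H (lact H \<theta> b) \<omega>)" .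
qed

text \<open>The adjoint of the antipode axiom at \<open>star x\<close>. Once
  \<open>star (antip H (star y))\<close> is recognised as the inverse antipode, this is the axiom
  that collapses the exchange relation under the counit.\<close>

lemma star_antip_star_right: "(\<Sum>(y, z)\<leftarrow>coprod H x. z * star (antip H (star y))) = counit H x *\<^sub>C 1"
proof -
  have "counit H (star x) *\<^sub>C (1::'a) = (\<Sum>(y, z)\<leftarrow>coprod H (star x). antip H y * z)"
    by (simp add: antip_left)
  also have "\<dots> = (\<Sum>(y, z)\<leftarrow>coprod H x. antip H (star y) * star z)"
    by (rule coprod_bilinear_star) (intro clinear_intros clinear_compose[OF clinear_mult_left antip_clinear])+
  finally have "star (counit H (star x) *\<^sub>C (1::'a)) = star (\<Sum>(y, z)\<leftarrow>coprod H x. antip H (star y) * star z)"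
    by simp
  then show ?thesis
    by (simp add: star_sum_list2 star_mult star_star star_scaleC counit_star)
qed

lemma corep_bilinear:
  fixes \<beta> :: "'a \<Rightarrow> 'a \<Rightarrow> 'c::complex_vector"
  assumes "corep H js v" "j \<in> set js" "l \<in> set js"
    and "\<And>y. clinear (\<lambda>x. \<beta> x y)" "\<And>x. clinear (\<beta> x)"
  shows "(\<Sum>(y, z)\<leftarrow>coprod H (v j l). \<beta> y z) = (\<Sum>m\<in>set js. \<beta> (v j m) (v m l))"
proof -
  have t: "tens_eq (coprod H (v j l)) [(v j m, v m l). m \<leftarrow> js]" and d: "distinct js"
    using assms unfolding corep_def by auto
  show ?thesis
    using tens_eq_bilinear[OF t assms(4-)] d
    by (simp add: comp_def sum_list_distinct_conv_sum_set)
qed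

lemma corepI:
  assumes "distinct js"
    and "\<And>j l (\<phi>::'a \<Rightarrow> complex) (\<psi>::'a \<Rightarrow> complex). j \<in> set js \<Longrightarrow> l \<in> set js \<Longrightarrow> clinear \<phi> \<Longrightarrow> clinear \<psi> \<Longrightarrow>
      (\<Sum>(y, z)\<leftarrow>coprod H (v j l). \<phi> y * \<psi> z) = (\<Sum>m\<in>set js. \<phi> (v j m) * \<psi> (v m l))"
    and "\<And>j l. j \<in> set js \<Longrightarrow> l \<in> set js \<Longrightarrow> counit H (v j l) = (if j = l then 1 else 0)"
  shows "corep H js v"
  using assms unfolding corep_def tens_eq_def
  by (auto simp: comp_def sum_list_distinct_conv_sum_set)

text \<open>Both sides are entries of an inverse of the matrix \<open>v\<close>: the antipode gives
  a left inverse, unitarity gives the adjoint as a right inverse, and the two must coincide.\<close>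

lemma antip_unitary_corep:
  assumes v: "unitary_corep H js v" and j: "j \<in> set js" and l: "l \<in> set js"
  shows "antip H (v j l) = star (v l j)"
proof -
  have c: "corep H js v" using v by (simp add: unitary_corep_def)
  have 1: "(\<Sum>m\<in>set js. antip H (v j m) * v m n) = (if j = n then 1 else 0)" if "n \<in> set js" for n
  proof -
    have "(\<Sum>m\<in>set js. antip H (v j m) * v m n) = counit H (v j n) *\<^sub>C 1"
      unfolding antip_left[symmetric]
      by (rule corep_bilinear[OF c j that, symmetric])
        (intro clinear_intros clinear_compose[OF clinear_mult_left antip_clinear])+
    then show ?thesis
      using c j that by (simp add: corep_def)
  qed
  have 2: "(\<Sum>n\<in>set js. v m n * star (v l n)) = (if m = l then 1 else 0)" if "m \<in> set js" for m
    using v that l by (simp add: unitary_corep_def)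
  have "star (v l j) = (\<Sum>n\<in>set js. (\<Sum>m\<in>set js. antip H (v j m) * v m n) * star (v l n))"
    using j by (simp add: 1 if_distrib[of "\<lambda>x. x * _"] sum.delta' cong: if_cong)
  also have "\<dots> = (\<Sum>n\<in>set js. \<Sum>m\<in>set js. antip H (v j m) * (v m n * star (v l n)))"
    by (simp add: sum_distrib_right mult.assoc)
  also have "\<dots> = (\<Sum>m\<in>set js. antip H (v j m) * (\<Sum>n\<in>set js. v m n * star (v l n)))"
    by (subst sum.swap) (simp add: sum_distrib_left)
  also have "\<dots> = antip H (v j l)"
    using l by (simp add: 2 if_distrib[of "\<lambda>x. _ * x"] cong: if_cong)
  finally show ?thesis ..
qed

end

section \<open>Tensor products and direct sums of unitary corepresentations\<close>

definition coefs :: "nat \<Rightarrow> (nat \<Rightarrow> nat \<Rightarrow> 'a) \<Rightarrow> 'a set" where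
  "coefs d v = {v j l | j l. j < d \<and> l < d}"

text \<open>Pairs of indices are coded by quotient and remainder modulo \<open>d'\<close>, because
  \<open>is_Phi\<close> tests only corepresentations indexed by an initial segment
  \<open>[0..<d]\<close>.\<close>

definition tensor_corep :: "nat \<Rightarrow> (nat \<Rightarrow> nat \<Rightarrow> 'a::times) \<Rightarrow> (nat \<Rightarrow> nat \<Rightarrow> 'a) \<Rightarrow> nat \<Rightarrow> nat \<Rightarrow> 'a" where
  "tensor_corep d' v w j l = v (j div d') (l div d') * w (j mod d') (l mod d')"

definition sum_corep :: "nat \<Rightarrow> (nat \<Rightarrow> nat \<Rightarrow> 'a::zero) \<Rightarrow> (nat \<Rightarrow> nat \<Rightarrow> 'a) \<Rightarrow> nat \<Rightarrow> nat \<Rightarrow> 'a" where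
  "sum_corep d v w j l = (if j < d \<and> l < d then v j l
     else if d \<le> j \<and> d \<le> l then w (j - d) (l - d) else 0)"

lemma sum_div_mod:
  fixes f :: "nat \<Rightarrow> nat \<Rightarrow> 'b::comm_monoid_add"
  shows "(\<Sum>m\<in>{0..<d * d'}. f (m div d') (m mod d')) = (\<Sum>i\<in>{0..<d}. \<Sum>k\<in>{0..<d'}. f i k)"
proof -
  have "(\<Sum>m\<in>{0..<d * d'}. f (m div d') (m mod d')) = (\<Sum>(i, k)\<in>{0..<d} \<times> {0..<d'}. f i k)"
  proof (rule sum.reindex_bij_witness[where j = "\<lambda>m. (m div d', m mod d')" and i = "\<lambda>(i, k). i * d' + k"])
    fix m assume "m \<in> {0..<d * d'}"
    then show "(m div d', m mod d') \<in> {0..<d} \<times> {0..<d'}"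
      by (cases "d' = 0") (auto simp: less_mult_imp_div_less)
  next
    fix p assume p: "p \<in> {0..<d} \<times> {0..<d'}"
    obtain i k where ik: "p = (i, k)" "i < d" "k < d'" using p by auto
    have "i * d' + k < (i + 1) * d'" using ik by simp
    also have "\<dots> \<le> d * d'" using ik by (intro mult_right_mono) auto
    finally show "(case p of (i, k) \<Rightarrow> i * d' + k) \<in> {0..<d * d'}" using ik by simp
  qed auto
  then show ?thesis
    by (simp add: sum.cartesian_product)
qed

lemma sum_split_at:
  fixes f :: "nat \<Rightarrow> 'b::comm_monoid_add"
  shows "(\<Sum>m\<in>{0..<d + d'}. f m) = (\<Sum>m\<in>{0..<d}. f m) + (\<Sum>m\<in>{0..<d'}. f (d + m))"
proof -
  have "(\<Sum>m\<in>{d..<d + d'}. f m) = (\<Sum>m\<in>{0..<d'}. f (d + m))"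
    using sum.shift_bounds_nat_ivl[of f 0 d d'] by (simp add: add.commute)
  then show ?thesis
    by (simp add: sum.atLeastLessThan_concat[of 0 d "d + d'", symmetric])
qed

context hopf_star
begin

lemma tensor_corep:
  assumes v: "corep H [0..<d] v" and w: "corep H [0..<d'] w"
  shows "corep H [0..<d * d'] (tensor_corep d' v w)"
proof (rule corepI)
  fix j l and \<phi> \<psi> :: "'a \<Rightarrow> complex"
  assume jl: "j \<in> set [0..<d * d']" "l \<in> set [0..<d * d']" and lin: "clinear \<phi>" "clinear \<psi>"
  have d': "d' > 0" using jl by (cases d') auto
  let ?j = "j div d'" and ?j' = "j mod d'" and ?l = "l div d'" and ?l' = "l mod d'"
  have in1: "?j \<in> set [0..<d]" "?l \<in> set [0..<d]" and in2: "?j' \<in> set [0..<d']" "?l' \<in> set [0..<d']"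
    using jl d' by (auto simp: less_mult_imp_div_less)
  have "(\<Sum>(y, z)\<leftarrow>coprod H (tensor_corep d' v w j l). \<phi> y * \<psi> z) =
      (\<Sum>(y, z)\<leftarrow>coprod H (v ?j ?l). \<Sum>(y', z')\<leftarrow>coprod H (w ?j' ?l'). \<phi> (y * y') * \<psi> (z * z'))"
    unfolding tensor_corep_def by (rule coprod_bilinear_mult) (intro clinear_intros lin)+
  also have "\<dots> = (\<Sum>(y, z)\<leftarrow>coprod H (v ?j ?l). \<Sum>k\<in>{0..<d'}. \<phi> (y * w ?j' k) * \<psi> (z * w k ?l'))"
  proof (rule sum_list2_cong)
    fix y z
    show "(\<Sum>(y', z')\<leftarrow>coprod H (w ?j' ?l'). \<phi> (y * y') * \<psi> (z * z')) =
        (\<Sum>k\<in>{0..<d'}. \<phi> (y * w ?j' k) * \<psi> (z * w k ?l'))"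
      by (rule corep_bilinear[OF w in2, simplified])
        (intro clinear_intros clinear_compose[OF lin(1)] clinear_compose[OF lin(2)])+
  qed
  also have "\<dots> = (\<Sum>k\<in>{0..<d'}. \<Sum>(y, z)\<leftarrow>coprod H (v ?j ?l). \<phi> (y * w ?j' k) * \<psi> (z * w k ?l'))"
    by (rule sum_list2_sum)
  also have "\<dots> = (\<Sum>k\<in>{0..<d'}. \<Sum>i\<in>{0..<d}. \<phi> (v ?j i * w ?j' k) * \<psi> (v i ?l * w k ?l'))"
  proof (rule sum.cong[OF refl])
    fix k
    show "(\<Sum>(y, z)\<leftarrow>coprod H (v ?j ?l). \<phi> (y * w ?j' k) * \<psi> (z * w k ?l')) =
        (\<Sum>i\<in>{0..<d}. \<phi> (v ?j i * w ?j' k) * \<psi> (v i ?l * w k ?l'))"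
      by (rule corep_bilinear[OF v in1, simplified])
        (intro clinear_intros clinear_compose[OF lin(1)] clinear_compose[OF lin(2)])+
  qed
  also have "\<dots> = (\<Sum>m\<in>set [0..<d * d']. \<phi> (tensor_corep d' v w j m) * \<psi> (tensor_corep d' v w m l))"
    by (subst sum.swap)
      (simp add: tensor_corep_def sum_div_mod[where f = "\<lambda>i k. \<phi> (v ?j i * w ?j' k) * \<psi> (v i ?l * w k ?l')"])
  finally show "(\<Sum>(y, z)\<leftarrow>coprod H (tensor_corep d' v w j l). \<phi> y * \<psi> z) =
      (\<Sum>m\<in>set [0..<d * d']. \<phi> (tensor_corep d' v w j m) * \<psi> (tensor_corep d' v w m l))" .
next
  fix j l
  assume jl: "j \<in> set [0..<d * d']" "l \<in> set [0..<d * d']"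
  have d': "d' > 0" using jl by (cases d') auto
  have "j = l \<longleftrightarrow> j div d' = l div d' \<and> j mod d' = l mod d'"
    by (metis div_mult_mod_eq)
  then show "counit H (tensor_corep d' v w j l) = (if j = l then 1 else 0)"
    using v w jl d' by (simp add: tensor_corep_def counit_mult corep_def less_mult_imp_div_less)
qed simp

lemma tensor_unitary_corep:
  assumes v: "unitary_corep H [0..<d] v" and w: "unitary_corep H [0..<d'] w"
  shows "unitary_corep H [0..<d * d'] (tensor_corep d' v w)"
  unfolding unitary_corep_def
proof (intro conjI ballI)
  show "corep H [0..<d * d'] (tensor_corep d' v w)"
    using v w by (intro tensor_corep) (simp_all add: unitary_corep_def)
next
  fix j l
  assume jl: "j \<in> set [0..<d * d']" "l \<in> set [0..<d * d']"
  have d': "d' > 0" using jl by (cases d') auto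
  let ?j = "j div d'" and ?j' = "j mod d'" and ?l = "l div d'" and ?l' = "l mod d'"
  have ins: "?j < d" "?l < d" "?j' < d'" "?l' < d'"
    using jl d' by (auto simp: less_mult_imp_div_less)
  have eq: "j = l \<longleftrightarrow> ?j = ?l \<and> ?j' = ?l'"
    by (metis div_mult_mod_eq)
  have "(\<Sum>m\<in>set [0..<d * d']. star (tensor_corep d' v w m j) * tensor_corep d' v w m l) =
     (\<Sum>i\<in>{0..<d}. \<Sum>k\<in>{0..<d'}. star (v i ?j * w k ?j') * (v i ?l * w k ?l'))"
    by (simp add: tensor_corep_def sum_div_mod[where f = "\<lambda>i k. star (v i ?j * w k ?j') * (v i ?l * w k ?l')"])
  \<comment> \<open>The adjoint reverses products, so here the sum over the first factor stands in
    the middle and collapses first; in the other unitarity identity it is the sum over the second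
    factor.\<close>
  also have "\<dots> = (\<Sum>k\<in>{0..<d'}. star (w k ?j') * (\<Sum>i\<in>{0..<d}. star (v i ?j) * v i ?l) * w k ?l')"
    by (subst sum.swap) (simp add: star_mult sum_distrib_left sum_distrib_right mult.assoc)
  also have "\<dots> = (if j = l then 1 else 0)"
    using v w ins by (auto simp: unitary_corep_def eq)
  finally show "(\<Sum>m\<in>set [0..<d * d']. star (tensor_corep d' v w m j) * tensor_corep d' v w m l) =
     (if j = l then 1 else 0)" .
  have "(\<Sum>m\<in>set [0..<d * d']. tensor_corep d' v w j m * star (tensor_corep d' v w l m)) =
     (\<Sum>i\<in>{0..<d}. \<Sum>k\<in>{0..<d'}. v ?j i * w ?j' k * star (v ?l i * w ?l' k))"
    by (simp add: tensor_corep_def sum_div_mod[where f = "\<lambda>i k. v ?j i * w ?j' k * star (v ?l i * w ?l' k)"])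
  also have "\<dots> = (\<Sum>i\<in>{0..<d}. v ?j i * (\<Sum>k\<in>{0..<d'}. w ?j' k * star (w ?l' k)) * star (v ?l i))"
    by (simp add: star_mult sum_distrib_left sum_distrib_right mult.assoc)
  also have "\<dots> = (if j = l then 1 else 0)"
    using v w ins by (auto simp: unitary_corep_def eq)
  finally show "(\<Sum>m\<in>set [0..<d * d']. tensor_corep d' v w j m * star (tensor_corep d' v w l m)) =
     (if j = l then 1 else 0)" .
qed

lemma sum_unitary_corep:
  assumes v: "unitary_corep H [0..<d] v" and w: "unitary_corep H [0..<d'] w"
  shows "unitary_corep H [0..<d + d'] (sum_corep d v w)"
  unfolding unitary_corep_def
proof (intro conjI ballI)
  have cv: "corep H [0..<d] v" and cw: "corep H [0..<d'] w"
    using v w by (simp_all add: unitary_corep_def)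
  show "corep H [0..<d + d'] (sum_corep d v w)"
  proof (rule corepI)
    fix j l and \<phi> \<psi> :: "'a \<Rightarrow> complex"
    assume jl: "j \<in> set [0..<d + d']" "l \<in> set [0..<d + d']" and lin: "clinear \<phi>" "clinear \<psi>"
    have zero: "(\<Sum>(y, z)\<leftarrow>coprod H 0. \<phi> y * \<psi> z) = 0"
      by (rule clinear_0[OF coprod_bilinear_clinear]) (intro clinear_intros lin)+
    have b: "\<And>y. clinear (\<lambda>x. \<phi> x * \<psi> y)" "\<And>x. clinear (\<lambda>y. \<phi> x * \<psi> y)"
      by (intro clinear_intros lin)+
    consider "j < d" "l < d" | "d \<le> j" "d \<le> l" | "j < d" "d \<le> l" | "d \<le> j" "l < d"
      by linarith
    then show "(\<Sum>(y, z)\<leftarrow>coprod H (sum_corep d v w j l). \<phi> y * \<psi> z) =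
        (\<Sum>m\<in>set [0..<d + d']. \<phi> (sum_corep d v w j m) * \<psi> (sum_corep d v w m l))"
      using jl
      by cases (simp_all add: sum_corep_def sum_split_at zero clinear_0[OF lin(1)] clinear_0[OF lin(2)]
          corep_bilinear[OF cv _ _ b] corep_bilinear[OF cw _ _ b] less_diff_conv2)
  next
    fix j l
    assume "j \<in> set [0..<d + d']" "l \<in> set [0..<d + d']"
    then show "counit H (sum_corep d v w j l) = (if j = l then 1 else 0)"
      using cv cw by (auto simp: sum_corep_def corep_def clinear_0[OF counit_clinear])
  qed simp
next
  fix j l
  assume jl: "j \<in> set [0..<d + d']" "l \<in> set [0..<d + d']"
  have uv: "(\<Sum>m\<in>{0..<d}. star (v m j) * v m l) = (if j = l then 1 else 0)"
    "(\<Sum>m\<in>{0..<d}. v j m * star (v l m)) = (if j = l then 1 else 0)" if "j < d" "l < d" for j l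
    using v that by (simp_all add: unitary_corep_def)
  have uw: "(\<Sum>m\<in>{0..<d'}. star (w m j) * w m l) = (if j = l then 1 else 0)"
    "(\<Sum>m\<in>{0..<d'}. w j m * star (w l m)) = (if j = l then 1 else 0)" if "j < d'" "l < d'" for j l
    using w that by (simp_all add: unitary_corep_def)
  have split: "(\<exists>i'. i = d + i' \<and> i' < d') \<or> i < d" if "i \<in> set [0..<d + d']" for i
    using that by (cases "i < d") (auto intro!: exI[of _ "i - d"])
  from split[OF jl(1)] split[OF jl(2)] have "(\<Sum>m\<in>set [0..<d + d']. star (sum_corep d v w m j) * sum_corep d v w m l) = (if j = l then 1 else 0) \<and>
    (\<Sum>m\<in>set [0..<d + d']. sum_corep d v w j m * star (sum_corep d v w l m)) = (if j = l then 1 else 0)"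
    by (elim disjE exE) (simp_all add: sum_split_at sum_corep_def uv uw)
  then show "(\<Sum>m\<in>set [0..<d + d']. star (sum_corep d v w m j) * sum_corep d v w m l) = (if j = l then 1 else 0)"
    "(\<Sum>m\<in>set [0..<d + d']. sum_corep d v w j m * star (sum_corep d v w l m)) = (if j = l then 1 else 0)"
    by simp_all
qed

lemma span_coefs_tensor:
  assumes b: "b \<in> cvec.span (coefs d v)" and b': "b' \<in> cvec.span (coefs d' (w :: nat \<Rightarrow> nat \<Rightarrow> 'a))"
  shows "b * b' \<in> cvec.span (coefs (d * d') (tensor_corep d' v w))"
proof -
  let ?S = "cvec.span (coefs (d * d') (tensor_corep d' v w))"
  have 1: "x * y \<in> ?S" if x: "x \<in> coefs d v" and y: "y \<in> coefs d' w" for x y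
  proof -
    obtain j l where jl: "x = v j l" "j < d" "l < d" using x by (auto simp: coefs_def)
    obtain j' l' where jl': "y = w j' l'" "j' < d'" "l' < d'" using y by (auto simp: coefs_def)
    have lt: "i * d' + i' < d * d'" if "i < d" "i' < d'" for i i'
    proof -
      have "i * d' + i' < (i + 1) * d'" using that by simp
      also have "\<dots> \<le> d * d'" using that by (intro mult_right_mono) auto
      finally show ?thesis .
    qed
    have "x * y = tensor_corep d' v w (j * d' + j') (l * d' + l')"
      using jl jl' by (simp add: tensor_corep_def)
    then show ?thesis
      using jl jl' lt by (intro cvec.span_base) (auto simp: coefs_def)
  qed
  have sub: "cvec.subspace ?S" by simp
  have 2: "x * b' \<in> ?S" if x: "x \<in> coefs d v" for x
    using b'
  proof (induction rule: cvec.span_induct_alt)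
    case base
    show ?case using cvec.subspace_0[OF sub] by simp
  next
    case (step c y z)
    then show ?case
      by (simp add: distrib_left mult_scaleC_right cvec.subspace_add[OF sub] cvec.subspace_scale[OF sub] 1[OF x])
  qed
  show ?thesis
    using b
  proof (induction rule: cvec.span_induct_alt)
    case base
    show ?case using cvec.subspace_0[OF sub] by simp
  next
    case (step c y z)
    then show ?case
      by (simp add: distrib_right mult_scaleC_left cvec.subspace_add[OF sub] cvec.subspace_scale[OF sub] 2)
  qed
qed

lemma span_coefs_sum:
  "cvec.span (coefs d v) \<subseteq> cvec.span (coefs (d + d') (sum_corep d v w))"
  "cvec.span (coefs d' w) \<subseteq> cvec.span (coefs (d + d') (sum_corep d v (w :: nat \<Rightarrow> nat \<Rightarrow> 'a)))"
proof -
  have "coefs d v \<subseteq> coefs (d + d') (sum_corep d v w)"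
  proof
    fix x assume "x \<in> coefs d v"
    then obtain j l where jl: "x = v j l" "j < d" "l < d"
      by (auto simp: coefs_def)
    then have "x = sum_corep d v w j l" by (simp add: sum_corep_def)
    then show "x \<in> coefs (d + d') (sum_corep d v w)"
      using jl unfolding coefs_def by fastforce
  qed
  moreover have "coefs d' w \<subseteq> coefs (d + d') (sum_corep d v w)"
  proof
    fix x assume "x \<in> coefs d' w"
    then obtain j l where jl: "x = w j l" "j < d'" "l < d'"
      by (auto simp: coefs_def)
    then have "x = sum_corep d v w (d + j) (d + l)" by (simp add: sum_corep_def)
    moreover have "d + j < d + d'" "d + l < d + d'" using jl by simp_all
    ultimately show "x \<in> coefs (d + d') (sum_corep d v w)"
      unfolding coefs_def by blast
  qed
  ultimately show "cvec.span (coefs d v) \<subseteq> cvec.span (coefs (d + d') (sum_corep d v w))"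
    "cvec.span (coefs d' w) \<subseteq> cvec.span (coefs (d + d') (sum_corep d v w))"
    by (simp_all add: cvec.span_mono)
qed

text \<open>A single corepresentation is required for each element, instead of a span over all of
  them; direct sums then account for addition and tensor products for multiplication.\<close>

definition unitary_coefs :: "'a set" where
  "unitary_coefs = {b. \<exists>d v. unitary_corep H [0..<d] v \<and> b \<in> cvec.span (coefs d v)}"

lemma unitary_coefs_coef: "unitary_corep H [0..<d] v \<Longrightarrow> j < d \<Longrightarrow> l < d \<Longrightarrow> v j l \<in> unitary_coefs"
  using cvec.span_base[of "v j l" "coefs d v"] unfolding unitary_coefs_def coefs_def by blast

lemma unitary_coefs_scale: "b \<in> unitary_coefs \<Longrightarrow> c *\<^sub>C b \<in> unitary_coefs"
  unfolding unitary_coefs_def using cvec.span_scale by blast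

lemma unitary_coefs_add: "b \<in> unitary_coefs \<Longrightarrow> b' \<in> unitary_coefs \<Longrightarrow> b + b' \<in> unitary_coefs"
  unfolding unitary_coefs_def
proof clarify
  fix d d' v w
  assume "unitary_corep H [0..<d] v" "b \<in> cvec.span (coefs d v)"
    "unitary_corep H [0..<d'] w" "b' \<in> cvec.span (coefs d' w)"
  then have "unitary_corep H [0..<d + d'] (sum_corep d v w)"
    "b + b' \<in> cvec.span (coefs (d + d') (sum_corep d v w))"
    using sum_unitary_corep span_coefs_sum cvec.span_add by blast+
  then show "\<exists>d v. unitary_corep H [0..<d] v \<and> b + b' \<in> cvec.span (coefs d v)"
    by blast
qed

lemma unitary_coefs_mult: "b \<in> unitary_coefs \<Longrightarrow> b' \<in> unitary_coefs \<Longrightarrow> b * b' \<in> unitary_coefs"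
  unfolding unitary_coefs_def using tensor_unitary_corep span_coefs_tensor by blast

lemma unitary_coefs_one: "1 \<in> unitary_coefs"
proof -
  have "unitary_corep H [0..<1] (\<lambda>_ _. 1)"
    unfolding unitary_corep_def
    by (auto intro!: corepI simp: counit_one coprod_bilinear_one clinear_intros)
  then show ?thesis
    by (rule unitary_coefs_coef[where j = 0 and l = 0]) auto
qed

text \<open>Direct sums place finitely many elements in one coefficient space, so that one matrix,
  and later one interpolating polynomial, serves all of them.\<close>

lemma unitary_coefs_finite:
  assumes "finite F" "F \<subseteq> unitary_coefs"
  obtains d v where "unitary_corep H [0..<d] v" "F \<subseteq> cvec.span (coefs d v)"
  using assms
proof (induction F arbitrary: thesis rule: finite_induct)
  case empty
  then show ?case using unitary_coefs_one unfolding unitary_coefs_def by blast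
next
  case (insert b F)
  obtain d v where 1: "unitary_corep H [0..<d] v" "F \<subseteq> cvec.span (coefs d v)"
    using insert.IH insert.prems by blast
  obtain d' w where 2: "unitary_corep H [0..<d'] w" "b \<in> cvec.span (coefs d' w)"
    using insert.prems(2) unfolding unitary_coefs_def by auto
  show ?case
    by (rule insert.prems(1)[OF sum_unitary_corep[OF 1(1) 2(1)]])
      (use 1 2 span_coefs_sum in blast)
qed

end


section \<open>The quantum group SU(2)\<close>

locale oq_su2 = hopf_star H for H :: "'a::star_algebra hopf" +
  fixes q :: real and \<alpha> \<gamma> :: 'a
  assumes oq: "Oq_SU2 q H \<alpha> \<gamma>" and q: "0 < q"
begin

lemma su2_relations:
  shows "star \<alpha> * \<alpha> + star \<gamma> * \<gamma> = 1"
    and "\<alpha> * star \<alpha> + (of_real q)\<^sup>2 *\<^sub>C (\<gamma> * star \<gamma>) = 1"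
    and "star \<gamma> * \<gamma> = \<gamma> * star \<gamma>"
    and "\<alpha> * \<gamma> = of_real q *\<^sub>C (\<gamma> * \<alpha>)"
    and "star \<gamma> * star \<alpha> = of_real q *\<^sub>C (star \<alpha> * star \<gamma>)"
    and "\<alpha> * star \<gamma> = of_real q *\<^sub>C (star \<gamma> * \<alpha>)"
    and "\<gamma> * star \<alpha> = of_real q *\<^sub>C (star \<alpha> * \<gamma>)"
proof -
  let ?\<phi> = "\<lambda>g. case g of Al \<Rightarrow> \<alpha> | AlS \<Rightarrow> star \<alpha> | Ga \<Rightarrow> \<gamma> | GaS \<Rightarrow> star \<gamma>"
  have "\<forall>r\<in>su2_rels q. eval_free ?\<phi> r = 0"
    using oq presented_by_relation unfolding Oq_SU2_def by blast
  then show "star \<alpha> * \<alpha> + star \<gamma> * \<gamma> = 1"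
    and "\<alpha> * star \<alpha> + (of_real q)\<^sup>2 *\<^sub>C (\<gamma> * star \<gamma>) = 1"
    and "star \<gamma> * \<gamma> = \<gamma> * star \<gamma>"
    and "\<alpha> * \<gamma> = of_real q *\<^sub>C (\<gamma> * \<alpha>)"
    and "star \<gamma> * star \<alpha> = of_real q *\<^sub>C (star \<alpha> * star \<gamma>)"
    and "\<alpha> * star \<gamma> = of_real q *\<^sub>C (star \<gamma> * \<alpha>)"
    and "\<gamma> * star \<alpha> = of_real q *\<^sub>C (star \<alpha> * \<gamma>)"
    by - (simp (no_asm_use) only: su2_rels_def Let_def ball_simps eval_free_simps su2_gen.case right_minus_eq simp_thms,
      elim conjE, assumption)+
qed

text \<open>Up to the normality of \<gamma>, each entry of the two unitarity identities is one of
  the defining relations of the quantum group.\<close>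

lemma fund_unitary: "unitary_corep H [0..<2] (fund q \<alpha> \<gamma>)"
proof -
  have c: "corep H [0..<2] (fund q \<alpha> \<gamma>)"
    using oq by (simp add: Oq_SU2_def upt_rec numeral_2_eq_2)
  have s: "set [0..<2] = {0, 1::nat}" by auto
  note r = su2_relations
  show ?thesis
    unfolding unitary_corep_def s using c r
    by (auto simp: fund_def star_scaleC star_star mult_scaleC_left mult_scaleC_right scaleC_scaleC
        power2_eq_square add.commute star_minus)
qed

text \<open>The coefficients form a subalgebra that contains the entries of the fundamental matrix,
  and these generate. From here on, linear statements on A may be checked on entries of unitary
  matrices.\<close>

lemma unitary_coefs_UNIV: "unitary_coefs = UNIV"
proof -
  let ?\<phi> = "\<lambda>g. case g of Al \<Rightarrow> \<alpha> | AlS \<Rightarrow> star \<alpha> | Ga \<Rightarrow> \<gamma> | GaS \<Rightarrow> star \<gamma>"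
  note f = unitary_coefs_coef[OF fund_unitary]
  have g: "\<alpha> \<in> unitary_coefs" "star \<alpha> \<in> unitary_coefs" "\<gamma> \<in> unitary_coefs"
    using f[of 0 0] f[of 1 1] f[of 1 0] by (simp_all add: fund_def)
  \<comment> \<open>The matrix entry is \<open>star \<gamma>\<close> multiplied by -q; the scalar is
    divided out, which uses that q is nonzero.\<close>
  have "(- (1 / of_real q)) *\<^sub>C (- complex_of_real q) *\<^sub>C star \<gamma> \<in> unitary_coefs"
    using f[of 0 1] by - (rule unitary_coefs_scale, simp add: fund_def)
  moreover have "(- (1 / of_real q)) *\<^sub>C (- complex_of_real q) *\<^sub>C star \<gamma> = star \<gamma>"
    using q by (simp add: scaleC_scaleC del: cvec.scale_minus_left cvec.scale_minus_right)
  ultimately have g': "star \<gamma> \<in> unitary_coefs"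
    by simp
  have w: "prod_list (map ?\<phi> l) \<in> unitary_coefs" for l
    by (induction l) (auto intro!: unitary_coefs_one unitary_coefs_mult g g' split: su2_gen.splits)
  have z: "0 \<in> unitary_coefs"
    using unitary_coefs_scale[OF unitary_coefs_one, of 0] by simp
  have sm: "(\<Sum>i\<in>A. f i) \<in> unitary_coefs" if "\<And>i. f i \<in> unitary_coefs" for A and f :: "_ \<Rightarrow> 'a"
    by (induction A rule: infinite_finite_induct) (auto intro!: z unitary_coefs_add that)
  have "eval_free ?\<phi> p \<in> unitary_coefs" for p
    unfolding eval_free_def by (intro sm unitary_coefs_scale w)
  moreover have "surj (eval_free ?\<phi>)"
    using oq by (simp add: Oq_SU2_def presented_by_def)
  ultimately show ?thesis by (metis UNIV_eq_I surj_def)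
qed

text \<open>On a unitary corepresentation \<open>star\<close> after \<open>antip\<close> transposes
  the matrix, and transposing twice is the identity. This makes \<open>antip\<close> bijective and
  turns \<open>antip_inv\<close>, defined through \<open>inv\<close>, into an explicit
  formula.\<close>

lemma star_antip_star_antip: "star (antip H (star (antip H b))) = b"
proof -
  obtain d v where v: "unitary_corep H [0..<d] v" and "b \<in> cvec.span (coefs d v)"
    using unitary_coefs_UNIV unfolding unitary_coefs_def by blast
  from this(2) show ?thesis
  proof (induction rule: cvec.span_induct_alt)
    case base
    show ?case by (simp add: clinear_0[OF antip_clinear])
  next
    case (step c x y)
    then show ?case
      by (auto simp: coefs_def clinear_add[OF antip_clinear] clinear_scale[OF antip_clinear]
          star_add star_scaleC star_star antip_unitary_corep[OF v])
  qed
qed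

lemma antip_inv_eq: "antip_inv H b = star (antip H (star b))"
proof -
  have "antip H (star (antip H (star b))) = b" for b
    using star_antip_star_antip[of "star b"] by (metis star_star)
  then have "inv (antip H) = (\<lambda>b. star (antip H (star b)))"
    using star_antip_star_antip by (intro inv_equality) auto
  then show ?thesis by (simp add: antip_inv_def)
qed

lemma antip_inv_clinear: "clinear (antip_inv H)"
  by (rule clinearI)
    (simp_all add: antip_inv_eq star_add star_scaleC clinear_add[OF antip_clinear] clinear_scale[OF antip_clinear])

lemma antip_inv_right: "(\<Sum>(y, z)\<leftarrow>coprod H x. z * antip_inv H y) = counit H x *\<^sub>C 1"
  using star_antip_star_right by (simp add: antip_inv_eq)

lemma finite_coefs:
  assumes "finite F"
  obtains d v where "unitary_corep H [0..<d] v" "F \<subseteq> cvec.span (coefs d v)"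
  using unitary_coefs_finite[OF assms] unitary_coefs_UNIV by auto

end


section \<open>Convolution in the full dual and the two actions of the dual\<close>

context hopf_star
begin

lemma conv_clinear: "clinear \<omega> \<Longrightarrow> clinear \<omega>' \<Longrightarrow> clinear (conv H \<omega> \<omega>')"
  unfolding conv_def by (intro coprod_bilinear_clinear clinear_intros)

lemma conv_one: "clinear \<omega> \<Longrightarrow> clinear \<omega>' \<Longrightarrow> conv H \<omega> \<omega>' 1 = \<omega> 1 * \<omega>' 1"
  unfolding conv_def by (intro coprod_bilinear_one clinear_intros)

lemma lact_conv:
  assumes "clinear \<omega>" "clinear \<omega>'"
  shows "lact H (conv H \<omega> \<omega>') b = lact H \<omega> (lact H \<omega>' b)"
proof (rule clinear_functional_eqI)
  fix \<phi> :: "'a \<Rightarrow> complex"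
  assume \<phi>: "clinear \<phi>"
  have "\<phi> (lact H \<omega> (lact H \<omega>' b)) = (\<Sum>(y, z)\<leftarrow>coprod H b. \<phi> (lact H \<omega> y) * \<omega>' z)"
    by (rule functional_lact) (intro clinear_compose[OF \<phi>] lact_clinear assms)
  also have "\<dots> = (\<Sum>(y, z)\<leftarrow>coprod H b. \<Sum>(y1, y2)\<leftarrow>coprod H y. \<phi> y1 * \<omega> y2 * \<omega>' z)"
    by (simp only: functional_lact[OF \<phi>] sum_list_mult_const case_prod_unfold)
  also have "\<dots> = (\<Sum>(y, z)\<leftarrow>coprod H b. \<Sum>(z1, z2)\<leftarrow>coprod H z. \<phi> y * \<omega> z1 * \<omega>' z2)"
    by (simp only: coassoc assms \<phi>)
  also have "\<dots> = \<phi> (lact H (conv H \<omega> \<omega>') b)"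
    by (simp only: functional_lact[OF \<phi>] conv_def mult.assoc sum_list_const_mult case_prod_unfold)
  finally show "\<phi> (lact H (conv H \<omega> \<omega>') b) = \<phi> (lact H \<omega> (lact H \<omega>' b))" ..
qed

lemma ract_conv:
  assumes "clinear \<omega>" "clinear \<omega>'"
  shows "ract H b (conv H \<omega> \<omega>') = ract H (ract H b \<omega>) \<omega>'"
proof (rule clinear_functional_eqI)
  fix \<phi> :: "'a \<Rightarrow> complex"
  assume \<phi>: "clinear \<phi>"
  have "\<phi> (ract H (ract H b \<omega>) \<omega>') = (\<Sum>(y, z)\<leftarrow>coprod H b. \<omega> y * \<phi> (ract H z \<omega>'))"
    by (rule functional_ract) (intro clinear_compose[OF \<phi>] ract_clinear assms)
  also have "\<dots> = (\<Sum>(y, z)\<leftarrow>coprod H b. \<Sum>(z1, z2)\<leftarrow>coprod H z. \<omega> y * \<omega>' z1 * \<phi> z2)"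
    by (simp only: functional_ract[OF \<phi>] mult.assoc sum_list_const_mult case_prod_unfold)
  also have "\<dots> = (\<Sum>(y, z)\<leftarrow>coprod H b. \<Sum>(y1, y2)\<leftarrow>coprod H y. \<omega> y1 * \<omega>' y2 * \<phi> z)"
    by (simp only: coassoc assms \<phi>)
  also have "\<dots> = \<phi> (ract H b (conv H \<omega> \<omega>'))"
    by (simp only: functional_ract[OF \<phi>] conv_def sum_list_mult_const case_prod_unfold)
  finally show "\<phi> (ract H b (conv H \<omega> \<omega>')) = \<phi> (ract H (ract H b \<omega>) \<omega>')" ..
qed

lemma lact_add: "lact H (\<lambda>x. \<omega> x + \<omega>' x) b = lact H \<omega> b + lact H \<omega>' b"
  and lact_scale: "lact H (\<lambda>x. c * \<omega> x) b = c *\<^sub>C lact H \<omega> b"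
  by (simp_all add: lact_def scaleC_left_distrib sum_list2_add scaleC_sum_list2 scaleC_scaleC)

lemma ract_add: "ract H b (\<lambda>x. \<omega> x + \<omega>' x) = ract H b \<omega> + ract H b \<omega>'"
  and ract_scale: "ract H b (\<lambda>x. c * \<omega> x) = c *\<^sub>C ract H b \<omega>"
  by (simp_all add: ract_def scaleC_left_distrib sum_list2_add scaleC_sum_list2 scaleC_scaleC)

lemma clinear_ract: "clinear f \<Longrightarrow> f (ract H b \<omega>) = (\<Sum>(y, z)\<leftarrow>coprod H b. \<omega> y *\<^sub>C f z)"
  unfolding ract_def by (simp add: clinear_sum_list2[where f = f] clinear_scale[where f = f])

lemma clinear_lact: "clinear f \<Longrightarrow> f (lact H \<omega> b) = (\<Sum>(y, z)\<leftarrow>coprod H b. \<omega> z *\<^sub>C f y)"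
  unfolding lact_def by (simp add: clinear_sum_list2[where f = f] clinear_scale[where f = f])

end

text \<open>The inverse antipode reverses the coproduct. It is checked on adjoints of unitary
  coefficients, where the inverse antipode simply transposes: it sends \<open>star (v l j)\<close>
  to \<open>v j l\<close>.\<close>

lemma (in oq_su2) conv_antip_inv:
  assumes "clinear \<omega>" "clinear \<omega>'"
  shows "conv H (\<lambda>x. \<omega> (antip_inv H x)) (\<lambda>x. \<omega>' (antip_inv H x)) x = conv H \<omega>' \<omega> (antip_inv H x)"
proof -
  obtain d v where v: "unitary_corep H [0..<d] v" and x: "star x \<in> cvec.span (coefs d v)"
    using unitary_coefs_UNIV unfolding unitary_coefs_def by blast
  have cv: "corep H [0..<d] v" using v by (simp add: unitary_corep_def)
  let ?L = "conv H (\<lambda>x. \<omega> (antip_inv H x)) (\<lambda>x. \<omega>' (antip_inv H x))"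
  let ?R = "\<lambda>x. conv H \<omega>' \<omega> (antip_inv H x)"
  have lin: "clinear ?L" "clinear ?R"
    by (intro conv_clinear clinear_compose[OF _ antip_inv_clinear] assms)+
  have T: "antip_inv H (star (v l j)) = v j l" if "j < d" "l < d" for j l
    using antip_unitary_corep[OF v, of l j] that by (simp add: antip_inv_eq star_star)
  have "?L (star y) = ?R (star y)" if "y \<in> cvec.span (coefs d v)" for y
    using that
  proof (induction rule: cvec.span_induct_alt)
    case base
    show ?case by (simp add: clinear_0[OF lin(1)] clinear_0[OF lin(2)])
  next
    case (step c y z)
    obtain l j where y: "y = v l j" "l < d" "j < d" using step by (auto simp: coefs_def)
    have "?L (star y) = (\<Sum>(x, z)\<leftarrow>coprod H (v l j). \<omega> (antip_inv H (star x)) * \<omega>' (antip_inv H (star z)))"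
      unfolding conv_def y
      by (rule coprod_bilinear_star) (intro clinear_intros clinear_compose[OF _ antip_inv_clinear] assms)+
    \<comment> \<open>The slots contain \<open>star\<close> and are antilinear; conjugating makes
      them linear, as needed to apply the coproduct of a matrix coefficient.\<close>
    also have "\<dots> = cnj (\<Sum>(x, z)\<leftarrow>coprod H (v l j).
        cnj (\<omega> (antip_inv H (star x))) * cnj (\<omega>' (antip_inv H (star z))))"
      by (simp add: cnj_sum_list2)
    also have "\<dots> = cnj (\<Sum>m\<in>{0..<d}. cnj (\<omega> (antip_inv H (star (v l m)))) * cnj (\<omega>' (antip_inv H (star (v m j)))))"
    proof -
      have "clinear (\<lambda>x. cnj (\<theta> (antip_inv H (star x))))" if "clinear \<theta>" for \<theta> :: "'a \<Rightarrow> complex"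
        by (rule clinearI) (simp_all add: star_add star_scaleC clinear_add[OF antip_inv_clinear]
          clinear_scale[OF antip_inv_clinear] clinear_add[OF that] clinear_scale[OF that])
      then show ?thesis
        using y by (subst corep_bilinear[OF cv]) (simp_all add: assms clinear_times_left clinear_times_right)
    qed
    also have "\<dots> = (\<Sum>m\<in>{0..<d}. \<omega>' (v j m) * \<omega> (v m l))"
      using y by (simp add: T mult.commute)
    also have "\<dots> = ?R (star y)"
      using y assms unfolding conv_def
      by (simp add: T corep_bilinear[OF cv] clinear_times_left clinear_times_right)
    finally have "?L (star y) = ?R (star y)" .
    then show ?case
      using step by (simp add: star_add star_scaleC clinear_add[OF lin(1)] clinear_add[OF lin(2)]
          clinear_scale[OF lin(1)] clinear_scale[OF lin(2)])
  qed
  from this[OF x] show ?thesis by (simp add: star_star)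
qed


section \<open>The pairing with the enveloping algebra\<close>

locale podles_sphere =
  fixes q a :: real and D :: "('a::star_algebra, 'u::star_algebra, 'x::star_algebra) podles"
  assumes q: "0 < q" "q < 1" and setting: "podles_setting q D"
begin

abbreviation "A \<equiv> hopfA D"
abbreviation "K \<equiv> hopfU D"
abbreviation "\<epsilon> \<equiv> counit A"
abbreviation "fo \<equiv> fun_of D"
abbreviation "B \<equiv> Bt D q a"
abbreviation "k \<equiv> kU D"
abbreviation "k' \<equiv> kinvU D"
abbreviation "T \<equiv> antip_inv A"

lemma setting_parts:
  shows su2: "Oq_SU2 q A (alpha D) (gamma D)"
    and uq: "Uq_su2 q K k k' (eU D) (fU D)"
    and pairing: "unitary_pairing A K (pair D)"
    and double: "drinfeld_double A (incA D) (incU D)"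
    and epsX_clinear: "clinear (epsX D)"
    and epsX_tensor [rule_format]: "\<forall>b. \<forall>\<omega>\<in>dual_of A. epsX D (incA D b * incU D \<omega>) = \<epsilon> b * \<omega> 1"
    and spin1_corep: "unitary_corep A [-1, 0, 1] (spin1 D)"
  using setting unfolding podles_setting_def by - (elim conjE, assumption)+

sublocale A: oq_su2 "hopfA D" q "alpha D" "gamma D"
  using su2 q by unfold_locales (auto simp: Oq_SU2_def)

sublocale U: hopf_star "hopfU D"
  using uq by unfold_locales (auto simp: Uq_su2_def)

lemma pair_clinear_left [rule_format]: "\<forall>h. clinear (\<lambda>b. pair D b h)"
  and pair_clinear_right [rule_format]: "\<forall>b. clinear (pair D b)"
  and pair_times_right [rule_format]: "\<forall>b h h'. pair D b (h * h') = (\<Sum>(y, z)\<leftarrow>coprod A b. pair D y h * pair D z h')"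
  and pair_times_left [rule_format]: "\<forall>b b' h. pair D (b * b') h = (\<Sum>(y, z)\<leftarrow>coprod K h. pair D b y * pair D b' z)"
  and pair_one_right [rule_format]: "\<forall>b. pair D b 1 = \<epsilon> b"
  and pair_one_left [rule_format]: "\<forall>h. pair D 1 h = counit K h"
  and pair_star_left [rule_format]: "\<forall>b h. pair D (star b) h = cnj (pair D b (star (antip K h)))"
  and pair_star_right [rule_format]: "\<forall>b h. pair D b (star h) = cnj (pair D (star (antip A b)) h)"
  using pairing unfolding unitary_pairing_def by - (elim conjE, assumption)+

lemma fun_of_clinear: "clinear (fo h)"
  unfolding fun_of_def by (rule pair_clinear_left)

lemma fun_of_times: "fo (h * h') = conv A (fo h) (fo h')"
  unfolding fun_of_def conv_def by (simp add: pair_times_right)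

lemma fun_of_one: "fo 1 = \<epsilon>"
  unfolding fun_of_def by (simp add: pair_one_right)

lemma fun_of_add: "fo (h + h') = (\<lambda>x. fo h x + fo h' x)"
  and fun_of_scale: "fo (c *\<^sub>C h) = (\<lambda>x. c * fo h x)"
  unfolding fun_of_def by (simp_all add: clinear_add[OF pair_clinear_right] clinear_scale[OF pair_clinear_right])

text \<open>The adjoint in the unitary pairing involves the antipode, and on unitary coefficients
  the antipode is the adjoint of the transposed entry. Self-adjoint elements thus act by Hermitian
  matrices.\<close>

lemma pair_hermitian:
  assumes v: "unitary_corep A js v" and "j \<in> set js" "l \<in> set js"
  shows "pair D (v j l) (star h) = cnj (pair D (v l j) h)"
  using A.antip_unitary_corep[OF assms] by (simp add: pair_star_right star_star)

section \<open>The element B_t: adjoint, counit, coproduct and antipode\<close>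

lemma uq_relations:
  shows "k * k' = 1" "k' * k = 1"
proof -
  let ?\<phi> = "\<lambda>g. case g of Kg \<Rightarrow> k | Ki \<Rightarrow> k' | Eg \<Rightarrow> eU D | Fg \<Rightarrow> fU D"
  have "\<forall>r\<in>uq_rels q. eval_free ?\<phi> r = 0"
    using uq presented_by_relation unfolding Uq_su2_def by blast
  then show "k * k' = 1" "k' * k = 1"
    by - (simp (no_asm_use) only: uq_rels_def Let_def ball_simps eval_free_simps uq_gen.case right_minus_eq simp_thms,
      elim conjE, assumption)+
qed

lemma uq_hopf:
  shows star_k: "star k = k" and star_e: "star (eU D) = fU D * k" and star_f: "star (fU D) = k' * eU D"
    and coprod_k: "tens_eq (coprod K k) [(k, k)]"
    and coprod_e: "tens_eq (coprod K (eU D)) [(eU D, 1), (k, eU D)]"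
    and coprod_f: "tens_eq (coprod K (fU D)) [(1, fU D), (fU D, k')]"
    and counit_k: "counit K k = 1" and counit_e: "counit K (eU D) = 0" and counit_f: "counit K (fU D) = 0"
  using uq unfolding Uq_su2_def by - (elim conjE, assumption)+

lemma star_k': "star k' = k'"
proof -
  have "star k' * k = 1"
    using arg_cong[OF uq_relations(1), of star] by (simp add: star_mult star_k)
  then have "star k' * k * k' = k'" by simp
  then show ?thesis by (simp add: mult.assoc uq_relations)
qed

lemma counit_k': "counit K k' = 1"
  using arg_cong[OF uq_relations(1), of "counit K"] by (simp add: U.counit_mult U.counit_one counit_k)

text \<open>The coproduct is prescribed only on \<open>k\<close>, \<open>e\<close>,
  \<open>f\<close>. Expanding that of \<open>k * k' = 1\<close> and multiplying both legs by
  \<open>k'\<close> from the left isolates the coproduct of the inverse.\<close>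

lemma coprod_k':
  fixes \<beta> :: "'u \<Rightarrow> 'u \<Rightarrow> 'c::complex_vector"
  assumes "\<And>y. clinear (\<lambda>x. \<beta> x y)" "\<And>x. clinear (\<beta> x)"
  shows "(\<Sum>(y, z)\<leftarrow>coprod K k'. \<beta> y z) = \<beta> k' k'"
proof -
  have b: "\<And>y. clinear (\<lambda>x. \<beta> (k' * x) y)" "\<And>x. clinear (\<lambda>y. \<beta> x (k' * y))"
    by (intro clinear_compose[OF assms(1)] clinear_compose[OF assms(2)] clinear_intros)+
  have b': "\<And>y. clinear (\<lambda>x. \<beta> (k' * (x * y')) z)" "\<And>x. clinear (\<lambda>y. \<beta> x (k' * (y * z')))" for y' z' z
    by (intro clinear_compose[OF b(1)] clinear_compose[OF b(2)] clinear_intros)+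
  have "\<beta> k' k' = (\<Sum>(y, z)\<leftarrow>coprod K (k * k'). \<beta> (k' * y) (k' * z))"
    using U.coprod_bilinear_one[of "\<lambda>y z. \<beta> (k' * y) (k' * z)"]
    by (simp add: uq_relations b)
  also have "\<dots> = (\<Sum>(y, z)\<leftarrow>coprod K k. \<Sum>(y', z')\<leftarrow>coprod K k'. \<beta> (k' * (y * y')) (k' * (z * z')))"
    by (rule U.coprod_bilinear_mult) (rule b)+
  also have "\<dots> = (\<Sum>(y, z)\<leftarrow>[(k, k)]. \<Sum>(y', z')\<leftarrow>coprod K k'. \<beta> (k' * (y * y')) (k' * (z * z')))"
    by (rule tens_eq_bilinear[OF coprod_k]) (intro clinear_sum_list_fun b')+
  also have "\<dots> = (\<Sum>(y, z)\<leftarrow>coprod K k'. \<beta> y z)"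
    by (simp add: uq_relations flip: mult.assoc)
  finally show ?thesis ..
qed

text \<open>The scalar with counit of B_t equal to -\<tau>, and hence [a] = -i \<tau>; it is purely
  imaginary.\<close>

definition \<tau> :: complex where "\<tau> = \<i> * of_real (qdiff q a / (q - 1 / q))"

text \<open>B_t without its \<open>k'\<close> term. It has counit 0 and is the second element,
  besides \<open>k'\<close>, that occurs in the right leg of the coproduct of B_t.\<close>

definition Z :: 'u where "Z = B + \<tau> *\<^sub>C k'"

lemma B_eq: "B = (- complex_of_real (sqrt q)) *\<^sub>C (k' * eU D) + complex_of_real (sqrt q) *\<^sub>C fU D - \<tau> *\<^sub>C k'"
  by (simp add: Bt_def \<tau>_def)

lemma Z_eq: "Z = (- complex_of_real (sqrt q)) *\<^sub>C (k' * eU D) + complex_of_real (sqrt q) *\<^sub>C fU D"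
  by (simp add: Z_def B_eq)

lemma cnj_\<tau>: "cnj \<tau> = - \<tau>"
  by (simp add: \<tau>_def)

lemma star_Z: "star Z = - Z"
  by (simp add: Z_eq star_add star_scaleC star_mult star_star star_diff star_e star_f star_k' mult.assoc
      uq_relations star_minus)

lemma star_B: "star B = - B"
proof -
  have "B = Z - \<tau> *\<^sub>C k'" by (simp add: Z_def)
  then show ?thesis
    by (simp add: star_diff star_Z star_scaleC star_k' cnj_\<tau>)
qed

lemma counit_B: "counit K B = - \<tau>"
  by (simp add: B_eq clinear_add[OF U.counit_clinear] clinear_diff[OF U.counit_clinear] clinear_minus[OF U.counit_clinear]
      clinear_scale[OF U.counit_clinear] U.counit_mult counit_e counit_f counit_k')

text \<open>Both \<open>k' * e\<close> and \<open>f\<close> are skew-primitive of the same type: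
  their coproduct is X tensor \<open>k'\<close> plus 1 tensor X. So is \<open>Z\<close>, and the
  remaining -\<tau> \<open>k'\<close> tensor \<open>k'\<close> merges with \<open>Z\<close> tensor
  \<open>k'\<close> into \<open>B\<close> tensor \<open>k'\<close>.\<close>

lemma coprod_B:
  fixes \<beta> :: "'u \<Rightarrow> 'u \<Rightarrow> 'c::complex_vector"
  assumes l: "\<And>y. clinear (\<lambda>x. \<beta> x y)" and r: "\<And>x. clinear (\<beta> x)"
  shows "(\<Sum>(y, z)\<leftarrow>coprod K B. \<beta> y z) = \<beta> B k' + \<beta> 1 Z"
proof -
  note c = U.coprod_bilinear_clinear[of \<beta>, OF l r]
  have b': "\<And>y. clinear (\<lambda>x. \<beta> (x * y') z)" "\<And>x. clinear (\<lambda>y. \<beta> x (y * z'))"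
    "\<And>y. clinear (\<lambda>x. \<beta> (y' * x) z)" "\<And>x. clinear (\<lambda>y. \<beta> x (z' * y))" for y' z' z
    by (intro clinear_compose[OF l] clinear_compose[OF r] clinear_intros)+
  have ke: "(\<Sum>(y, z)\<leftarrow>coprod K (k' * eU D). \<beta> y z) = \<beta> (k' * eU D) k' + \<beta> 1 (k' * eU D)"
  proof -
    have "(\<Sum>(y, z)\<leftarrow>coprod K (k' * eU D). \<beta> y z) =
        (\<Sum>(y, z)\<leftarrow>coprod K k'. \<Sum>(y', z')\<leftarrow>coprod K (eU D). \<beta> (y * y') (z * z'))"
      by (rule U.coprod_bilinear_mult) (rule l r)+
    also have "\<dots> = (\<Sum>(y', z')\<leftarrow>coprod K (eU D). \<beta> (k' * y') (k' * z'))"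
      by (rule coprod_k') (intro clinear_sum_list_fun b')+
    also have "\<dots> = \<beta> (k' * eU D) k' + \<beta> 1 (k' * eU D)"
      by (subst tens_eq_bilinear[OF coprod_e b'(3) b'(4)]) (simp add: uq_relations)
    finally show ?thesis .
  qed
  have f: "(\<Sum>(y, z)\<leftarrow>coprod K (fU D). \<beta> y z) = \<beta> 1 (fU D) + \<beta> (fU D) k'"
    by (simp add: tens_eq_bilinear[OF coprod_f l r])
  have lB: "\<beta> B k' = (- complex_of_real (sqrt q)) *\<^sub>C \<beta> (k' * eU D) k' + complex_of_real (sqrt q) *\<^sub>C \<beta> (fU D) k'
      - \<tau> *\<^sub>C \<beta> k' k'"
    by (simp only: B_eq clinear_add[OF l] clinear_diff[OF l] clinear_scale[OF l])
  have rZ: "\<beta> 1 Z = (- complex_of_real (sqrt q)) *\<^sub>C \<beta> 1 (k' * eU D) + complex_of_real (sqrt q) *\<^sub>C \<beta> 1 (fU D)"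
    by (simp only: Z_eq clinear_add[OF r] clinear_diff[OF r] clinear_scale[OF r])
  have "(\<Sum>(y, z)\<leftarrow>coprod K B. \<beta> y z) =
      (- complex_of_real (sqrt q)) *\<^sub>C (\<Sum>(y, z)\<leftarrow>coprod K (k' * eU D). \<beta> y z) +
      complex_of_real (sqrt q) *\<^sub>C (\<Sum>(y, z)\<leftarrow>coprod K (fU D). \<beta> y z) - \<tau> *\<^sub>C (\<Sum>(y, z)\<leftarrow>coprod K k'. \<beta> y z)"
    unfolding B_eq by (simp only: clinear_add[OF c] clinear_diff[OF c] clinear_scale[OF c])
  then show ?thesis
    unfolding ke f coprod_k'[of \<beta>, OF l r] lB rZ
    by (simp add: scaleC_right_distrib)
qed

text \<open>The antipode axiom at \<open>B\<close> reads S(B) \<open>k'\<close> + Z = -\<tau> and is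
  solved for S(B). Pairing with \<open>star b\<close> involves exactly this element, so it decides
  whether the sphere is closed under the star.\<close>

lemma star_antip_B: "star (antip K B) = \<tau> *\<^sub>C 1 + \<tau> *\<^sub>C k + k * B"
proof -
  have "- \<tau> *\<^sub>C 1 = (\<Sum>(y, z)\<leftarrow>coprod K B. antip K y * z)"
    by (simp add: U.antip_left counit_B)
  also have "\<dots> = antip K B * k' + antip K 1 * Z"
    by (rule coprod_B) (intro clinear_intros clinear_compose[OF clinear_mult_left U.antip_clinear])+
  also have "antip K 1 = 1"
  proof -
    have "(1::'u) = (\<Sum>(y, z)\<leftarrow>coprod K 1. antip K y * z)"
      by (simp add: U.antip_left U.counit_one)
    also have "\<dots> = antip K 1 * 1"
      by (rule U.coprod_bilinear_one) (intro clinear_intros clinear_compose[OF clinear_mult_left U.antip_clinear])+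
    finally show ?thesis by simp
  qed
  finally have "antip K B * k' = - \<tau> *\<^sub>C 1 - Z" by (simp add: algebra_simps)
  then have "antip K B * k' * k = (- \<tau> *\<^sub>C 1 - Z) * k" by simp
  then have "antip K B = - \<tau> *\<^sub>C k - Z * k"
    by (simp add: mult.assoc uq_relations left_diff_distrib mult_scaleC_left)
  then have "star (antip K B) = \<tau> *\<^sub>C k + k * Z"
    by (simp add: star_diff star_minus star_mult star_Z star_k star_scaleC cnj_\<tau>)
  then show ?thesis
    by (simp add: Z_def distrib_left mult_scaleC_right uq_relations)
qed

lemma pair_times_k': "pair D (x * y) k' = pair D x k' * pair D y k'"
  unfolding pair_times_left by (rule coprod_k') (intro clinear_intros pair_clinear_right)+

lemma pair_times_B: "pair D (x * y) B = pair D x B * pair D y k' + \<epsilon> x * pair D y Z"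
  unfolding pair_times_left pair_one_right[symmetric] by (rule coprod_B) (intro clinear_intros pair_clinear_right)+

lemma pair_times_Z: "pair D (x * y) Z = pair D x Z * pair D y k' + \<epsilon> x * pair D y Z"
  by (simp add: Z_def pair_times_B pair_times_k' clinear_add[OF pair_clinear_right] clinear_scale[OF pair_clinear_right]
      algebra_simps)

end


section \<open>Polynomials in a diagonalizable operator\<close>

text \<open>\<open>dual_rep\<close> acts on coordinate vectors that are functions of the index. With
  functions as a complex vector space, the same operator lemmas cover these matrices and the action
  on the module.\<close>

instantiation "fun" :: (type, complex_vector) complex_vector
begin
definition "scaleC_fun (c::complex) (f::'a \<Rightarrow> 'b) = (\<lambda>x. c *\<^sub>C f x)"
instance
  by standard
    (simp_all add: scaleC_fun_def fun_eq_iff scaleC_right_distrib scaleC_left_distrib scaleC_scaleC)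
end

lemma scaleC_fun_apply [simp]: "(c *\<^sub>C f) x = c *\<^sub>C f x"
  by (simp add: scaleC_fun_def)

lemma sum_fun_apply: "(\<Sum>i\<in>I. f i) x = (\<Sum>i\<in>I. (f i :: 'a \<Rightarrow> 'b::comm_monoid_add) x)"
  by (induction I rule: infinite_finite_induct) auto

definition poly_op :: "complex poly \<Rightarrow> ('v::complex_vector \<Rightarrow> 'v) \<Rightarrow> 'v \<Rightarrow> 'v" where
  "poly_op Q T v = (\<Sum>i\<le>degree Q. coeff Q i *\<^sub>C (T ^^ i) v)"

lemma poly_op_degree_le:
  assumes "degree Q \<le> n"
  shows "poly_op Q T v = (\<Sum>i\<le>n. coeff Q i *\<^sub>C (T ^^ i) v)"
  unfolding poly_op_def using assms
  by (intro sum.mono_neutral_left) (auto simp: coeff_eq_0)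

lemma clinear_funpow:
  fixes T :: "'v::complex_vector \<Rightarrow> 'v"
  shows "clinear T \<Longrightarrow> clinear (T ^^ i)"
  by (induction i) (auto simp: clinear_iff)

lemma poly_op_clinear: "clinear T \<Longrightarrow> clinear (poly_op Q T)"
  unfolding poly_op_def
  by (rule clinearI) (simp_all add: clinear_add[OF clinear_funpow] clinear_scale[OF clinear_funpow]
      scaleC_right_distrib sum.distrib cvec.scale_sum_right scaleC_scaleC mult.commute)

lemma poly_op_pCons: "poly_op (pCons c Q) T v = c *\<^sub>C v + poly_op Q T (T v)"
proof -
  have "poly_op (pCons c Q) T v = (\<Sum>i\<le>Suc (degree Q). coeff (pCons c Q) i *\<^sub>C (T ^^ i) v)"
    by (rule poly_op_degree_le) (rule degree_pCons_le)
  then show ?thesis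
    by (simp add: sum.atMost_Suc_shift poly_op_def funpow_swap1 del: sum.atMost_Suc)
qed

lemma poly_op_add: "poly_op (P + Q) T v = poly_op P T v + poly_op Q T v"
proof -
  let ?n = "max (degree P) (degree Q)"
  have "poly_op (P + Q) T v = (\<Sum>i\<le>?n. coeff (P + Q) i *\<^sub>C (T ^^ i) v)"
    by (rule poly_op_degree_le) (rule degree_add_le_max)
  then show ?thesis
    by (simp add: poly_op_degree_le[of P ?n] poly_op_degree_le[of Q ?n] scaleC_left_distrib sum.distrib)
qed

lemma poly_op_smult: "poly_op (smult c Q) T v = c *\<^sub>C poly_op Q T v"
proof -
  have "poly_op (smult c Q) T v = (\<Sum>i\<le>degree Q. coeff (smult c Q) i *\<^sub>C (T ^^ i) v)"
    by (rule poly_op_degree_le) (rule degree_smult_le)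
  then show ?thesis
    by (simp add: poly_op_def cvec.scale_sum_right scaleC_scaleC)
qed

lemma poly_op_linear_factor:
  assumes "clinear T"
  shows "poly_op ([:- c, 1:] * Q) T v = poly_op Q T (T v - c *\<^sub>C v)"
proof -
  have "[:- c, 1:] * Q = smult (- c) Q + pCons 0 Q" by simp
  then have "poly_op ([:- c, 1:] * Q) T v = - c *\<^sub>C poly_op Q T v + poly_op Q T (T v)"
    by (simp only: poly_op_add poly_op_smult poly_op_pCons scaleC_zero_simps add_0)
  then show ?thesis
    by (simp add: clinear_diff[OF poly_op_clinear[OF assms]] clinear_scale[OF poly_op_clinear[OF assms]])
qed

lemma poly_op_eigenvector:
  assumes "clinear T" "T v = c *\<^sub>C v"
  shows "poly_op Q T v = poly Q c *\<^sub>C v"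
proof -
  have "(T ^^ i) v = c ^ i *\<^sub>C v" for i
    by (induction i) (simp_all add: clinear_scale[OF assms(1)] assms(2) scaleC_scaleC mult.commute)
  then show ?thesis
    by (simp add: poly_op_def poly_altdef scaleC_scaleC cvec.scale_sum_left)
qed

text \<open>A vector involves only finitely many eigenvalues, and on those \<Theta> is any
  polynomial in T with the values \<delta>. The conclusion is a set of nodes rather than one
  polynomial, so that nodes from several vectors or from different spaces can be merged.\<close>

lemma spectral_interpolation:
  assumes T: "clinear T" and \<Theta>: "clinear \<Theta>"
    and E: "\<And>w. w \<in> E \<Longrightarrow> \<exists>c. T w = c *\<^sub>C w \<and> \<Theta> w = \<delta> c *\<^sub>C w"
    and v: "v \<in> cvec.span E"
  shows "\<exists>S. finite S \<and> (\<forall>Q. (\<forall>c\<in>S. poly Q c = \<delta> c) \<longrightarrow> \<Theta> v = poly_op Q T v)"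
  using v
proof (induction rule: cvec.span_induct_alt)
  case base
  show ?case
    by (auto simp: clinear_0[OF \<Theta>] clinear_0[OF poly_op_clinear[OF T]] intro!: exI[of _ "{}"])
next
  case (step c w v)
  obtain S where S: "finite S" "\<And>Q. (\<forall>c\<in>S. poly Q c = \<delta> c) \<Longrightarrow> \<Theta> v = poly_op Q T v"
    using step by blast
  obtain b where b: "T w = b *\<^sub>C w" "\<Theta> w = \<delta> b *\<^sub>C w"
    using E step by blast
  show ?case
    by (rule exI[of _ "insert b S"])
      (use S b(2) in \<open>auto simp: clinear_add[OF \<Theta>] clinear_scale[OF \<Theta>] clinear_add[OF poly_op_clinear[OF T]]
        clinear_scale[OF poly_op_clinear[OF T]] poly_op_eigenvector[OF T b(1)]\<close>)
qed

lemma interpolation_poly: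
  fixes c0 :: complex
  assumes "finite S"
  obtains Q where "\<And>c. c \<in> S \<Longrightarrow> poly Q c = (if c = c0 then 1 else 0)"
proof -
  let ?Q = "\<Prod>b\<in>S - {c0}. smult (1 / (c0 - b)) [:- b, 1:]"
  have "poly ?Q c = (if c = c0 then 1 else 0)" if "c \<in> S" for c
  proof (cases "c = c0")
    case True
    then show ?thesis
      by (auto simp: poly_prod diff_divide_distrib[symmetric] intro!: prod.neutral split: if_splits)
  next
    case False
    then show ?thesis using that assms by (auto simp: poly_prod intro!: prod_zero bexI[of _ c])
  qed
  then show thesis using that by blast
qed

text \<open>Split off a root c of the annihilating polynomial. By induction \<eta> = (T - c) v is a
  combination of eigenvectors; subtracting a suitable combination \<zeta> from v leaves a vector
  killed by the square of T - c, and \<open>semisimple\<close>, which rules out Jordan blocks, makes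
  it an eigenvector.\<close>

lemma annihilated_in_span_eigenvectors:
  assumes T: "clinear T" and V: "cvec.subspace V" and TV: "\<And>v. v \<in> V \<Longrightarrow> T v \<in> V"
    and semisimple: "\<And>v c. v \<in> V \<Longrightarrow> T (T v - c *\<^sub>C v) = c *\<^sub>C (T v - c *\<^sub>C v) \<Longrightarrow> T v = c *\<^sub>C v"
    and "p \<noteq> 0" "v \<in> V" "poly_op p T v = 0"
  shows "v \<in> cvec.span {w \<in> V. \<exists>c. T w = c *\<^sub>C w}"
  using assms(5-)
proof (induction "degree p" arbitrary: p v)
  case 0
  then obtain k where "p = [:k:]" "k \<noteq> 0" by (metis degree_eq_zeroE pCons_0_0)
  then have "v = 0" using 0 by (simp add: poly_op_def)
  then show ?case using cvec.span_zero by simp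
next
  case (Suc n)
  let ?E = "{w \<in> V. \<exists>c. T w = c *\<^sub>C w}"
  have "\<not> constant (poly p)" using Suc by (simp add: constant_degree)
  then obtain c where "poly p c = 0" using fundamental_theorem_of_algebra by blast
  then obtain r where p: "p = [:- c, 1:] * r" by (auto simp: poly_eq_0_iff_dvd)
  have r: "r \<noteq> 0" using Suc p by auto
  have "degree p = 1 + degree r" unfolding p using r by (subst degree_mult_eq) auto
  then have n: "n = degree r" using Suc by simp
  have spanV: "cvec.span ?E \<subseteq> V" by (rule cvec.span_minimal[OF _ V]) auto
  define \<eta> where "\<eta> = T v - c *\<^sub>C v"
  have "\<eta> \<in> V"
    unfolding \<eta>_def using Suc by (intro cvec.subspace_diff[OF V] cvec.subspace_scale[OF V] TV)
  moreover have "poly_op r T \<eta> = 0"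
    using Suc unfolding p \<eta>_def by (simp only: poly_op_linear_factor[OF T])
  ultimately have "\<eta> \<in> cvec.span ?E" using Suc.hyps(1) n r by blast
  \<comment> \<open>Solve (T - c) \<zeta> = \<eta> up to an error in the c-eigenspace. The
    components with eigenvalue c cannot be reached and stay in the error.\<close>
  then have "\<exists>\<zeta>\<in>cvec.span ?E. T (\<eta> - (T \<zeta> - c *\<^sub>C \<zeta>)) = c *\<^sub>C (\<eta> - (T \<zeta> - c *\<^sub>C \<zeta>))"
  proof (induction rule: cvec.span_induct_alt)
    case base
    show ?case using cvec.span_zero by (intro bexI[of _ 0]) (simp_all add: clinear_0[OF T])
  next
    case (step x w y)
    obtain \<zeta> where \<zeta>: "\<zeta> \<in> cvec.span ?E" "T (y - (T \<zeta> - c *\<^sub>C \<zeta>)) = c *\<^sub>C (y - (T \<zeta> - c *\<^sub>C \<zeta>))"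
      using step by blast
    obtain b where b: "T w = b *\<^sub>C w" using step by blast
    show ?case
    proof (cases "b = c")
      case True
      have "T (x *\<^sub>C w + y - (T \<zeta> - c *\<^sub>C \<zeta>)) = x *\<^sub>C T w + T (y - (T \<zeta> - c *\<^sub>C \<zeta>))"
        by (simp add: clinear_add[OF T] clinear_diff[OF T] clinear_scale[OF T])
      also have "\<dots> = c *\<^sub>C (x *\<^sub>C w + y - (T \<zeta> - c *\<^sub>C \<zeta>))"
        unfolding \<zeta> b True
        by (simp add: scaleC_right_distrib cvec.scale_right_diff_distrib scaleC_scaleC mult.commute)
      finally show ?thesis using \<zeta>(1) by blast
    next
      case False
      \<comment> \<open>On an eigenvector with eigenvalue b different from c, T - c is
        multiplication by b - c and can be inverted.\<close>
      define \<xi> where "\<xi> = (x / (b - c)) *\<^sub>C w + \<zeta>"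
      have "T \<xi> - c *\<^sub>C \<xi> = (x / (b - c) * b - c * (x / (b - c))) *\<^sub>C w + (T \<zeta> - c *\<^sub>C \<zeta>)"
        by (simp add: \<xi>_def clinear_add[OF T] clinear_scale[OF T] b scaleC_right_distrib scaleC_scaleC
            cvec.scale_left_diff_distrib)
      also have "x / (b - c) * b - c * (x / (b - c)) = x"
        using False by (simp add: mult.commute[of c] flip: right_diff_distrib diff_divide_distrib)
      finally have "x *\<^sub>C w + y - (T \<xi> - c *\<^sub>C \<xi>) = y - (T \<zeta> - c *\<^sub>C \<zeta>)" by simp
      moreover have "\<xi> \<in> cvec.span ?E"
        unfolding \<xi>_def
        by (rule cvec.span_add[OF cvec.span_scale[OF cvec.span_base[OF step.hyps(1)]] \<zeta>(1)])
      ultimately show ?thesis using \<zeta>(2) by (intro bexI[of _ \<xi>]) (simp_all only:)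
    qed
  qed
  then obtain \<zeta> where \<zeta>: "\<zeta> \<in> cvec.span ?E" "T (\<eta> - (T \<zeta> - c *\<^sub>C \<zeta>)) = c *\<^sub>C (\<eta> - (T \<zeta> - c *\<^sub>C \<zeta>))"
    by blast
  have diff: "T (v - \<zeta>) - c *\<^sub>C (v - \<zeta>) = \<eta> - (T \<zeta> - c *\<^sub>C \<zeta>)"
    by (simp add: \<eta>_def clinear_diff[OF T] cvec.scale_right_diff_distrib)
  have in_V: "v - \<zeta> \<in> V" using spanV \<zeta>(1) Suc by (intro cvec.subspace_diff[OF V]) auto
  moreover have "T (v - \<zeta>) = c *\<^sub>C (v - \<zeta>)"
    using in_V
    by (rule semisimple) (simp only: diff \<zeta>(2))
  ultimately have "v - \<zeta> \<in> cvec.span ?E" by (intro cvec.span_base) auto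
  then show ?case using cvec.span_add[OF _ \<zeta>(1)] by fastforce
qed

text \<open>One more iterate of v than there are spanning vectors is linearly dependent, and the
  coefficients of the dependence form the polynomial.\<close>

lemma finite_dim_annihilator:
  fixes T :: "'v::complex_vector \<Rightarrow> 'v"
  assumes B: "finite B" and orbit: "\<And>i. (T ^^ i) v \<in> cvec.span B"
  obtains p where "p \<noteq> 0" "poly_op p T v = 0"
proof -
  let ?w = "\<lambda>i. (T ^^ i) v" and ?n = "card B"
  obtain u where u: "\<exists>i\<le>?n. u i \<noteq> 0" "(\<Sum>i\<le>?n. u i *\<^sub>C ?w i) = 0"
  proof (cases "inj_on ?w {..?n}")
    case True
    have "\<not> cvec.independent (?w ` {..?n})"
    proof
      assume "cvec.independent (?w ` {..?n})"
      then have "card (?w ` {..?n}) \<le> card B"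
        using cvec.independent_span_bound[OF B] orbit by blast
      then show False by (simp add: card_image[OF True])
    qed
    then obtain f where "\<exists>x\<in>?w ` {..?n}. f x \<noteq> 0" "(\<Sum>x\<in>?w ` {..?n}. f x *\<^sub>C x) = 0"
      by (auto simp: cvec.dependent_finite)
    then show thesis
      by (intro that[of "\<lambda>i. f (?w i)"]) (auto simp: sum.reindex[OF True])
  next
    case False
    then obtain i j where ij: "i \<le> ?n" "j \<le> ?n" "i \<noteq> j" "?w i = ?w j" by (auto simp: inj_on_def)
    \<comment> \<open>Dependence concerns sets, so coinciding iterates need their own relation: the
      difference of two distinct monomials.\<close>
    let ?u = "\<lambda>l. (if l = i then 1 else 0) - (if l = j then 1 else 0 :: complex)"
    have "(\<Sum>l\<le>?n. ?u l *\<^sub>C ?w l) =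
        (\<Sum>l\<le>?n. if l = i then ?w l else 0) - (\<Sum>l\<le>?n. if l = j then ?w l else 0)"
      unfolding sum_subtractf[symmetric] by (intro sum.cong) auto
    then show thesis
      using ij by (intro that[of ?u]) (auto intro!: exI[of _ i])
  qed
  define p where "p = (\<Sum>i\<le>?n. monom (u i) i)"
  have coeff: "coeff p i = (if i \<le> ?n then u i else 0)" for i
    by (auto simp: p_def coeff_sum)
  have "degree p \<le> ?n" by (rule degree_le) (simp add: coeff)
  then have "poly_op p T v = 0"
    using u by (simp add: poly_op_degree_le coeff)
  moreover have "p \<noteq> 0"
  proof
    assume "p = 0"
    then have "coeff p i = 0" for i by simp
    then show False using u(1) coeff by metis
  qed
  ultimately show thesis using that by blast
qed

section \<open>Diagonalizability of Hermitian matrices\<close>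

definition supported :: "nat \<Rightarrow> (nat \<Rightarrow> complex) set" where
  "supported d = {\<xi>. \<forall>j. d \<le> j \<longrightarrow> \<xi> j = 0}"

lemma supported_subspace: "cvec.subspace (supported d)"
  by (simp add: cvec.subspace_def supported_def)

lemma supported_subset_span: "supported d \<subseteq> cvec.span ((\<lambda>i j. if j = i then 1 else 0) ` {..<d})"
proof
  fix \<xi> assume "\<xi> \<in> supported d"
  then have "\<xi> = (\<Sum>i<d. \<xi> i *\<^sub>C (\<lambda>j. if j = i then 1 else 0))"
    by (auto simp: fun_eq_iff sum_fun_apply supported_def if_distrib not_less cong: if_cong)
  then show "\<xi> \<in> cvec.span ((\<lambda>i j. if j = i then 1 else 0) ` {..<d})"
    by (metis (no_types, lifting) cvec.span_base cvec.span_scale cvec.span_sum imageI)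
qed

lemma dual_rep_clinear: "clinear (dual_rep js v \<omega>)"
  by (rule clinearI)
    (auto simp: dual_rep_def fun_eq_iff sum.distrib distrib_left sum_distrib_left algebra_simps intro!: sum.cong)

lemma dual_rep_supported: "dual_rep [0..<d] v \<omega> \<xi> \<in> supported d"
  by (auto simp: dual_rep_def supported_def)

text \<open>Let u = (T - c) \<xi>, an eigenvector for c unless it vanishes. If u is nonzero, then c
  is real, and moving T - c across the inner product gives (u, u) = (\<xi>, (T - c) u) = 0. The sum
  stops at d, so definiteness also uses that u is supported below d.\<close>

lemma hermitian_semisimple:
  assumes herm: "\<And>j l. j < d \<Longrightarrow> l < d \<Longrightarrow> \<omega> (v l j) = cnj (\<omega> (v j l))"
    and \<xi>: "\<xi> \<in> supported d"
    and eig: "dual_rep [0..<d] v \<omega> (dual_rep [0..<d] v \<omega> \<xi> - c *\<^sub>C \<xi>) = c *\<^sub>C (dual_rep [0..<d] v \<omega> \<xi> - c *\<^sub>C \<xi>)"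
  shows "dual_rep [0..<d] v \<omega> \<xi> = c *\<^sub>C \<xi>"
proof -
  let ?T = "dual_rep [0..<d] v \<omega>"
  define ip where "ip f g = (\<Sum>j<d. cnj (f j) * g j)" for f g :: "nat \<Rightarrow> complex"
  have self: "ip f (?T g) = ip (?T f) g" for f g
  proof -
    have "ip f (?T g) = (\<Sum>j<d. \<Sum>l<d. cnj (f j) * \<omega> (v j l) * g l)"
      by (simp add: ip_def dual_rep_def sum_distrib_left mult.assoc atLeast0LessThan)
    also have "\<dots> = (\<Sum>l<d. \<Sum>j<d. cnj (f j) * \<omega> (v j l) * g l)"
      by (rule sum.swap)
    also have "\<dots> = (\<Sum>l<d. \<Sum>j<d. cnj (\<omega> (v l j) * f j) * g l)"
    proof (intro sum.cong refl)
      fix l j assume "l \<in> {..<d}" "j \<in> {..<d}"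
      then show "cnj (f j) * \<omega> (v j l) * g l = cnj (\<omega> (v l j) * f j) * g l"
        using herm[of l j] by simp
    qed
    also have "\<dots> = ip (?T f) g"
      by (simp add: ip_def dual_rep_def sum_distrib_right atLeast0LessThan)
    finally show ?thesis .
  qed
  have ip_scale: "ip f (b *\<^sub>C g) = b * ip f g" "ip (b *\<^sub>C f) g = cnj b * ip f g" for b f g
    by (simp_all add: ip_def sum_distrib_left algebra_simps)
  have ip_diff: "ip (f - f') g = ip f g - ip f' g" for f f' g
    by (simp add: ip_def algebra_simps sum_subtractf)
  define u where "u = ?T \<xi> - c *\<^sub>C \<xi>"
  have Tu: "?T u = c *\<^sub>C u" using eig by (simp add: u_def)
  have "u \<in> supported d"
    unfolding u_def
    by (intro cvec.subspace_diff[OF supported_subspace] cvec.subspace_scale[OF supported_subspace] dual_rep_supported \<xi>)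
  have "ip u u = 0"
  proof (rule ccontr)
    assume nz: "ip u u \<noteq> 0"
    have "c * ip u u = cnj c * ip u u"
      using self[of u u] by (simp add: Tu ip_scale)
    then have c: "cnj c = c" using nz by simp
    have "ip u u = ip (?T \<xi>) u - cnj c * ip \<xi> u"
      by (subst (1) u_def) (simp add: ip_diff ip_scale)
    also have "ip (?T \<xi>) u = c * ip \<xi> u"
      using self[of \<xi> u] by (simp add: Tu ip_scale)
    finally show False using nz c by simp
  qed
  moreover have "ip u u = of_real (\<Sum>j<d. (norm (u j))\<^sup>2)"
    unfolding ip_def by (simp add: mult.commute[of "cnj _"] flip: complex_norm_square)
  ultimately have "(\<Sum>j<d. (norm (u j))\<^sup>2) = 0" by (simp only: of_real_eq_0_iff)
  then have "u j = 0" if "j < d" for j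
    using that by (simp add: sum_nonneg_eq_0_iff)
  then have "u = 0"
    using \<open>u \<in> supported d\<close> by (auto simp: supported_def fun_eq_iff not_less[symmetric])
  then show ?thesis by (simp add: u_def)
qed

lemma hermitian_span_eigenvectors:
  assumes "\<And>j l. j < d \<Longrightarrow> l < d \<Longrightarrow> \<omega> (v l j) = cnj (\<omega> (v j l))" and \<xi>: "\<xi> \<in> supported d"
  shows "\<xi> \<in> cvec.span {w \<in> supported d. \<exists>c. dual_rep [0..<d] v \<omega> w = c *\<^sub>C w}"
proof -
  let ?T = "dual_rep [0..<d] v \<omega>"
  let ?B = "(\<lambda>i j. if j = i then 1 else 0 :: complex) ` {..<d}"
  have "(?T ^^ i) \<xi> \<in> supported d" for i
    by (cases i) (simp_all add: \<xi> dual_rep_supported)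
  then have orbit: "(?T ^^ i) \<xi> \<in> cvec.span ?B" for i
    by (rule subsetD[OF supported_subset_span])
  obtain p where p: "p \<noteq> 0" "poly_op p ?T \<xi> = 0"
    by (rule finite_dim_annihilator[OF _ orbit]) auto
  show ?thesis
  proof (rule annihilated_in_span_eigenvectors[OF dual_rep_clinear supported_subspace dual_rep_supported _ p(1) \<xi> p(2)])
    fix w c
    assume "w \<in> supported d" "?T (?T w - c *\<^sub>C w) = c *\<^sub>C (?T w - c *\<^sub>C w)"
    then show "?T w = c *\<^sub>C w"
      by (rule hermitian_semisimple[where \<omega> = \<omega> and v = v, rotated]) (rule assms(1))
  qed
qed


section \<open>The Podles sphere and its stabilizer\<close>

lemma (in hopf_star) dual_rep_conv:
  assumes "corep H js v" "clinear \<omega>" "clinear \<omega>'"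
  shows "dual_rep js v (conv H \<omega> \<omega>') \<xi> = dual_rep js v \<omega> (dual_rep js v \<omega>' \<xi>)"
proof
  fix j
  have "conv H \<omega> \<omega>' (v j l) = (\<Sum>m\<in>set js. \<omega> (v j m) * \<omega>' (v m l))" if "j \<in> set js" "l \<in> set js" for l
    unfolding conv_def by (rule corep_bilinear[OF assms(1) that]) (intro clinear_intros assms)+
  then show "dual_rep js v (conv H \<omega> \<omega>') \<xi> j = dual_rep js v \<omega> (dual_rep js v \<omega>' \<xi>) j"
    by (simp add: dual_rep_def sum_distrib_left sum_distrib_right mult.assoc) (rule impI, rule sum.swap)
qed

lemma (in oq_su2) counit_antip_inv: "counit H (antip_inv H x) = counit H x"
proof -
  have "counit H x = counit H (\<Sum>(y, z)\<leftarrow>coprod H x. z * antip_inv H y)"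
    by (simp add: antip_inv_right clinear_scale[OF counit_clinear] counit_one)
  also have "\<dots> = counit H (antip_inv H (\<Sum>(y, z)\<leftarrow>coprod H x. counit H z *\<^sub>C y))"
    by (simp add: clinear_sum_list2[OF counit_clinear] clinear_sum_list2[OF antip_inv_clinear] counit_mult
        clinear_scale[OF antip_inv_clinear] clinear_scale[OF counit_clinear])
  finally show ?thesis by (simp add: counit_right)
qed

context podles_sphere
begin

abbreviation "St \<equiv> Oq_sphere D q a"
abbreviation "h \<equiv> \<i> *\<^sub>C B"
abbreviation "eigval n \<equiv> complex_of_real (qint q (a + 2 * of_int n))"

lemma counit_h: "counit K h = of_real (qint q a)"
  by (simp add: clinear_scale[OF U.counit_clinear] counit_B \<tau>_def qint_def qdiff_def diff_divide_distrib)

lemma star_h: "star h = h"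
  by (simp add: star_scaleC star_B)

lemma star_h_power: "star (h ^ i) = h ^ i"
  by (induction i) (simp_all only: power_0 power_Suc star_one star_mult star_h power_commutes)

lemma lact_fun_of_times: "lact A (fo (g * g')) b = lact A (fo g) (lact A (fo g') b)"
  by (simp add: fun_of_times A.lact_conv fun_of_clinear)

lemma lact_fun_of_add: "lact A (fo (g + g')) b = lact A (fo g) b + lact A (fo g') b"
  and lact_fun_of_scale: "lact A (fo (c *\<^sub>C g)) b = c *\<^sub>C lact A (fo g) b"
  by (simp_all add: fun_of_add fun_of_scale A.lact_add A.lact_scale)

lemma lact_fun_of_one: "lact A (fo 1) b = b"
  by (simp add: fun_of_one A.lact_counit)

text \<open>The left action is multiplicative in the dual element and the counit is a character, so
  the invariance condition passes from the generator B_t to its powers and by linearity to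
  I.\<close>

lemma sphere_iff: "b \<in> St \<longleftrightarrow> lact A (fo B) b = - \<tau> *\<^sub>C b"
proof
  assume "b \<in> St"
  moreover have "B \<in> coideal_I D q a"
    unfolding coideal_I_def by (rule cvec.span_base) (auto intro: exI[of _ 1] simp: image_iff)
  ultimately show "lact A (fo B) b = - \<tau> *\<^sub>C b"
    by (auto simp: Oq_sphere_def counit_B)
next
  assume b: "lact A (fo B) b = - \<tau> *\<^sub>C b"
  have pow: "lact A (fo (B ^ n)) b = counit K (B ^ n) *\<^sub>C b" for n
  proof (induction n)
    case 0
    then show ?case by (simp add: lact_fun_of_one U.counit_one)
  next
    case (Suc n)
    then show ?case
      by (simp add: lact_fun_of_times U.counit_mult counit_B clinear_scale[OF A.lact_clinear[OF fun_of_clinear]]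
          b scaleC_scaleC mult.commute)
  qed
  have "lact A (fo g) b = counit K g *\<^sub>C b" if "g \<in> coideal_I D q a" for g
    using that unfolding coideal_I_def
  proof (induction rule: cvec.span_induct_alt)
    case base
    show ?case
      using lact_fun_of_scale[of 0 0 b] by (simp add: clinear_0[OF U.counit_clinear])
  next
    case (step c x y)
    then show ?case
      using pow by (auto simp: lact_fun_of_add lact_fun_of_scale clinear_add[OF U.counit_clinear]
          clinear_scale[OF U.counit_clinear] scaleC_left_distrib scaleC_scaleC)
  qed
  then show "b \<in> St" by (auto simp: Oq_sphere_def)
qed

lemma sphere_one: "1 \<in> St"
  unfolding sphere_iff lact_def
  by (subst A.coprod_bilinear_one) (simp_all add: fun_of_def pair_one_left counit_B clinear_intros pair_clinear_left)

text \<open>The pairing turns the action of \<open>B\<close> on \<open>star b\<close> into that of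
  \<open>star (antip K B)\<close> on b. In \<tau> + \<tau> \<open>k\<close> + \<open>k * B\<close>
  the last two terms cancel on the sphere, and conjugating \<tau> gives -\<tau>.\<close>

lemma sphere_star:
  assumes "b \<in> St"
  shows "star b \<in> St"
proof -
  have "lact A (fo B) (star b) = (\<Sum>(y, z)\<leftarrow>coprod A b. fo B (star z) *\<^sub>C star y)"
    unfolding lact_def
  proof (rule A.coprod_bilinear_star)
    show "clinear (\<lambda>x. fo B y *\<^sub>C x)" "clinear (\<lambda>y. fo B y *\<^sub>C x)" for x y
      by (intro clinear_intros fun_of_clinear)+
  qed
  also have "\<dots> = star (lact A (fo (star (antip K B))) b)"
    by (simp add: lact_def star_sum_list2 star_scaleC fun_of_def pair_star_left)
  also have "lact A (fo (star (antip K B))) b = \<tau> *\<^sub>C b"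
    using assms unfolding star_antip_B sphere_iff
    by (simp add: lact_fun_of_add lact_fun_of_scale lact_fun_of_times lact_fun_of_one
        clinear_minus[OF A.lact_clinear[OF fun_of_clinear]] clinear_scale[OF A.lact_clinear[OF fun_of_clinear]])
  finally show ?thesis
    by (simp add: sphere_iff star_scaleC cnj_\<tau>)
qed

lemma sphere_ract:
  assumes "b \<in> St" "clinear \<omega>"
  shows "ract A b \<omega> \<in> St"
  using assms unfolding sphere_iff
  by (simp add: A.lact_ract fun_of_clinear clinear_minus[OF A.ract_clinear] clinear_scale[OF A.ract_clinear])

text \<open>The element Q(i B_t) seen as a functional on A; products in the enveloping algebra
  become convolutions.\<close>

definition poly_fun :: "complex poly \<Rightarrow> 'a \<Rightarrow> complex" where
  "poly_fun Q x = (\<Sum>i\<le>degree Q. coeff Q i * fo (h ^ i) x)"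

lemma poly_fun_clinear: "clinear (poly_fun Q)"
  unfolding poly_fun_def
  by (rule clinearI) (simp_all add: clinear_add[OF fun_of_clinear] clinear_scale[OF fun_of_clinear] distrib_left
      sum.distrib sum_distrib_left mult.left_commute)

lemma dual_rep_fun_of_power:
  assumes v: "corep A [0..<d] v" and \<xi>: "\<xi> \<in> supported d"
  shows "(dual_rep [0..<d] v (fo h) ^^ i) \<xi> = dual_rep [0..<d] v (fo (h ^ i)) \<xi>"
proof (induction i)
  case 0
  have "\<epsilon> (v j l) = (if j = l then 1 else 0)" if "j < d" "l < d" for j l
    using v that by (simp add: corep_def)
  then show ?case
    using \<xi> by (auto simp: fun_eq_iff fun_of_one dual_rep_def supported_def if_distrib[of "\<lambda>x. x * _"] cong: if_cong)
next
  case (Suc i)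
  then show ?case
    by (simp add: fun_of_times A.dual_rep_conv[OF v] fun_of_clinear)
qed

lemma dual_rep_poly_fun:
  assumes v: "corep A [0..<d] v" and \<xi>: "\<xi> \<in> supported d"
  shows "dual_rep [0..<d] v (poly_fun Q) \<xi> = poly_op Q (dual_rep [0..<d] v (fo h)) \<xi>"
  unfolding poly_op_def dual_rep_fun_of_power[OF assms]
proof
  fix j
  show "dual_rep [0..<d] v (poly_fun Q) \<xi> j =
      (\<Sum>i\<le>degree Q. coeff Q i *\<^sub>C dual_rep [0..<d] v (fo (h ^ i)) \<xi>) j"
    by (simp add: sum_fun_apply dual_rep_def poly_fun_def sum_distrib_left sum_distrib_right mult.assoc)
      (rule impI, rule sum.swap)
qed

section \<open>The projections \<Phi>_n as functionals and their span\<close>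

lemma is_Phi_clinear: "is_Phi D q a n \<omega> \<Longrightarrow> clinear \<omega>"
  by (simp add: is_Phi_def dual_of_def)

lemma is_PhiD:
  assumes "is_Phi D q a n \<omega>" "corep A [0..<d] v" "\<xi> \<in> supported d"
    and "dual_rep [0..<d] v (fo h) \<xi> = (\<lambda>j. c * \<xi> j)"
  shows "dual_rep [0..<d] v \<omega> \<xi> = (if c = eigval n then \<xi> else (\<lambda>_. 0))"
  using assms unfolding is_Phi_def supported_def by blast

text \<open>As \<open>h\<close> is self-adjoint, it acts diagonalizably in unitary corepresentations.\<close>

lemma is_Phi_poly_fun:
  assumes \<omega>: "is_Phi D q a n \<omega>" and F: "finite F"
  obtains S where "finite S"
    "\<And>Q x. (\<And>c. c \<in> S \<Longrightarrow> poly Q c = (if c = eigval n then 1 else 0)) \<Longrightarrow> x \<in> F \<Longrightarrow> \<omega> x = poly_fun Q x"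
proof -
  let ?\<delta> = "\<lambda>c. if c = eigval n then 1 else 0 :: complex"
  obtain d v where v: "unitary_corep A [0..<d] v" and Fv: "F \<subseteq> cvec.span (coefs d v)"
    using A.finite_coefs[OF F] by blast
  have cv: "corep A [0..<d] v" using v by (simp add: unitary_corep_def)
  let ?e = "\<lambda>l j. if j = l then 1 else 0 :: complex"
  let ?T = "dual_rep [0..<d] v (fo h)"
  have supp: "?e l \<in> supported d" if "l < d" for l using that by (auto simp: supported_def)
  have entry: "dual_rep [0..<d] v \<theta> (?e l) j = \<theta> (v j l)" if "j < d" "l < d" for \<theta> :: "'a \<Rightarrow> complex" and j l
    using that by (simp add: dual_rep_def if_distrib[of "\<lambda>x. _ * x"] cong: if_cong)
  have herm: "fo h (v l j) = cnj (fo h (v j l))" if "j < d" "l < d" for j l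
    using pair_hermitian[OF v, of l j h] that by (simp add: fun_of_def star_h)
  have Phi: "\<exists>c. ?T w = c *\<^sub>C w \<and> dual_rep [0..<d] v \<omega> w = ?\<delta> c *\<^sub>C w"
    if "w \<in> {w \<in> supported d. \<exists>c. ?T w = c *\<^sub>C w}" for w
  proof -
    obtain c where w: "w \<in> supported d" and c: "?T w = c *\<^sub>C w" using \<open>w \<in> _\<close> by blast
    have "?T w = (\<lambda>j. c * w j)" using c by (simp add: fun_eq_iff)
    then have "dual_rep [0..<d] v \<omega> w = (if c = eigval n then w else (\<lambda>_. 0))"
      by (rule is_PhiD[OF \<omega> cv w])
    then show ?thesis using c by (intro exI[of _ c]) (auto simp: fun_eq_iff)
  qed
  \<comment> \<open>The standard basis vectors pick out the columns of the matrix of \<omega>, hence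
    all its coefficients. Since there are finitely many columns, their node sets have a finite
    union.\<close>
  have "\<exists>S. finite S \<and> (\<forall>Q. (\<forall>c\<in>S. poly Q c = ?\<delta> c) \<longrightarrow> dual_rep [0..<d] v \<omega> (?e l) = poly_op Q ?T (?e l))"
    if "l < d" for l
  proof (rule spectral_interpolation[OF dual_rep_clinear dual_rep_clinear Phi])
    show "?e l \<in> cvec.span {w \<in> supported d. \<exists>c. ?T w = c *\<^sub>C w}"
      by (rule hermitian_span_eigenvectors[where \<omega> = "fo h" and v = v, OF _ supp[OF that]]) (rule herm)
  qed
  then obtain S where S: "\<And>l. l < d \<Longrightarrow> finite (S l)"
    "\<And>l Q. l < d \<Longrightarrow> (\<forall>c\<in>S l. poly Q c = ?\<delta> c) \<Longrightarrow> dual_rep [0..<d] v \<omega> (?e l) = poly_op Q ?T (?e l)"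
    by metis
  show thesis
  proof (rule that)
    show "finite (\<Union>l<d. S l)" using S by blast
    fix Q x
    assume Q: "\<And>c. c \<in> (\<Union>l<d. S l) \<Longrightarrow> poly Q c = ?\<delta> c" and "x \<in> F"
    have coef: "\<omega> (v j l) = poly_fun Q (v j l)" if "j < d" "l < d" for j l
    proof -
      have "\<omega> (v j l) = dual_rep [0..<d] v \<omega> (?e l) j" using that by (simp add: entry)
      also have "dual_rep [0..<d] v \<omega> (?e l) = poly_op Q ?T (?e l)"
        using that by (intro S(2) ballI Q) auto
      also have "poly_op Q ?T (?e l) j = poly_fun Q (v j l)"
        using that by (simp only: dual_rep_poly_fun[OF cv supp, symmetric] entry)
      finally show ?thesis .
    qed
    have "x \<in> cvec.span (coefs d v)" using Fv \<open>x \<in> F\<close> by blast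
    then show "\<omega> x = poly_fun Q x"
    proof (induction rule: cvec.span_induct_alt)
      case base
      show ?case by (simp add: clinear_0[OF is_Phi_clinear[OF \<omega>]] clinear_0[OF poly_fun_clinear])
    next
      case (step c x y)
      then show ?case
        using coef by (auto simp: coefs_def clinear_add[OF is_Phi_clinear[OF \<omega>]] clinear_scale[OF is_Phi_clinear[OF \<omega>]]
            clinear_add[OF poly_fun_clinear] clinear_scale[OF poly_fun_clinear])
    qed
  qed
qed

text \<open>The adjoint of Q(h) is the polynomial with conjugate coefficients in h. As the
  eigenvalue selected by \<Phi>_n is real, both polynomials interpolate the same values. This makes
  I_c closed under the star.\<close>

lemma is_Phi_dual_star:
  assumes \<omega>: "is_Phi D q a n \<omega>"
  shows "dual_star A \<omega> = \<omega>"
proof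
  fix x
  obtain S where S: "finite S" "\<And>Q y. (\<And>c. c \<in> S \<Longrightarrow> poly Q c = (if c = eigval n then 1 else 0)) \<Longrightarrow>
      y \<in> {x, star (antip A x)} \<Longrightarrow> \<omega> y = poly_fun Q y"
    using is_Phi_poly_fun[OF \<omega>, of "{x, star (antip A x)}"] by blast
  \<comment> \<open>The conjugate nodes are included so that the conjugate polynomial has the
    prescribed values on \<open>S\<close> as well.\<close>
  obtain Q where Q: "\<And>c. c \<in> S \<union> cnj ` S \<Longrightarrow> poly Q c = (if c = eigval n then 1 else 0)"
    using interpolation_poly[of "S \<union> cnj ` S" "eigval n"] S(1) by auto
  let ?Q = "map_poly cnj Q"
  have real: "cnj c = eigval n \<longleftrightarrow> c = eigval n" for c
    by (metis complex_cnj_cnj complex_cnj_complex_of_real)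
  have "poly ?Q c = (if c = eigval n then 1 else 0)" if "c \<in> S" for c
    using Q[of "cnj c"] that by (auto simp: real)
  then have "\<omega> x = poly_fun ?Q x" by (intro S(2)) auto
  also have "\<dots> = cnj (poly_fun Q (star (antip A x)))"
  proof -
    have "fo (h ^ i) x = cnj (fo (h ^ i) (star (antip A x)))" for i
      using pair_star_right[of x "h ^ i"] by (simp add: fun_of_def star_h_power)
    moreover have "degree ?Q = degree Q" by (rule degree_map_poly) auto
    ultimately show ?thesis by (simp add: poly_fun_def coeff_map_poly)
  qed
  also have "poly_fun Q (star (antip A x)) = \<omega> (star (antip A x))"
    using Q by (intro S(2)[symmetric]) auto
  finally show "dual_star A \<omega> x = \<omega> x" by (simp add: dual_star_def)
qed

text \<open>Evaluation at 1 is the trivial one-dimensional corepresentation, in which i B_t acts by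
  its counit [a].\<close>

lemma is_Phi_one:
  assumes "is_Phi D q a n \<omega>"
  shows "\<omega> 1 = (if of_real (qint q a) = eigval n then 1 else 0)"
proof -
  let ?v = "\<lambda>_ _. 1 :: 'a" and ?\<xi> = "\<lambda>j::nat. if j = 0 then 1 else 0 :: complex"
  have "corep A [0..<1] ?v"
    by (auto intro!: A.corepI simp: A.counit_one A.coprod_bilinear_one clinear_intros)
  moreover have "dual_rep [0..<1] ?v (fo h) ?\<xi> = (\<lambda>j. of_real (qint q a) * ?\<xi> j)"
    by (auto simp: dual_rep_def fun_of_def pair_one_left counit_h)
  ultimately have "dual_rep [0..<1] ?v \<omega> ?\<xi> = (if of_real (qint q a) = eigval n then ?\<xi> else (\<lambda>_. 0))"
    by (intro is_PhiD[OF assms]) (auto simp: supported_def)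
  from fun_cong[OF this, of 0] show ?thesis by (simp add: dual_rep_def split: if_splits)
qed

lemma stab_Ic_induct [consumes 1, case_names zero step]:
  assumes "\<omega> \<in> stab_Ic D q a"
    and "P (\<lambda>x. 0)"
    and "\<And>c n \<theta> \<omega>. is_Phi D q a n \<theta> \<Longrightarrow> \<omega> \<in> stab_Ic D q a \<Longrightarrow> P \<omega> \<Longrightarrow> P (\<lambda>x. c * \<theta> x + \<omega> x)"
  shows "P \<omega>"
proof -
  have "P (\<lambda>x. \<Sum>(c, \<omega>)\<leftarrow>ps. c * \<omega> x)" if "\<forall>(c, \<omega>)\<in>set ps. \<exists>n. is_Phi D q a n \<omega>" for ps
    using that
  proof (induction ps)
    case Nil
    show ?case using assms(2) by simp
  next
    case (Cons p ps)
    obtain c \<theta> where p: "p = (c, \<theta>)" by (cases p)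
    have "(\<lambda>x. \<Sum>(c, \<omega>)\<leftarrow>ps. c * \<omega> x) \<in> stab_Ic D q a"
      unfolding stab_Ic_def using Cons.prems by auto
    then show ?case using Cons p assms(3) by auto
  qed
  then show ?thesis using assms(1) unfolding stab_Ic_def by auto
qed

lemma is_Phi_stab_Ic: "is_Phi D q a n \<omega> \<Longrightarrow> \<omega> \<in> stab_Ic D q a"
  unfolding stab_Ic_def by (auto intro!: exI[of _ "[(1, \<omega>)]"])

lemma stab_Ic_clinear: "\<omega> \<in> stab_Ic D q a \<Longrightarrow> clinear \<omega>"
  by (induction rule: stab_Ic_induct)
    (rule clinear_zero, rule clinear_plus[OF clinear_times_right[OF is_Phi_clinear]])

lemma stab_Ic_dual_star: "\<omega> \<in> stab_Ic D q a \<Longrightarrow> dual_star A \<omega> \<in> stab_Ic D q a"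
proof (induction rule: stab_Ic_induct)
  case zero
  show ?case by (auto simp: dual_star_def stab_Ic_def intro!: exI[of _ "[]"])
next
  case (step c n \<theta> \<omega>)
  have "dual_star A (\<lambda>x. c * \<theta> x + \<omega> x) = (\<lambda>x. cnj c * \<theta> x + dual_star A \<omega> x)"
    using is_Phi_dual_star[OF step(1)] by (simp add: dual_star_def fun_eq_iff)
  moreover obtain ps where "\<forall>(c, \<omega>)\<in>set ps. \<exists>n. is_Phi D q a n \<omega>" "dual_star A \<omega> = (\<lambda>x. \<Sum>(c, \<omega>)\<leftarrow>ps. c * \<omega> x)"
    using step(3) unfolding stab_Ic_def by auto
  ultimately show ?case
    using step(1) unfolding stab_Ic_def by (auto intro!: exI[of _ "(cnj c, \<theta>) # ps"])
qed


section \<open>The Drinfeld double\<close>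

abbreviation "jA \<equiv> incA D"
abbreviation "jU \<equiv> incU D"
abbreviation "eps \<equiv> epsX D"

lemma double_parts:
  shows jA_clinear: "clinear jA" and jA_one: "jA 1 = 1"
    and jA_times [rule_format]: "\<forall>b b'. jA (b * b') = jA b * jA b'"
    and jA_star [rule_format]: "\<forall>b. jA (star b) = star (jA b)"
    and jU_add' [rule_format]: "\<forall>\<omega>\<in>dual_of A. \<forall>\<omega>'\<in>dual_of A. jU (\<lambda>x. \<omega> x + \<omega>' x) = jU \<omega> + jU \<omega>'"
    and jU_scale' [rule_format]: "\<forall>c. \<forall>\<omega>\<in>dual_of A. jU (\<lambda>x. c * \<omega> x) = c *\<^sub>C jU \<omega>"
    and jU_counit: "jU \<epsilon> = 1"
    and jU_conv' [rule_format]: "\<forall>\<omega>\<in>dual_of A. \<forall>\<omega>'\<in>dual_of A. jU (conv A \<omega> \<omega>') = jU \<omega> * jU \<omega>'"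
    and jU_star' [rule_format]: "\<forall>\<omega>\<in>dual_of A. jU (dual_star A \<omega>) = star (jU \<omega>)"
    and exchange' [rule_format]: "\<forall>\<omega>\<in>dual_of A. \<forall>b. jU \<omega> * jA b =
       (\<Sum>(b1, c)\<leftarrow>coprod A b. \<Sum>(b2, b3)\<leftarrow>coprod A c. jA b2 * jU (\<lambda>x. \<omega> (b3 * x * T b1)))"
    and double_span [rule_format]: "\<forall>y. \<exists>ps. set ps \<subseteq> UNIV \<times> dual_of A \<and> y = (\<Sum>(b, \<omega>)\<leftarrow>ps. jA b * jU \<omega>)"
  using double unfolding drinfeld_double_def by - (elim conjE, assumption)+

lemma in_dual_of [simp]: "\<omega> \<in> dual_of A \<longleftrightarrow> clinear \<omega>"
  by (simp add: dual_of_def)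

lemma jU_add: "clinear \<omega> \<Longrightarrow> clinear \<omega>' \<Longrightarrow> jU (\<lambda>x. \<omega> x + \<omega>' x) = jU \<omega> + jU \<omega>'"
  and jU_scale: "clinear \<omega> \<Longrightarrow> jU (\<lambda>x. c * \<omega> x) = c *\<^sub>C jU \<omega>"
  and jU_conv: "clinear \<omega> \<Longrightarrow> clinear \<omega>' \<Longrightarrow> jU (conv A \<omega> \<omega>') = jU \<omega> * jU \<omega>'"
  and jU_star: "clinear \<omega> \<Longrightarrow> jU (dual_star A \<omega>) = star (jU \<omega>)"
  and exchange: "clinear \<omega> \<Longrightarrow> jU \<omega> * jA b =
       (\<Sum>(b1, c)\<leftarrow>coprod A b. \<Sum>(b2, b3)\<leftarrow>coprod A c. jA b2 * jU (\<lambda>x. \<omega> (b3 * x * T b1)))"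
  and eps_tensor: "clinear \<omega> \<Longrightarrow> eps (jA b * jU \<omega>) = \<epsilon> b * \<omega> 1"
  by (simp_all add: jU_add' jU_scale' jU_conv' jU_star' exchange' epsX_tensor)

lemma jU_zero: "jU (\<lambda>x. 0) = 0"
  using jU_scale[OF A.counit_clinear, of 0] by simp

section \<open>The counit of the double is a character compatible with the star\<close>

lemma eps_jA: "eps (jA b) = \<epsilon> b"
  using eps_tensor[OF A.counit_clinear, of b] by (simp add: jU_counit A.counit_one)

lemma eps_jU: "clinear \<omega> \<Longrightarrow> eps (jU \<omega>) = \<omega> 1"
  using eps_tensor[of \<omega> 1] by (simp add: jA_one A.counit_one)

lemma double_induct [case_names tensor add zero]:
  assumes "\<And>b \<omega>. clinear \<omega> \<Longrightarrow> P (jA b * jU \<omega>)" "\<And>x y. P x \<Longrightarrow> P y \<Longrightarrow> P (x + y)" "P 0"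
  shows "P y"
proof -
  obtain ps where ps: "set ps \<subseteq> UNIV \<times> dual_of A" and y: "y = (\<Sum>(b, \<omega>)\<leftarrow>ps. jA b * jU \<omega>)"
    using double_span by blast
  show ?thesis
    unfolding y using ps by (induction ps) (auto intro!: assms)
qed

text \<open>Under the counit the middle leg of the exchange relation disappears, leaving \<omega> at
  the sum of b_2 S^-1(b_1), which is the counit of b times 1.\<close>

lemma eps_exchange:
  assumes \<omega>: "clinear \<omega>"
  shows "eps (jU \<omega> * jA b) = \<omega> 1 * \<epsilon> b"
proof -
  have lin: "clinear (\<lambda>x. \<omega> (b3 * x * b1))" for b1 b3
    by (intro clinear_compose[OF \<omega>] clinear_compose[OF clinear_mult_left] clinear_intros)
  have "eps (jU \<omega> * jA b) =
      (\<Sum>(b1, c)\<leftarrow>coprod A b. \<Sum>(b2, b3)\<leftarrow>coprod A c. \<epsilon> b2 * \<omega> (b3 * T b1))"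
    by (simp add: exchange[OF \<omega>] clinear_sum_list2[OF epsX_clinear] eps_tensor lin)
  also have "\<dots> = (\<Sum>(b1, c)\<leftarrow>coprod A b. \<omega> (c * T b1))"
  proof (rule sum_list2_cong)
    fix b1 c
    have lin: "clinear (\<lambda>x. \<omega> (x * T b1))"
      by (intro clinear_compose[OF \<omega>] clinear_intros)
    have "\<omega> (c * T b1) = \<omega> ((\<Sum>(b2, b3)\<leftarrow>coprod A c. \<epsilon> b2 *\<^sub>C b3) * T b1)"
      by (simp add: A.counit_left)
    also have "\<dots> = (\<Sum>(b2, b3)\<leftarrow>coprod A c. \<omega> (\<epsilon> b2 *\<^sub>C b3 * T b1))"
      by (rule clinear_sum_list2[OF lin])
    also have "\<dots> = (\<Sum>(b2, b3)\<leftarrow>coprod A c. \<epsilon> b2 * \<omega> (b3 * T b1))"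
      by (simp add: clinear_scale[OF lin])
    finally show "(\<Sum>(b2, b3)\<leftarrow>coprod A c. \<epsilon> b2 * \<omega> (b3 * T b1)) = \<omega> (c * T b1)" ..
  qed
  also have "\<dots> = \<omega> (\<Sum>(b1, c)\<leftarrow>coprod A b. c * T b1)"
    by (simp add: clinear_sum_list2[OF \<omega>])
  finally show ?thesis
    by (simp add: A.antip_inv_right clinear_scale[OF \<omega>])
qed

text \<open>Outer factors already in the right order split off without exchange. In a product of two
  tensors only the inner crossing of \<omega> with c then remains, and this is
  \<open>eps_exchange\<close>.\<close>

lemma eps_sandwich:
  assumes \<omega>: "clinear \<omega>"
  shows "eps (jA b * y * jU \<omega>) = \<epsilon> b * eps y * \<omega> 1"
proof (induction y rule: double_induct)
  case (tensor c \<theta>)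
  have "jA b * (jA c * jU \<theta>) * jU \<omega> = jA (b * c) * jU (conv A \<theta> \<omega>)"
    by (simp add: jA_times jU_conv tensor \<omega> mult.assoc)
  then show ?case
    by (simp add: eps_tensor A.conv_clinear A.conv_one tensor \<omega> A.counit_mult)
qed (simp_all add: distrib_left distrib_right clinear_add[OF epsX_clinear] clinear_0[OF epsX_clinear])

lemma eps_times: "eps (x * y) = eps x * eps y"
proof (induction x rule: double_induct)
  case (tensor b \<omega>)
  note \<omega> = this
  show ?case
  proof (induction y rule: double_induct)
    case (tensor c \<theta>)
    have "jA b * jU \<omega> * (jA c * jU \<theta>) = jA b * (jU \<omega> * jA c) * jU \<theta>"
      by (simp add: mult.assoc)
    then have "eps (jA b * jU \<omega> * (jA c * jU \<theta>)) = \<epsilon> b * (\<omega> 1 * \<epsilon> c) * \<theta> 1"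
      by (simp only: eps_sandwich[OF tensor] eps_exchange[OF \<omega>])
    then show ?case
      by (simp only: eps_tensor[OF \<omega>] eps_tensor[OF tensor] mult.assoc)
  qed (simp_all add: distrib_left clinear_add[OF epsX_clinear] clinear_0[OF epsX_clinear])
qed (simp_all add: distrib_right clinear_add[OF epsX_clinear] clinear_0[OF epsX_clinear])

lemma eps_one: "eps 1 = 1"
  using eps_jA[of 1] by (simp add: jA_one A.counit_one)

lemma eps_star: "eps (star x) = cnj (eps x)"
proof (induction x rule: double_induct)
  case (tensor b \<omega>)
  have "antip A 1 = 1"
    using A.antip_left[of 1] A.coprod_bilinear_one[of "\<lambda>y z. antip A y * z"]
    by (simp add: A.counit_one clinear_intros clinear_compose[OF clinear_mult_left A.antip_clinear])
  moreover have "clinear (dual_star A \<omega>)"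
    by (rule clinearI) (simp_all add: dual_star_def clinear_add[OF A.antip_clinear] clinear_scale[OF A.antip_clinear]
        star_add star_scaleC clinear_add[OF tensor] clinear_scale[OF tensor])
  ultimately show ?case
    by (simp add: star_mult eps_times eps_jA eps_jU A.counit_star dual_star_def tensor flip: jA_star jU_star[OF tensor])
qed (simp_all add: star_add clinear_add[OF epsX_clinear] clinear_0[OF epsX_clinear])

lemma T_functional_clinear: "clinear \<omega> \<Longrightarrow> clinear (\<lambda>x. \<omega> (T x))"
  by (rule clinear_compose[OF _ A.antip_inv_clinear])

text \<open>The exchange relation of the double contains a left action on x. On the sphere that
  action of \<open>B\<close> is the scalar -\<tau>, so the parts with \<open>k'\<close> and
  \<open>Z\<close> recombine to -\<tau> \<open>k'\<close> + \<open>Z\<close> = \<open>B\<close>, and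
  only the right action remains.\<close>

lemma exchange_B:
  assumes x: "x \<in> St"
  shows "jU (fo B) * jA x = jA (ract A x (\<lambda>y. fo k' (T y))) * jU (fo B) + jA (ract A x (\<lambda>y. fo Z (T y)))"
proof -
  have jA_mult: "clinear (\<lambda>b. jA b * y)" for y
    by (rule clinear_compose[OF clinear_mult_left jA_clinear])
  \<comment> \<open>The twofold coproduct of B_t has the terms \<open>B\<close>, \<open>k'\<close>,
    \<open>k'\<close>, then 1, \<open>Z\<close>, \<open>k'\<close>, then 1, 1, \<open>Z\<close>; its
    outer legs are evaluated at \<open>b3\<close> and \<open>b1\<close>.\<close>
  have slice: "jU (\<lambda>y. fo B (b3 * y * b1)) =
      (fo B b3 * fo k' b1) *\<^sub>C jU (fo k') + (\<epsilon> b3 * fo k' b1) *\<^sub>C jU (fo Z) + (\<epsilon> b3 * fo Z b1) *\<^sub>C 1" for b1 b3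
  proof -
    have "(\<lambda>y. fo B (b3 * y * b1)) =
        (\<lambda>y. (fo B b3 * fo k' b1) * fo k' y + ((\<epsilon> b3 * fo k' b1) * fo Z y + (\<epsilon> b3 * fo Z b1) * \<epsilon> y))"
      by (simp add: fun_of_def pair_times_B pair_times_k' pair_times_Z mult.assoc algebra_simps)
    then show ?thesis
      by (simp add: jU_add jU_scale jU_counit clinear_intros fun_of_clinear A.counit_clinear)
  qed
  have inner: "(\<Sum>(b2, b3)\<leftarrow>coprod A c. jA b2 * jU (\<lambda>y. fo B (b3 * y * b1))) =
      fo k' b1 *\<^sub>C (jA (lact A (fo B) c) * jU (fo k')) + fo k' b1 *\<^sub>C (jA c * jU (fo Z)) + fo Z b1 *\<^sub>C jA c" for b1 c
  proof -
    have "(\<Sum>(b2, b3)\<leftarrow>coprod A c. jA b2 * jU (\<lambda>y. fo B (b3 * y * b1))) =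
        (\<Sum>(b2, b3)\<leftarrow>coprod A c. fo B b3 *\<^sub>C (fo k' b1 *\<^sub>C (jA b2 * jU (fo k')))) +
        ((\<Sum>(b2, b3)\<leftarrow>coprod A c. \<epsilon> b3 *\<^sub>C (fo k' b1 *\<^sub>C (jA b2 * jU (fo Z)))) +
         (\<Sum>(b2, b3)\<leftarrow>coprod A c. \<epsilon> b3 *\<^sub>C (fo Z b1 *\<^sub>C jA b2)))"
      unfolding sum_list2_add[symmetric] slice
      by (simp add: distrib_left mult_scaleC_right scaleC_scaleC mult.commute add.assoc)
    also have "\<dots> = fo k' b1 *\<^sub>C (jA (lact A (fo B) c) * jU (fo k')) +
        (fo k' b1 *\<^sub>C (jA (lact A \<epsilon> c) * jU (fo Z)) + fo Z b1 *\<^sub>C jA (lact A \<epsilon> c))"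
      by (simp only: A.clinear_lact[OF clinear_scaleC[OF jA_mult]] A.clinear_lact[OF clinear_scaleC[OF jA_clinear]])
    finally show ?thesis by (simp add: A.lact_counit add.assoc)
  qed
  let ?r = "ract A x (\<lambda>y. fo k' (T y))"
  have "jU (fo B) * jA x =
      (\<Sum>(b1, c)\<leftarrow>coprod A x. fo k' (T b1) *\<^sub>C (jA (lact A (fo B) c) * jU (fo k'))) +
      ((\<Sum>(b1, c)\<leftarrow>coprod A x. fo k' (T b1) *\<^sub>C (jA c * jU (fo Z))) +
       (\<Sum>(b1, c)\<leftarrow>coprod A x. fo Z (T b1) *\<^sub>C jA c))"
    unfolding sum_list2_add[symmetric] by (simp add: exchange[OF fun_of_clinear] inner add.assoc)
  also have "\<dots> = jA (lact A (fo B) ?r) * jU (fo k') + (jA ?r * jU (fo Z) + jA (ract A x (\<lambda>y. fo Z (T y))))"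
    by (intro arg_cong2[where f = plus] A.clinear_ract[OF clinear_compose[OF jA_mult A.lact_clinear[OF fun_of_clinear]], symmetric]
        A.clinear_ract[OF jA_mult, symmetric] A.clinear_ract[OF jA_clinear, symmetric])
  \<comment> \<open>Right translation stays in the sphere, so \<open>B\<close> acts on
    \<open>?r\<close> by the same scalar as on x.\<close>
  also have "lact A (fo B) ?r = - \<tau> *\<^sub>C ?r"
    using sphere_ract[OF x T_functional_clinear[OF fun_of_clinear]] sphere_iff by blast
  also have "jA (- \<tau> *\<^sub>C ?r) * jU (fo k') + (jA ?r * jU (fo Z) + jA (ract A x (\<lambda>y. fo Z (T y)))) =
      jA ?r * (- \<tau> *\<^sub>C jU (fo k') + jU (fo Z)) + jA (ract A x (\<lambda>y. fo Z (T y)))"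
    by (simp only: clinear_scale[OF jA_clinear] mult_scaleC_left mult_scaleC_right distrib_left add.assoc)
  also have "- \<tau> *\<^sub>C jU (fo k') + jU (fo Z) = jU (fo B)"
  proof -
    have "fo Z = (\<lambda>x. fo B x + \<tau> * fo k' x)"
      by (simp add: Z_def fun_of_add fun_of_scale)
    then have "jU (fo Z) = jU (fo B) + \<tau> *\<^sub>C jU (fo k')"
      by (simp add: jU_add jU_scale clinear_intros fun_of_clinear)
    then show ?thesis by simp
  qed
  finally show ?thesis .
qed

end


section \<open>The trivial quotient of the universal module\<close>

lemma is_rep_UNIV:
  assumes "is_rep X UNIV \<rho>"
  shows is_rep_clinear: "x \<in> X \<Longrightarrow> clinear (\<rho> x)"
    and is_rep_add: "x \<in> X \<Longrightarrow> y \<in> X \<Longrightarrow> \<rho> (x + y) v = \<rho> x v + \<rho> y v"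
    and is_rep_scale: "x \<in> X \<Longrightarrow> \<rho> (c *\<^sub>C x) v = c *\<^sub>C \<rho> x v"
    and is_rep_mult: "x \<in> X \<Longrightarrow> y \<in> X \<Longrightarrow> \<rho> (x * y) v = \<rho> x (\<rho> y v)"
  using assms unfolding is_rep_def by (auto intro!: clinearI)

context podles_sphere
begin

text \<open>The counit of the coefficient of \<xi> with itself is its squared norm q + t^2 / (q +
  1/q) + 1/q; the constant subtracted in A_a removes the middle term. This is where \<lambda> = q +
  1/q comes from.\<close>

lemma counit_A_el: "\<epsilon> (A_el D q a a) = of_real (q + 1 / q)"
proof -
  have spin: "\<epsilon> (spin1 D j l) = (if j = l then 1 else 0)" if "j \<in> {-1, 0, 1}" "l \<in> {-1, 0, 1}" for j l
    using spin1_corep that unfolding unitary_corep_def corep_def by auto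
  have "\<epsilon> (mcoef D (xi_vec q a) (xi_vec q a)) =
      (\<Sum>j\<in>{-1, 0, 1}. \<Sum>l\<in>{-1, 0, 1}. (cnj (xi_vec q a j) * xi_vec q a l) * \<epsilon> (spin1 D j l))"
    unfolding mcoef_def by (simp only: clinear_sum[OF A.counit_clinear] clinear_scale[OF A.counit_clinear] scaleC_complex)
  also have "\<dots> = (\<Sum>j\<in>{-1, 0, 1}. cnj (xi_vec q a j) * xi_vec q a j)"
    by (simp add: spin)
  also have "\<dots> = of_real ((sqrt q)\<^sup>2 + (qdiff q a / sqrt (q + 1 / q))\<^sup>2 + (1 / sqrt q)\<^sup>2)"
  proof -
    have "cnj (of_real y) * of_real y = complex_of_real (y\<^sup>2)"
      "cnj (- (\<i> * of_real y)) * - (\<i> * of_real y) = complex_of_real (y\<^sup>2)" for y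
      by (simp_all add: power2_eq_square complex_eq_iff)
    then show ?thesis
      by (simp add: xi_vec_def del: complex_cnj_complex_of_real complex_cnj_minus complex_cnj_mult of_real_power
          of_real_divide mult_minus_right)
  qed
  also have "\<dots> = of_real (q + qdiff q a * qdiff q a / (q + 1 / q) + 1 / q)"
  proof -
    have "0 \<le> q + 1 / q" using q by simp
    then have "(sqrt q)\<^sup>2 = q" "(qdiff q a / sqrt (q + 1 / q))\<^sup>2 = qdiff q a * qdiff q a / (q + 1 / q)" "(1 / sqrt q)\<^sup>2 = 1 / q"
      using q by (simp_all only: power_divide real_sqrt_pow2 less_imp_le power_one power2_eq_square[of "qdiff q a"])
    then show ?thesis by (simp only:)
  qed
  finally show ?thesis
    by (simp add: A_el_def clinear_diff[OF A.counit_clinear] clinear_scale[OF A.counit_clinear] A.counit_one)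
qed

lemma Uq_jA: "b \<in> St \<Longrightarrow> jA b \<in> Uq_sl2R D q a"
  unfolding Uq_sl2R_def by (rule star_gen.base) auto

lemma iBt_eq: "iBt D q a = jU (fo h)"
  by (simp add: iBt_def)

lemma Uq_iBt: "iBt D q a \<in> Uq_sl2R D q a"
proof -
  have "h \<in> coideal_I D q a"
    unfolding coideal_I_def
    by (rule cvec.span_scale[OF cvec.span_base]) (auto intro: exI[of _ 1] simp: image_iff)
  then show ?thesis unfolding Uq_sl2R_def iBt_eq by (intro star_gen.base) auto
qed

lemma Uq_scalars: "c *\<^sub>C 1 \<in> Uq_sl2R D q a"
  using Uq_jA[OF sphere_one] unfolding Uq_sl2R_def by (simp add: jA_one star_gen.scale)

lemma eps_iBt: "eps (iBt D q a) = of_real (qint q a)"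
  by (simp only: iBt_eq eps_jU[OF fun_of_clinear]) (simp add: fun_of_def pair_one_left counit_h)

text \<open>The line is taken inside \<open>nat \<Rightarrow>\<^sub>0 complex\<close> because
  universality quantifies over subspaces of that type. Both choices of \<open>s\<close> give the
  same \<lambda>, as it is real.\<close>

lemma trivial_basic_module:
  fixes \<xi> :: "nat \<Rightarrow>\<^sub>0 complex"
  assumes s: "s = star \<or> s = id"
  shows "basic_module D q a s (of_real (q + 1 / q)) a (range (\<lambda>c. c *\<^sub>C \<xi>)) (\<lambda>x v. eps x *\<^sub>C v) \<xi>"
proof -
  have "cvec.subspace (range (\<lambda>c. c *\<^sub>C \<xi>))"
    by (rule cvec.subspaceI) (auto simp: image_iff scaleC_scaleC
        intro: exI[of _ 0] exI[of _ "_ + _"] simp flip: scaleC_left_distrib)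
  then have "is_rep (Uq_sl2R D q a) (range (\<lambda>c. c *\<^sub>C \<xi>)) (\<lambda>x v. eps x *\<^sub>C v)"
    by (auto simp: is_rep_def scaleC_scaleC scaleC_right_distrib clinear_add[OF epsX_clinear] clinear_scale[OF epsX_clinear]
        scaleC_left_distrib eps_times eps_one mult.commute mult.left_commute)
  moreover have "range (\<lambda>c. c *\<^sub>C \<xi>) = (\<lambda>x. eps x *\<^sub>C \<xi>) ` Uq_sl2R D q a"
  proof -
    have "c *\<^sub>C \<xi> = eps (c *\<^sub>C 1) *\<^sub>C \<xi>" for c
      by (simp add: clinear_scale[OF epsX_clinear] eps_one)
    then show ?thesis using Uq_scalars by (auto simp: image_iff) metis
  qed
  moreover have "\<epsilon> (s (A_el D q a a)) = of_real (q + 1 / q)"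
    using s counit_A_el by (auto simp: A.counit_star)
  moreover have "\<xi> \<in> range (\<lambda>c. c *\<^sub>C \<xi>)"
    using rangeI[of "\<lambda>c. c *\<^sub>C \<xi>" 1] by simp
  ultimately show ?thesis
    unfolding basic_module_def eps_iBt eps_jA by (intro conjI) (simp_all only:)
qed

text \<open>The form \<open>cnj (\<phi> v) * \<phi> w\<close> is invariant, so uniqueness of the form identifies its kernel with that of \<open>p\<close>.\<close>

lemma trivial_quotient:
  assumes s: "s = star \<or> s = id"
    and L: "L_module D q a s (of_real (q + 1 / q)) a \<rho> e hf p \<rho>L"
  obtains \<phi> where "clinear \<phi>" "\<phi> e = (1::complex)"
    "\<And>x v. x \<in> Uq_sl2R D q a \<Longrightarrow> \<phi> (\<rho> x v) = eps x * \<phi> v" "\<And>v. p v = 0 \<longleftrightarrow> \<phi> v = 0"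
proof -
  \<comment> \<open>A vector with coordinate 1 at index 0; reading this coordinate turns the map
    onto the line into a functional with value 1 at \<open>e\<close>.\<close>
  let ?\<xi> = "Poly_Mapping.single (0::nat) (1::complex)"
  have U: "universal_basic_module D q a s (of_real (q + 1 / q)) a \<rho> e"
    and form: "unique_invariant_form (Uq_sl2R D q a) \<rho> hf"
    and ker: "{v. p v = 0} = {v. \<forall>w. hf v w = 0}"
    using L unfolding L_module_def by auto
  have "\<exists>\<psi>. clinear \<psi> \<and> range \<psi> = range (\<lambda>c. c *\<^sub>C ?\<xi>) \<and> \<psi> e = ?\<xi> \<and>
      (\<forall>x\<in>Uq_sl2R D q a. \<forall>v. \<psi> (\<rho> x v) = eps x *\<^sub>C \<psi> v)"
    by (rule U[unfolded universal_basic_module_def, THEN conjunct2, rule_format, OF trivial_basic_module[OF s]])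
  then obtain \<psi> where \<psi>: "clinear \<psi>" "\<psi> e = ?\<xi>"
    "\<And>x v. x \<in> Uq_sl2R D q a \<Longrightarrow> \<psi> (\<rho> x v) = eps x *\<^sub>C \<psi> v"
    by blast
  define \<phi> where "\<phi> v = Poly_Mapping.lookup (\<psi> v) 0" for v
  have lin: "clinear \<phi>"
    by (rule clinearI) (simp_all add: \<phi>_def clinear_add[OF \<psi>(1)] clinear_scale[OF \<psi>(1)] lookup_add lookup_scaleC)
  have e: "\<phi> e = 1" by (simp add: \<phi>_def \<psi>(2))
  have equiv: "\<phi> (\<rho> x v) = eps x * \<phi> v" if "x \<in> Uq_sl2R D q a" for x v
    by (simp add: \<phi>_def \<psi>(3)[OF that] lookup_scaleC)
  have star: "star x \<in> Uq_sl2R D q a" if "x \<in> Uq_sl2R D q a" for x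
    using that unfolding Uq_sl2R_def by (rule star_gen.star)
  have "invariant_form (Uq_sl2R D q a) \<rho> (\<lambda>v w. cnj (\<phi> v) * \<phi> w)"
    unfolding invariant_form_def
    by (intro conjI allI ballI clinear_times_right[OF lin])
      (simp_all add: clinear_add[OF lin] clinear_scale[OF lin] distrib_right equiv star eps_star)
  then obtain c where c: "cnj (\<phi> v) * \<phi> w = c * hf v w" for v w
    using form unfolding unique_invariant_form_def by metis
  have "c \<noteq> 0" using c[of e e] e by auto
  have "p v = 0 \<longleftrightarrow> \<phi> v = 0" for v
  proof -
    have "p v = 0 \<longleftrightarrow> (\<forall>w. hf v w = 0)" using ker by blast
    also have "\<dots> \<longleftrightarrow> (\<forall>w. cnj (\<phi> v) * \<phi> w = 0)" using c \<open>c \<noteq> 0\<close> by simp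
    also have "\<dots> \<longleftrightarrow> \<phi> v = 0" using e by (metis complex_cnj_zero_iff mult_eq_0_iff one_neq_zero)
    finally show ?thesis .
  qed
  with lin e equiv show thesis using that by blast
qed

end


section \<open>The action of the stabilizer\<close>

locale stab_module = podles_sphere q a D
  for q a :: real and D :: "('a::star_algebra, 'u::star_algebra, 'x::star_algebra) podles" +
  fixes \<rho> \<pi>t :: "'x \<Rightarrow> 'm::complex_vector \<Rightarrow> 'm"
  assumes rep: "is_rep (Uq_sl2R D q a) UNIV \<rho>" and stab: "stab_rep D q a \<rho> \<pi>t"
begin

abbreviation "X \<equiv> Oq_stab D q a"

lemma stab_parts:
  shows \<pi>t_rep: "is_rep X UNIV \<pi>t"
    and \<pi>t_jA [rule_format]: "\<forall>b\<in>St. \<pi>t (jA b) = \<rho> (jA b)"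
    and weights_span: "cvec.span {v. \<exists>n::int. \<rho> (iBt D q a) v = eigval n *\<^sub>C v} = UNIV"
    and \<pi>t_Phi [rule_format]: "\<forall>n \<omega> m v. is_Phi D q a n \<omega> \<and> \<rho> (iBt D q a) v = eigval m *\<^sub>C v \<longrightarrow>
        \<pi>t (jU \<omega>) v = (if m = n then v else 0)"
  using stab unfolding stab_rep_def by - (elim conjE, assumption)+

lemma X_jA: "b \<in> St \<Longrightarrow> jA b \<in> X" and X_jU: "\<omega> \<in> stab_Ic D q a \<Longrightarrow> jU \<omega> \<in> X"
  unfolding Oq_stab_def by (auto intro: star_gen.base)

lemma X_scale: "x \<in> X \<Longrightarrow> c *\<^sub>C x \<in> X"
  and X_star: "x \<in> X \<Longrightarrow> star x \<in> X"
  unfolding Oq_stab_def by (auto intro: star_gen.intros)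

lemmas \<pi>t_clinear = is_rep_clinear[OF \<pi>t_rep]
lemmas \<rho>_clinear = is_rep_clinear[OF rep]

lemma \<pi>t_zero: "\<pi>t 0 v = 0"
  using is_rep_scale[OF \<pi>t_rep X_jA[OF sphere_one], of 0 v] by simp

lemma \<pi>t_jU_step:
  assumes "is_Phi D q a n \<theta>" "\<omega> \<in> stab_Ic D q a"
  shows "\<pi>t (jU (\<lambda>x. c * \<theta> x + \<omega> x)) v = c *\<^sub>C \<pi>t (jU \<theta>) v + \<pi>t (jU \<omega>) v"
proof -
  have "jU (\<lambda>x. c * \<theta> x + \<omega> x) = c *\<^sub>C jU \<theta> + jU \<omega>"
    using is_Phi_clinear[OF assms(1)] stab_Ic_clinear[OF assms(2)] by (simp add: jU_add jU_scale clinear_times_right)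
  then show ?thesis
    using assms by (simp add: is_rep_add[OF \<pi>t_rep] is_rep_scale[OF \<pi>t_rep] X_scale X_jU is_Phi_stab_Ic)
qed

text \<open>Indices are replaced by eigenvalues, the form used in interpolation: if the two
  eigenvalues agree, \<open>\<pi>t_Phi\<close> is applied with \<open>n\<close> in place of
  \<open>m\<close>; otherwise the indices differ.\<close>

lemma \<pi>t_Phi_eigenvector:
  assumes \<omega>: "is_Phi D q a n \<omega>" and v: "\<rho> (iBt D q a) v = eigval m *\<^sub>C v"
  shows "\<pi>t (jU \<omega>) v = (if eigval m = eigval n then 1 else 0) *\<^sub>C v"
  using \<pi>t_Phi[of n \<omega> v m] \<pi>t_Phi[of n \<omega> v n] assms by (auto split: if_splits)

lemma \<pi>t_jU_cyclic:
  assumes e: "\<rho> (iBt D q a) e = of_real (qint q a) *\<^sub>C e" and "\<omega> \<in> stab_Ic D q a"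
  shows "\<pi>t (jU \<omega>) e = \<omega> 1 *\<^sub>C e"
  using assms(2)
proof (induction rule: stab_Ic_induct)
  case zero
  show ?case by (simp add: jU_zero \<pi>t_zero)
next
  case (step c n \<theta> \<omega>)
  have "\<pi>t (jU \<theta>) e = \<theta> 1 *\<^sub>C e"
    using \<pi>t_Phi_eigenvector[OF step(1), of e 0] e by (simp add: is_Phi_one[OF step(1)])
  then show ?case
    using step by (simp add: \<pi>t_jU_step scaleC_left_distrib scaleC_scaleC)
qed

text \<open>After the exchange, i B_t meets \<open>e\<close> and becomes [a] = -i \<tau>. Then [a]
  \<open>k'\<close> + i \<open>Z\<close> = i \<open>B\<close> as elements of the enveloping algebra,
  so the two right translates merge into one by i B_t.\<close>

lemma \<rho>_h_shift:
  assumes e: "\<rho> (iBt D q a) e = of_real (qint q a) *\<^sub>C e" and x: "x \<in> St"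
  shows "\<rho> (iBt D q a) (\<rho> (jA x) e) = \<rho> (jA (ract A x (\<lambda>y. fo h (T y)))) e"
proof -
  let ?r = "ract A x (\<lambda>y. fo k' (T y))" and ?z = "ract A x (\<lambda>y. fo Z (T y))"
  have St: "?r \<in> St" "?z \<in> St"
    by (intro sphere_ract x T_functional_clinear fun_of_clinear)+
  note Uq = Uq_jA[OF St(1)] Uq_jA[OF St(2)] Uq_iBt Uq_jA[OF x]
  have Uq': "jA ?r * iBt D q a \<in> Uq_sl2R D q a" "\<i> *\<^sub>C jA ?z \<in> Uq_sl2R D q a"
    using Uq unfolding Uq_sl2R_def by (auto intro: star_gen.intros)
  have "iBt D q a = \<i> *\<^sub>C jU (fo B)"
    unfolding iBt_eq fun_of_scale by (rule jU_scale[OF fun_of_clinear])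
  then have ex: "iBt D q a * jA x = jA ?r * iBt D q a + \<i> *\<^sub>C jA ?z"
    by (simp only: mult_scaleC_left mult_scaleC_right exchange_B[OF x] scaleC_right_distrib)
  have "\<rho> (iBt D q a) (\<rho> (jA x) e) = \<rho> (jA ?r * iBt D q a + \<i> *\<^sub>C jA ?z) e"
    using Uq by (simp only: is_rep_mult[OF rep, symmetric] ex)
  also have "\<dots> = of_real (qint q a) *\<^sub>C \<rho> (jA ?r) e + \<i> *\<^sub>C \<rho> (jA ?z) e"
    using Uq Uq' by (simp add: is_rep_add[OF rep] is_rep_mult[OF rep] is_rep_scale[OF rep] e clinear_scale[OF \<rho>_clinear])
  also have "\<dots> = \<rho> (of_real (qint q a) *\<^sub>C jA ?r + \<i> *\<^sub>C jA ?z) e"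
  proof -
    have "of_real (qint q a) *\<^sub>C jA ?r \<in> Uq_sl2R D q a"
      using Uq unfolding Uq_sl2R_def by (auto intro: star_gen.intros)
    then show ?thesis
      using Uq Uq' by (simp add: is_rep_add[OF rep] is_rep_scale[OF rep])
  qed
  also have "of_real (qint q a) *\<^sub>C jA ?r + \<i> *\<^sub>C jA ?z = jA (ract A x (\<lambda>y. of_real (qint q a) * fo k' (T y) + \<i> * fo Z (T y)))"
    by (simp only: clinear_scale[OF jA_clinear, symmetric] clinear_add[OF jA_clinear, symmetric] A.ract_add A.ract_scale)
  also have "(\<lambda>y. of_real (qint q a) * fo k' (T y) + \<i> * fo Z (T y)) = (\<lambda>y. fo h (T y))"
  proof -
    have "of_real (qint q a) = - \<i> * \<tau>"
      using counit_h by (simp add: clinear_scale[OF U.counit_clinear] counit_B)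
    then show ?thesis
      by (simp add: Z_def fun_of_add fun_of_scale algebra_simps)
  qed
  finally show ?thesis .
qed

text \<open>Iteration works because each translate stays in the sphere. The inverse antipode
  reverses convolution, which here only moves the new factor \<open>h\<close> to the front of the
  power.\<close>

lemma poly_op_shift:
  assumes e: "\<rho> (iBt D q a) e = of_real (qint q a) *\<^sub>C e" and x: "x \<in> St"
  shows "poly_op Q (\<rho> (iBt D q a)) (\<rho> (jA x) e) = \<rho> (jA (ract A x (\<lambda>y. poly_fun Q (T y)))) e"
proof -
  let ?f = "\<lambda>i y. fo (h ^ i) (T y)"
  have St: "ract A x (?f i) \<in> St" for i
    by (intro sphere_ract x T_functional_clinear fun_of_clinear)
  have pow: "(\<rho> (iBt D q a) ^^ i) (\<rho> (jA x) e) = \<rho> (jA (ract A x (?f i))) e" for i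
  proof (induction i)
    case 0
    show ?case by (simp add: fun_of_one A.counit_antip_inv A.ract_counit)
  next
    case (Suc i)
    have "(\<rho> (iBt D q a) ^^ Suc i) (\<rho> (jA x) e) = \<rho> (jA (ract A (ract A x (?f i)) (\<lambda>y. fo h (T y)))) e"
      by (simp add: Suc \<rho>_h_shift[OF e St])
    also have "ract A (ract A x (?f i)) (\<lambda>y. fo h (T y)) = ract A x (conv A (?f i) (\<lambda>y. fo h (T y)))"
      by (simp add: A.ract_conv T_functional_clinear fun_of_clinear)
    also have "conv A (?f i) (\<lambda>y. fo h (T y)) = ?f (Suc i)"
      by (simp add: fun_eq_iff A.conv_antip_inv fun_of_clinear fun_of_times)
    finally show ?case .
  qed
  \<comment> \<open>\<open>\<rho>\<close> is known to be linear only on \<open>Uq_sl2R\<close>, so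
    membership of the partial sums in the sphere is carried through the induction.\<close>
  have lin: "\<rho> (jA (\<Sum>i\<in>I. c i *\<^sub>C ract A x (?f i))) e = (\<Sum>i\<in>I. c i *\<^sub>C \<rho> (jA (ract A x (?f i))) e)"
    if "finite I" for I and c :: "nat \<Rightarrow> complex"
  proof -
    have "(\<Sum>i\<in>I. c i *\<^sub>C ract A x (?f i)) \<in> St \<and> ?thesis"
      using that
    proof (induction I)
      case empty
      have "\<rho> (0 *\<^sub>C jA 1) e = 0"
        using is_rep_scale[OF rep Uq_jA[OF sphere_one], of 0] by simp
      then show ?case by (simp add: clinear_0[OF jA_clinear] sphere_iff clinear_0[OF A.lact_clinear[OF fun_of_clinear]])
    next
      case (insert i I)
      have add: "b + b' \<in> St" if "b \<in> St" "b' \<in> St" for b b'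
        using that by (simp add: sphere_iff clinear_add[OF A.lact_clinear[OF fun_of_clinear]] scaleC_right_distrib)
      have scale: "c i *\<^sub>C ract A x (?f i) \<in> St"
        using St[of i] by (simp add: sphere_iff clinear_scale[OF A.lact_clinear[OF fun_of_clinear]] scaleC_scaleC mult.commute)
      have "\<rho> (jA (c i *\<^sub>C ract A x (?f i))) e = c i *\<^sub>C \<rho> (jA (ract A x (?f i))) e"
        using St by (simp add: clinear_scale[OF jA_clinear] is_rep_scale[OF rep] Uq_jA)
      then show ?case
        using insert scale add by (simp add: clinear_add[OF jA_clinear] is_rep_add[OF rep] Uq_jA)
    qed
    then show ?thesis by blast
  qed
  have "ract A x (\<lambda>y. \<Sum>i\<in>I. c i * ?f i y) = (\<Sum>i\<in>I. c i *\<^sub>C ract A x (?f i))" if "finite I" for I and c :: "nat \<Rightarrow> complex"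
    using that
  proof (induction I)
    case empty
    show ?case using A.ract_scale[of x 0 \<epsilon>] by simp
  next
    case (insert i I)
    then show ?case by (simp add: A.ract_add A.ract_scale)
  qed
  from this[of "{..degree Q}" "coeff Q"] show ?thesis
    by (simp add: poly_op_def poly_fun_def pow lin)
qed

text \<open>One polynomial has to replace \<Phi>_n in two places: as an operator on
  \<open>\<rho> (jA x) e\<close>, with nodes among the weights of that vector, and as a functional,
  with nodes from a unitary corepresentation. Merging the node sets reduces the claim to
  \<open>poly_op_shift\<close>.\<close>

lemma \<pi>t_jU_shift:
  assumes e: "\<rho> (iBt D q a) e = of_real (qint q a) *\<^sub>C e" and x: "x \<in> St" and "\<omega> \<in> stab_Ic D q a"
  shows "\<pi>t (jU \<omega>) (\<rho> (jA x) e) = \<rho> (jA (ract A x (\<lambda>y. \<omega> (T y)))) e"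
  using assms(3)
proof (induction rule: stab_Ic_induct)
  case zero
  have "ract A x (\<lambda>y. 0) = 0 *\<^sub>C 1" using A.ract_scale[of x 0 \<epsilon>] by simp
  then have "\<rho> (jA (ract A x (\<lambda>y. 0))) e = 0"
    using is_rep_scale[OF rep Uq_jA[OF sphere_one], of 0] by (simp add: clinear_0[OF jA_clinear])
  then show ?case by (simp add: jU_zero \<pi>t_zero)
next
  case (step c n \<theta> \<omega>)
  let ?v = "\<rho> (jA x) e" and ?\<delta> = "\<lambda>c. if c = eigval n then 1 else 0 :: complex"
  have lin: "clinear \<theta>" "clinear \<omega>" using step is_Phi_clinear stab_Ic_clinear by blast+
  have "\<pi>t (jU \<theta>) ?v = \<rho> (jA (ract A x (\<lambda>y. \<theta> (T y)))) e"
  proof -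
    have E: "\<exists>c. \<rho> (iBt D q a) w = c *\<^sub>C w \<and> \<pi>t (jU \<theta>) w = ?\<delta> c *\<^sub>C w"
      if "w \<in> {v. \<exists>n. \<rho> (iBt D q a) v = eigval n *\<^sub>C v}" for w
      using that \<pi>t_Phi_eigenvector[OF step(1)] by blast
    have "?v \<in> cvec.span {v. \<exists>n. \<rho> (iBt D q a) v = eigval n *\<^sub>C v}"
      using weights_span by blast
    then obtain S1 where S1: "finite S1"
      "\<And>Q. (\<forall>c\<in>S1. poly Q c = ?\<delta> c) \<Longrightarrow> \<pi>t (jU \<theta>) ?v = poly_op Q (\<rho> (iBt D q a)) ?v"
      using spectral_interpolation[OF \<rho>_clinear[OF Uq_iBt] \<pi>t_clinear[OF X_jU[OF is_Phi_stab_Ic[OF step(1)]]] E]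
      by blast
    \<comment> \<open>The right translate of x evaluates the functional only at these finitely many
      elements, which come from the chosen Sweedler representation of the coproduct.\<close>
    let ?F = "(\<lambda>(y, z). T y) ` set (coprod A x)"
    obtain S2 where S2: "finite S2"
      "\<And>Q y. (\<And>c. c \<in> S2 \<Longrightarrow> poly Q c = ?\<delta> c) \<Longrightarrow> y \<in> ?F \<Longrightarrow> \<theta> y = poly_fun Q y"
      using is_Phi_poly_fun[OF step(1), of ?F] by blast
    obtain Q where Q: "\<And>c. c \<in> S1 \<union> S2 \<Longrightarrow> poly Q c = ?\<delta> c"
      using interpolation_poly[of "S1 \<union> S2" "eigval n"] S1(1) S2(1) by auto
    have "\<pi>t (jU \<theta>) ?v = poly_op Q (\<rho> (iBt D q a)) ?v"
      using Q by (intro S1(2)) auto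
    also have "\<dots> = \<rho> (jA (ract A x (\<lambda>y. poly_fun Q (T y)))) e"
      by (rule poly_op_shift[OF e x])
    also have "ract A x (\<lambda>y. poly_fun Q (T y)) = ract A x (\<lambda>y. \<theta> (T y))"
    proof -
      have "poly_fun Q (T y) = \<theta> (T y)" if "(y, z) \<in> set (coprod A x)" for y z
        using Q that by (intro S2(2)[symmetric]) (auto intro: rev_image_eqI)
      then show ?thesis unfolding ract_def by (intro arg_cong[where f = sum_list] map_cong) auto
    qed
    finally show ?thesis .
  qed
  moreover have "\<rho> (jA (ract A x (\<lambda>y. c * \<theta> (T y) + \<omega> (T y)))) e =
      c *\<^sub>C \<rho> (jA (ract A x (\<lambda>y. \<theta> (T y)))) e + \<rho> (jA (ract A x (\<lambda>y. \<omega> (T y)))) e"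
  proof -
    have Uq: "jA (ract A x (\<lambda>y. \<theta> (T y))) \<in> Uq_sl2R D q a" "jA (ract A x (\<lambda>y. \<omega> (T y))) \<in> Uq_sl2R D q a"
      by (intro Uq_jA sphere_ract x T_functional_clinear lin)+
    then have "c *\<^sub>C jA (ract A x (\<lambda>y. \<theta> (T y))) \<in> Uq_sl2R D q a"
      unfolding Uq_sl2R_def by (auto intro: star_gen.intros)
    then show ?thesis
      using Uq by (simp add: A.ract_add A.ract_scale clinear_add[OF jA_clinear] clinear_scale[OF jA_clinear]
          is_rep_add[OF rep] is_rep_scale[OF rep])
  qed
  ultimately show ?case
    using step by (simp add: \<pi>t_jU_step)
qed

text \<open>Equivariance is assumed on \<open>Uq_sl2R\<close>, whereas I_c lives only in the other
  algebra. The two meet in i B_t: the functional can be nonzero only on the weight [a], where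
  \<Phi>_n acts by its value at 1.\<close>

lemma functional_equivariant:
  assumes \<phi>: "clinear \<phi>" "\<And>x v. x \<in> Uq_sl2R D q a \<Longrightarrow> \<phi> (\<rho> x v) = eps x * \<phi> v" and y: "y \<in> X"
  shows "\<phi> (\<pi>t y v) = eps y * \<phi> v"
proof -
  have jA: "\<phi> (\<pi>t (jA b) v) = eps (jA b) * \<phi> v" if "b \<in> St" for b v
    using that by (simp add: \<pi>t_jA \<phi>(2) Uq_jA)
  have jU: "\<phi> (\<pi>t (jU \<omega>) v) = eps (jU \<omega>) * \<phi> v" if "\<omega> \<in> stab_Ic D q a" for \<omega> v
    using that
  proof (induction rule: stab_Ic_induct)
    case zero
    show ?case by (simp add: jU_zero \<pi>t_zero clinear_0[OF \<phi>(1)] clinear_0[OF epsX_clinear])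
  next
    case (step c n \<theta> \<omega>)
    have lin: "clinear \<theta>" "clinear \<omega>" using step is_Phi_clinear stab_Ic_clinear by blast+
    note \<Phi> = clinear_compose[OF \<phi>(1) \<pi>t_clinear[OF X_jU[OF is_Phi_stab_Ic[OF step(1)]]]]
    have "v \<in> cvec.span {v. \<exists>n. \<rho> (iBt D q a) v = eigval n *\<^sub>C v}"
      using weights_span by blast
    then have "\<phi> (\<pi>t (jU \<theta>) v) = \<theta> 1 * \<phi> v"
    proof (induction rule: cvec.span_induct_alt)
      case base
      show ?case using clinear_0[OF \<Phi>] clinear_0[OF \<phi>(1)] by simp
    next
      case (step d w v)
      obtain m where w: "\<rho> (iBt D q a) w = eigval m *\<^sub>C w" using step by blast
      \<comment> \<open>Computing the functional at i B_t w in two ways shows that it kills w unless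
        the weight of w equals [a].\<close>
      have "of_real (qint q a) * \<phi> w = eigval m * \<phi> w"
        using \<phi>(2)[OF Uq_iBt, of w] by (auto simp: w eps_iBt clinear_scale[OF \<phi>(1)])
      then have "\<phi> w = 0 \<or> of_real (qint q a) = eigval m" by auto
      then have "\<phi> (\<pi>t (jU \<theta>) w) = \<theta> 1 * \<phi> w"
        by (auto simp: \<pi>t_Phi_eigenvector[OF \<open>is_Phi D q a n \<theta>\<close> w] is_Phi_one[OF \<open>is_Phi D q a n \<theta>\<close>]
            clinear_scale[OF \<phi>(1)])
      then show ?case
        using step clinear_add[OF \<Phi>] clinear_scale[OF \<Phi>] by (simp add: clinear_add[OF \<phi>(1)] clinear_scale[OF \<phi>(1)] algebra_simps)
    qed
    then show ?case
      using step lin by (simp add: \<pi>t_jU_step clinear_add[OF \<phi>(1)] clinear_scale[OF \<phi>(1)] eps_jU clinear_plus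
          clinear_times_right distrib_right mult.assoc)
  qed
  \<comment> \<open>Closure under the star is a generation rule, so the claim for y and
    \<open>star y\<close> is proved jointly; at the generators it uses \<open>sphere_star\<close>
    and \<open>stab_Ic_dual_star\<close>.\<close>
  have "(\<forall>v. \<phi> (\<pi>t y v) = eps y * \<phi> v) \<and> (\<forall>v. \<phi> (\<pi>t (star y) v) = eps (star y) * \<phi> v)"
    using y unfolding Oq_stab_def
  proof (induction rule: star_gen.induct)
    case (base y)
    then consider b where "b \<in> St" "y = jA b" | \<omega> where "\<omega> \<in> stab_Ic D q a" "y = jU \<omega>" by blast
    then show ?case
    proof cases
      case 1
      then show ?thesis using sphere_star by (simp add: jA flip: jA_star)
    next
      case 2
      then show ?thesis
        using stab_Ic_dual_star by (simp add: jU stab_Ic_clinear flip: jU_star)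
    qed
  next
    case (add x y)
    then have "x \<in> X" "y \<in> X" by (simp_all add: Oq_stab_def)
    then show ?case
      using add by (simp add: is_rep_add[OF \<pi>t_rep] star_add X_star clinear_add[OF \<phi>(1)] clinear_add[OF epsX_clinear] distrib_right)
  next
    case (scale x c)
    then have "x \<in> X" by (simp add: Oq_stab_def)
    then show ?case
      using scale by (simp add: is_rep_scale[OF \<pi>t_rep] star_scaleC X_star clinear_scale[OF \<phi>(1)] clinear_scale[OF epsX_clinear])
  next
    case (mult x y)
    then have "x \<in> X" "y \<in> X" by (simp_all add: Oq_stab_def)
    then show ?case
      using mult by (simp add: is_rep_mult[OF \<pi>t_rep] star_mult X_star eps_times)
  next
    case (star x)
    then show ?case by (simp add: star_star)
  qed
  then show ?thesis by blast
qed

end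

theorem theorem4p3:
  fixes q a :: real
    and D :: "('a::star_algebra, 'u::star_algebra, 'x::star_algebra) podles"
    and s :: "'a \<Rightarrow> 'a"
    and \<rho> \<pi>t \<pi> :: "'x \<Rightarrow> 'm::complex_vector \<Rightarrow> 'm" and e :: 'm
    and h ip :: "'m \<Rightarrow> 'm \<Rightarrow> complex"
    and p :: "'m \<Rightarrow> 'l::complex_vector" and \<rho>L \<pi>L :: "'x \<Rightarrow> 'l \<Rightarrow> 'l"
    and \<rho>1 :: "'x \<Rightarrow> 'm1::complex_vector \<Rightarrow> 'm1" and e1 :: 'm1 and h1 :: "'m1 \<Rightarrow> 'm1 \<Rightarrow> complex"
    and p1 :: "'m1 \<Rightarrow> 'd1::complex_vector" and \<rho>D1 \<pi>D1 :: "'x \<Rightarrow> 'd1 \<Rightarrow> 'd1"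
    and \<rho>2 :: "'x \<Rightarrow> 'm2::complex_vector \<Rightarrow> 'm2" and e2 :: 'm2 and h2 :: "'m2 \<Rightarrow> 'm2 \<Rightarrow> complex"
    and p2 :: "'m2 \<Rightarrow> 'd2::complex_vector" and \<rho>D2 \<pi>D2 :: "'x \<Rightarrow> 'd2 \<Rightarrow> 'd2"
    and \<iota> :: "'d1 \<times> 'd2 \<Rightarrow> 'm"
  assumes q: "0 < q" "q < 1"
    and setting: "podles_setting q D"
    and s: "s = star \<or> s = id"
    \<comment> \<open>\<open>(\<rho>, e)\<close> is the universal basic module at \<open>a\<close>, with quotient \<open>\<rho>L\<close>; \<open>\<rho>D1\<close> and \<open>\<rho>D2\<close>
      are the discrete series, quotients of the universal modules at \<open>a + 2\<close> and \<open>a - 2\<close>\<close>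
    and M: "L_module D q a s (of_real (q + 1 / q)) a \<rho> e h p \<rho>L"
    and D_plus: "L_module D q a s (of_real (q + 1 / q)) (a + 2) \<rho>1 e1 h1 p1 \<rho>D1"
    and D_minus: "L_module D q a s (of_real (q + 1 / q)) (a - 2) \<rho>2 e2 h2 p2 \<rho>D2"
    and reps: "stab_rep D q a \<rho> \<pi>t" "stab_rep D q a \<rho>L \<pi>L"
      "stab_rep D q a \<rho>D1 \<pi>D1" "stab_rep D q a \<rho>D2 \<pi>D2"
    \<comment> \<open>the exact sequence, through which the sum of the discrete series is a submodule\<close>
    and exact: "short_exact (Oq_stab D q a) \<iota> p (sum_rep \<pi>D1 \<pi>D2) \<pi>t \<pi>L"
    and iota_plus: "\<forall>n. \<iota> (p1 (ladder_up D q a s (a + 2) \<rho>1 e1 n), 0) = ladder_up D q a s a \<rho> e (Suc n)"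
    and iota_minus: "\<forall>n. \<iota> (0, p2 (ladder_down D q a s (a - 2) \<rho>2 e2 n)) = ladder_down D q a s a \<rho> e (Suc n)"
    and pi: "\<forall>x\<in>Oq_stab D q a. \<forall>v. \<pi> x (\<iota> v) = \<iota> (sum_rep \<pi>D1 \<pi>D2 x v)"
    and ip: "star_rep (Oq_stab D q a) (range \<iota>) ip \<pi>"
  shows "cocycle (Oq_stab D q a) (epsX D) (range \<iota>) ip \<pi> (\<lambda>y. \<pi>t y e - epsX D y *\<^sub>C e) \<and>
    yetter_drinfeld_cocycle D q a (range \<iota>) ip \<pi> (\<lambda>b. \<pi>t (incA D b) e - counit (hopfA D) b *\<^sub>C e)"
proof -
  interpret podles_sphere q a D
    using q setting by unfold_locales
  have rep: "is_rep (Uq_sl2R D q a) UNIV \<rho>" and e: "\<rho> (iBt D q a) e = of_real (qint q a) *\<^sub>C e"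
    using M unfolding L_module_def universal_basic_module_def basic_module_def by auto
  interpret stab_module q a D \<rho> \<pi>t
    using rep reps(1) by unfold_locales
  obtain \<phi> where \<phi>: "clinear \<phi>" "\<phi> e = (1::complex)"
    "\<And>x v. x \<in> Uq_sl2R D q a \<Longrightarrow> \<phi> (\<rho> x v) = eps x * \<phi> v" "\<And>v. p v = 0 \<longleftrightarrow> \<phi> v = 0"
    using trivial_quotient[OF s M] by metis
  note equiv = functional_equivariant[OF \<phi>(1,3)]
  \<comment> \<open>By exactness the submodule is the kernel of \<open>p\<close>, hence of \<phi>;
    membership of a cocycle value thus becomes one scalar equation.\<close>
  have range: "range \<iota> = {v. \<phi> v = 0}"
    using exact \<phi>(4) unfolding short_exact_def by simp
  have \<pi>_eq: "\<pi> x v = \<pi>t x v" if "x \<in> X" "v \<in> range \<iota>" for x v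
  proof -
    obtain w where "v = \<iota> w" using \<open>v \<in> range \<iota>\<close> by blast
    then show ?thesis using pi exact \<open>x \<in> X\<close> unfolding short_exact_def by metis
  qed
  have val: "\<pi>t y e - eps y *\<^sub>C e \<in> range \<iota>" if "y \<in> X" for y
    unfolding range by (simp add: clinear_diff[OF \<phi>(1)] clinear_scale[OF \<phi>(1)] equiv that \<phi>(2))
  have cocycle: "cocycle X eps (range \<iota>) ip \<pi> (\<lambda>y. \<pi>t y e - eps y *\<^sub>C e)"
    unfolding cocycle_def
  proof (intro conjI ballI allI)
    fix x y assume xy: "x \<in> X" "y \<in> X"
    have "\<pi> x (\<pi>t y e - eps y *\<^sub>C e) = \<pi>t x (\<pi>t y e) - eps y *\<^sub>C \<pi>t x e"
      using xy by (simp add: \<pi>_eq val clinear_diff[OF \<pi>t_clinear] clinear_scale[OF \<pi>t_clinear])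
    then show "\<pi>t (x * y) e - eps (x * y) *\<^sub>C e = \<pi> x (\<pi>t y e - eps y *\<^sub>C e) + eps y *\<^sub>C (\<pi>t x e - eps x *\<^sub>C e)"
      using xy by (simp add: is_rep_mult[OF \<pi>t_rep] eps_times cvec.scale_right_diff_distrib scaleC_scaleC mult.commute)
  qed (simp_all add: ip val is_rep_add[OF \<pi>t_rep] is_rep_scale[OF \<pi>t_rep] clinear_add[OF epsX_clinear]
      clinear_scale[OF epsX_clinear] scaleC_left_distrib cvec.scale_right_diff_distrib scaleC_scaleC)
  let ?C = "\<lambda>b. \<pi>t (jA b) e - \<epsilon> b *\<^sub>C e"
  have "star_rep St (range \<iota>) ip (\<lambda>b. \<pi> (jA b))"
    using ip X_jA X_jA[OF sphere_one, unfolded jA_one] unfolding star_rep_def is_rep_def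
    by (simp add: clinear_add[OF jA_clinear] clinear_scale[OF jA_clinear] jA_times jA_star jA_one)
  then have "cocycle St \<epsilon> (range \<iota>) ip (\<lambda>b. \<pi> (jA b)) ?C"
    using cocycle X_jA unfolding cocycle_def
    by (simp add: clinear_add[OF jA_clinear] clinear_scale[OF jA_clinear] jA_times flip: eps_jA)
  moreover have "\<pi> (jU \<omega>) (?C x) = ?C (ract A x (dual_antip_inv A \<omega>))" if x: "x \<in> St" and \<omega>: "\<omega> \<in> stab_Ic D q a" for x \<omega>
  proof -
    let ?r = "ract A x (\<lambda>y. \<omega> (T y))"
    have r: "?r \<in> St"
      by (intro sphere_ract x T_functional_clinear stab_Ic_clinear \<omega>)
    have shift: "\<pi>t (jU \<omega>) (\<pi>t (jA x) e) = \<pi>t (jA ?r) e"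
      using \<pi>t_jU_shift[OF e x \<omega>] by (simp add: \<pi>t_jA x r)
    \<comment> \<open>Applying \<phi> to both sides of \<open>shift\<close> computes the counit of
      the translate, since \<phi> is equivariant and takes the value 1 at \<open>e\<close>.\<close>
    have "\<epsilon> ?r = \<phi> (\<pi>t (jA ?r) e)"
      by (simp add: equiv X_jA r \<phi>(2) eps_jA)
    also have "\<dots> = \<omega> 1 * \<epsilon> x"
      by (simp add: equiv X_jA X_jU x \<omega> \<phi>(2) eps_jA eps_jU stab_Ic_clinear flip: shift)
    finally have counit: "\<epsilon> ?r = \<omega> 1 * \<epsilon> x" .
    have "\<pi> (jU \<omega>) (?C x) = \<pi>t (jU \<omega>) (?C x)"
      using val[OF X_jA[OF x]] by (intro \<pi>_eq X_jU \<omega>) (simp add: eps_jA)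
    also have "\<dots> = \<pi>t (jA ?r) e - \<epsilon> x *\<^sub>C \<omega> 1 *\<^sub>C e"
      by (simp add: clinear_diff[OF \<pi>t_clinear] clinear_scale[OF \<pi>t_clinear] X_jU \<omega> shift \<pi>t_jU_cyclic[OF e \<omega>])
    finally show ?thesis
      by (simp add: counit dual_antip_inv_def[abs_def] scaleC_scaleC mult.commute)
  qed
  ultimately show ?thesis
    using cocycle unfolding yetter_drinfeld_cocycle_def by blast
qed

end
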